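(* Let $\mathcal{A}\subset\mathbb{P}^2$ be an arrangement of $d$ lines. Denote by $S_0(\mathcal{A})$ the set of points $P\in\mathbb{P}^2$ that are contained in at least three distinct lines of $\mathcal{A}$, and for $P\in S_0(\mathcal{A})$ let $t_P$ be the number of lines of $\mathcal{A}$ containing $P$. Assume that no line in $\mathcal{A}$ contains two or more elements of $S_0(\mathcal{A})$. Denote by $s$ the number of lines of $\mathcal{A}$ that do not contain any $P\in S_0(\mathcal{A})$. Then one has: (a) If $\mathcal{A}$ consists of $d$ concurrent lines, then it is free and the graded minimal free resolution of its Jacobian ideal has the form $$0\to S(-2d+2)\to S^2(-d+1)\to\mathrm{Jac}(f_{\mathcal{A}})\to 0.$$ (b) If $\mathcal{A}$ consists of $d-1$ lines through a point $P\in\mathbb{P}^2$ and one line that does not contain $P$, then it is free and the graded minimal free resolution of $\mathrm{Jac}(f_{\mathcal{A}})$ has the form $$0\to S(-2d+3)\oplus S(-d)\to S^3(-d+1)\to\mathrm{Jac}(f_{\mathcal{A}})\to 0.$$ (c) If $\mathcal{A}$ does not satisfy the condition in either (a) or (b), then $\mathcal{A}$ is not free, and the Milnor module $M=\mathrm{Jac}(f_{\mathcal{A}})^{sat}/\mathrm{Jac}(f_{\mathcal{A}})$ and the Jacobian ideal have graded minimal free resolutions of the form $$0\to S^{2|S_0(\mathcal{A})|+s-3}(-2d+2)\to S^{|S_0(\mathcal{A})|+s-1}(-2d+3)\oplus\bigoplus_{P\in S_0(\mathcal{A})}S(-2d+t_P+1)$$ $$\to S^{|S_0(\mathcal{A})|+s-1}(-d)\oplus\bigoplus_{P\in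 S_0(\mathcal{A})}S(-d-t_P+2)\to S^{2|S_0(\mathcal{A})|+s-3}(-d+1)\to M\to 0$$ and $$0\to S^{2|S_0(\mathcal{A})|+s-3}(-2d+2)\to S^{|S_0(\mathcal{A})|+s-1}(-2d+3)\oplus\bigoplus_{P\in S_0(\mathcal{A})}S(-2d+t_P+1)\to S^3(-d+1)\to\mathrm{Jac}(f_{\mathcal{A}})\to 0.$$
   Context: $K$ is a field of characteristic zero, $S=K[x_0,x_1,x_2]$ with the standard grading. An arrangement is a finite set of distinct lines. $f_{\mathcal{A}}$ is the product of the linear forms defining the lines of $\mathcal{A}$, $\mathrm{Jac}(f_{\mathcal{A}})$ is the ideal generated by its first partial derivatives (the Jacobian ideal), and $\mathrm{Jac}(f_{\mathcal{A}})^{sat}$ is its saturation with respect to the homogeneous maximal ideal. $\mathcal{A}$ is free if $\mathrm{Jac}(f_{\mathcal{A}})=\mathrm{Jac}(f_{\mathcal{A}})^{sat}$. Lines are concurrent if they all contain a common point.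
   Formalization: The resolution in (a) is claimed only for d ≥ 2 and the one in (b) only for d ≥ 3; it fails otherwise (two lines, P on just one: the Jacobian ideal has 2 minimal generators, not 3; d = 1: it is S; d = 0: it is 0). Freeness is claimed for every d. *)

theory Defs
  imports
    "HOL-Library.Poly_Mapping"
    "HOL-Library.Numeral_Type"
    "HOL-Library.Multiset"
    "HOL-Algebra.QuotRing"
    "HOL-Algebra.Ideal_Product"
    "HOL-Algebra.Algebraic_Closure_Type"
    "Jordan_Normal_Form.Matrix"
begin

unbundle no fps_syntax

section \<open>The polynomial ring in three variables\<close>

text \<open>The numeral type \<^typ>\<open>3\<close> has exactly the elements 0, 1, 2, so it indexes the variables
  and the homogeneous coordinates. A monomial is its exponent vector.\<close>

type_synonym 'k poly3 = "(3 \<Rightarrow>\<^sub>0 nat) \<Rightarrow>\<^sub>0 'k"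

abbreviation S_ring :: "'k::field poly3 ring" where
  "S_ring \<equiv> ring_of_type_algebra"

definition variable :: "3 \<Rightarrow> 'k::field poly3" where
  "variable i = Poly_Mapping.single (Poly_Mapping.single i 1) 1"

definition poly_eval :: "'k::field poly3 \<Rightarrow> (3 \<Rightarrow> 'k) \<Rightarrow> 'k" where
  "poly_eval p x = (\<Sum>m\<in>Poly_Mapping.keys p.
     Poly_Mapping.lookup p m * (\<Prod>i\<in>UNIV. x i ^ Poly_Mapping.lookup m i))"

text \<open>If the exponent of the variable is 0, the truncated subtraction is harmless because the
  coefficient vanishes.\<close>

definition partial_deriv :: "3 \<Rightarrow> 'k::field poly3 \<Rightarrow> 'k poly3" where
  "partial_deriv i p = (\<Sum>m\<in>Poly_Mapping.keys p.
     Poly_Mapping.single (m - Poly_Mapping.single i 1)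
       (of_nat (Poly_Mapping.lookup m i) * Poly_Mapping.lookup p m))"

text \<open>The degree is an integer, since twists are; 0 is homogeneous of every degree, and it is the
  only polynomial that is homogeneous of a negative degree.\<close>

definition homogeneous_of_degree :: "int \<Rightarrow> 'k::field poly3 \<Rightarrow> bool" where
  "homogeneous_of_degree k p \<longleftrightarrow>
     (\<forall>m\<in>Poly_Mapping.keys p. int (\<Sum>i\<in>UNIV. Poly_Mapping.lookup m i) = k)"

definition irrelevant_ideal :: "'k::field poly3 set" where
  "irrelevant_ideal = Idl\<^bsub>S_ring\<^esub> (range variable)"

definition ideal_power :: "('a, 'b) ring_scheme \<Rightarrow> 'a set \<Rightarrow> nat \<Rightarrow> 'a set" where
  "ideal_power R I n = ((\<lambda>J. ideal_prod R I J) ^^ n) (carrier R)"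

definition saturation :: "'k::field poly3 set \<Rightarrow> 'k poly3 set" where
  "saturation I = {f. \<exists>n. \<forall>g\<in>ideal_power S_ring irrelevant_ideal n. f * g \<in> I}"

definition jacobian_ideal :: "'k::field poly3 \<Rightarrow> 'k poly3 set" where
  "jacobian_ideal f = Idl\<^bsub>S_ring\<^esub> (range (\<lambda>i. partial_deriv i f))"


section \<open>Line arrangements in the projective plane\<close>

text \<open>Points are the classes of nonzero vectors modulo nonzero scalars. Lines are sets of
  points.\<close>

definition proj_rel :: "((3 \<Rightarrow> 'k::field) \<times> (3 \<Rightarrow> 'k)) set" where
  "proj_rel = {(x, y). x \<noteq> (\<lambda>_. 0) \<and> (\<exists>c. c \<noteq> 0 \<and> y = (\<lambda>i. c * x i))}"

definition proj_plane :: "(3 \<Rightarrow> 'k::field) set set" where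
  "proj_plane = {x. x \<noteq> (\<lambda>_. 0)} // proj_rel"

definition zero_locus :: "'k::field poly3 \<Rightarrow> (3 \<Rightarrow> 'k) set set" where
  "zero_locus p = {P \<in> proj_plane. \<forall>x\<in>P. poly_eval p x = 0}"

definition linear_form_of_line :: "'k::field poly3 \<Rightarrow> (3 \<Rightarrow> 'k) set set \<Rightarrow> bool" where
  "linear_form_of_line l L \<longleftrightarrow> l \<noteq> 0 \<and> homogeneous_of_degree 1 l \<and> L = zero_locus l"

definition line_arrangement :: "(3 \<Rightarrow> 'k::field) set set set \<Rightarrow> bool" where
  "line_arrangement A \<longleftrightarrow> finite A \<and> (\<forall>L\<in>A. \<exists>l. linear_form_of_line l L)"

text \<open>A linear form is determined by its line only up to a nonzero scalar, so the product of the
  linear forms is a relation rather than a function of the arrangement.\<close>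

definition arrangement_poly :: "(3 \<Rightarrow> 'k::field) set set set \<Rightarrow> 'k poly3 \<Rightarrow> bool" where
  "arrangement_poly A f \<longleftrightarrow>
     (\<exists>l. (\<forall>L\<in>A. linear_form_of_line (l L) L) \<and> f = (\<Prod>L\<in>A. l L))"

text \<open>Freeness of the arrangement with defining polynomial \<open>f\<close>.\<close>

definition free_arrangement_poly :: "'k::field poly3 \<Rightarrow> bool" where
  "free_arrangement_poly f \<longleftrightarrow> jacobian_ideal f = saturation (jacobian_ideal f)"

definition point_multiplicity :: "(3 \<Rightarrow> 'k::field) set set set \<Rightarrow> (3 \<Rightarrow> 'k) set \<Rightarrow> nat" where
  "point_multiplicity A P = card {L \<in> A. P \<in> L}"

definition multiple_points :: "(3 \<Rightarrow> 'k::field) set set set \<Rightarrow> (3 \<Rightarrow> 'k) set set" where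
  "multiple_points A = {P \<in> proj_plane. point_multiplicity A P \<ge> 3}"

definition concurrent :: "(3 \<Rightarrow> 'k::field) set set set \<Rightarrow> bool" where
  "concurrent A \<longleftrightarrow> (\<exists>P\<in>proj_plane. \<forall>L\<in>A. P \<in> L)"

definition all_but_one_through_point :: "(3 \<Rightarrow> 'k::field) set set set \<Rightarrow> bool" where
  "all_but_one_through_point A \<longleftrightarrow>
     (\<exists>P\<in>proj_plane. \<exists>L\<^sub>0\<in>A. P \<notin> L\<^sub>0 \<and> (\<forall>L\<in>A - {L\<^sub>0}. P \<in> L))"


section \<open>Graded modules and graded minimal free resolutions\<close>

record ('a, 'b) graded_module = "('a, 'b) module" +
  component :: "int \<Rightarrow> 'b set"

definition graded_hom ::
  "('a, 'b, 'x) graded_module_scheme \<Rightarrow> ('a, 'c, 'y) graded_module_scheme \<Rightarrow> ('b \<Rightarrow> 'c) \<Rightarrow> bool" where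
  "graded_hom M N h \<longleftrightarrow>
     h \<in> carrier M \<rightarrow> carrier N \<and>
     (\<forall>x\<in>carrier M. \<forall>y\<in>carrier M. h (x \<oplus>\<^bsub>M\<^esub> y) = h x \<oplus>\<^bsub>N\<^esub> h y) \<and>
     (\<forall>a. \<forall>x\<in>carrier M. h (a \<odot>\<^bsub>M\<^esub> x) = a \<odot>\<^bsub>N\<^esub> h x) \<and>
     (\<forall>k. h ` component M k \<subseteq> component N k)"

definition hom_kernel ::
  "('a, 'b, 'x) graded_module_scheme \<Rightarrow> ('a, 'c, 'y) graded_module_scheme \<Rightarrow> ('b \<Rightarrow> 'c) \<Rightarrow> 'b set" where
  "hom_kernel M N h = {x \<in> carrier M. h x = \<zero>\<^bsub>N\<^esub>}"

text \<open>For a list \<open>[a\<^sub>1, \<dots>, a\<^sub>n]\<close> of twists this is the direct sum of the \<open>S(a\<^sub>j)\<close>, where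
  \<open>S(a)\<close> has the forms of degree \<open>a + k\<close> as its component of degree \<open>k\<close>. The fields \<open>mult\<close> and
  \<open>one\<close> of a module record are irrelevant.\<close>

definition free_graded_module :: "int list \<Rightarrow> ('k::field poly3, 'k poly3 vec) graded_module" where
  "free_graded_module as =
     \<lparr>carrier = carrier_vec (length as), monoid.mult = undefined, one = undefined,
      zero = 0\<^sub>v (length as), add = (+), module.smult = (\<cdot>\<^sub>v),
      component = (\<lambda>k. {v \<in> carrier_vec (length as).
                          \<forall>j<length as. homogeneous_of_degree (as ! j + k) (v $ j)})\<rparr>"

definition ideal_module :: "'k::field poly3 set \<Rightarrow> ('k poly3, 'k poly3) graded_module" where
  "ideal_module I =
     \<lparr>carrier = I, monoid.mult = undefined, one = undefined, zero = 0, add = (+), module.smult = (*),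
      component = (\<lambda>k. {x \<in> I. homogeneous_of_degree k x})\<rparr>"

text \<open>The quotient \<open>I/J\<close> of ideals \<open>J \<subseteq> I\<close>; its elements are cosets of \<open>J\<close>, with the same operations
  as in \<^const>\<open>FactRing\<close>.\<close>

definition quotient_module ::
  "'k::field poly3 set \<Rightarrow> 'k poly3 set \<Rightarrow> ('k poly3, 'k poly3 set) graded_module" where
  "quotient_module I J =
     \<lparr>carrier = (\<lambda>x. J +>\<^bsub>S_ring\<^esub> x) ` I, monoid.mult = undefined, one = undefined,
      zero = J, add = set_add S_ring,
      module.smult = (\<lambda>a C. \<Union>x\<in>C. J +>\<^bsub>S_ring\<^esub> (a * x)),
      component = (\<lambda>k. (\<lambda>x. J +>\<^bsub>S_ring\<^esub> x) ` {x \<in> I. homogeneous_of_degree k x})\<rparr>"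

definition milnor_module :: "'k::field poly3 \<Rightarrow> ('k poly3, 'k poly3 set) graded_module" where
  "milnor_module f = quotient_module (saturation (jacobian_ideal f)) (jacobian_ideal f)"

text \<open>The list \<open>[B\<^sub>0, \<dots>, B\<^sub>r]\<close> of multisets of twists stands for the shape
  \<open>0 \<rightarrow> F\<^sub>r \<rightarrow> \<dots> \<rightarrow> F\<^sub>0 \<rightarrow> N \<rightarrow> 0\<close>, where \<open>F\<^sub>i\<close> is the direct sum of the \<open>S(b)\<close> with \<open>b\<close> in \<open>B\<^sub>i\<close>;
  note that it starts with \<open>F\<^sub>0\<close>. Beyond \<open>r\<close> all \<open>F\<^sub>i\<close> are 0, so exactness at \<open>F\<^sub>r\<close> says that
  the leftmost map is injective. Minimality says that \<open>F\<^sub>i\<^sub>+\<^sub>1\<close> is mapped into \<open>\<mm> F\<^sub>i\<close>, that is, all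
  coordinates of the images lie in the homogeneous maximal ideal \<open>\<mm>\<close>.\<close>

definition has_graded_minimal_free_resolution ::
  "('k::field poly3, 'b, 'x) graded_module_scheme \<Rightarrow> int multiset list \<Rightarrow> bool" where
  "has_graded_minimal_free_resolution N Bs \<longleftrightarrow>
     (\<exists>(tw :: nat \<Rightarrow> int list) (\<phi> :: nat \<Rightarrow> 'k poly3 vec \<Rightarrow> 'k poly3 vec) (\<epsilon> :: 'k poly3 vec \<Rightarrow> 'b).
        let F = (\<lambda>i. free_graded_module (tw i)) in
        (\<forall>i. mset (tw i) = (if i < length Bs then Bs ! i else {#})) \<and>
        graded_hom (F 0) N \<epsilon> \<and>
        (\<forall>i. graded_hom (F (Suc i)) (F i) (\<phi> i)) \<and>
        \<epsilon> ` carrier (F 0) = carrier N \<and>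
        hom_kernel (F 0) N \<epsilon> = \<phi> 0 ` carrier (F 1) \<and>
        (\<forall>i. hom_kernel (F (Suc i)) (F i) (\<phi> i) = \<phi> (Suc i) ` carrier (F (Suc (Suc i)))) \<and>
        (\<forall>i. \<forall>v\<in>carrier (F (Suc i)). \<forall>j<length (tw i). \<phi> i v $ j \<in> irrelevant_ideal))"

end

theory Submission
  imports Defs
begin

text \<open>Group the lines by the multiple point they contain; a line without multiple points is a group of
  its own. Let \<open>g\<close> be the product of the linear forms of a group and \<open>h = f / g\<close>. The ideal \<open>I\<close> generated
  by all products of \<open>h\<close> with a partial derivative of \<open>g\<close> contains the Jacobian ideal. Since linear forms
  are prime, a syzygy of these generators can be reduced modulo each group, and the syzygies turn out to be
  freely generated by the differences of the Euler relations of the groups and one Koszul relation for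
  every multiple point. So \<open>I\<close> is saturated, and as powers of the variables multiply it into
  the Jacobian ideal, it is the saturation.

  The partial derivatives of \<open>f\<close> are combinations of the generators of \<open>I\<close> with constant coefficients, the
  coefficients of the lines. In the first two cases this linear system can be solved for the generators,
  hence \<open>I\<close> is the Jacobian ideal. Otherwise the partial derivatives can be split off, which leaves a
  presentation of the Milnor module by a matrix \<open>B\<close> whose kernel is the module of syzygies of the gradient.
  This module carries the alternating pairing \<open>c\<close> with \<open>\<theta> \<times> \<eta> = c \<nabla> f\<close>. As the cokernel of \<open>B\<close>
  has finite length, the pairing identifies the transpose of \<open>B\<close> with the left end of both resolutions.\<close>

no_notation fps_nth (infixl \<open>$\<close> 75)

text \<open>The grouping works because a line contains at most one multiple point: the pencils are
  disjoint, and lines of different groups meet in double points only. So there are 2n + s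
  generators, n the number of multiple points and s that of the remaining lines, and one relation
  fewer, the shape of a Hilbert-Burch resolution. If the lines have no common point, the gradient
  replaces three generators, and 2n + s - 3 are left for M.

  The left half of the resolution of M is dual to the right half. As M has finite length, Hom(M, S),
  Ext^1(M, S) and Ext^2(M, S) vanish, so the transpose of \<open>B\<close> resolves the dual of the
  kernel of \<open>B\<close>. This kernel is the syzygy module of the gradient; it has rank two, and
  the pairing identifies it with its dual up to a shift. The vanishing is obtained by hand:
  multiplication by x_i^k factors through \<open>B\<close>, and powers of the variables form a
  regular sequence. Gluing the halves could produce nonzero constants and spoil minimality; degrees
  exclude this off the diagonal, the alternation of the pairing on it.\<close>

lemma UNIV_3: "(UNIV :: 3 set) = {0, 1, 2}"
proof -
  have "card {0, 1, 2 :: 3} = card (UNIV :: 3 set)"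
    by simp
  then show ?thesis
    by (metis card_subset_eq finite subset_UNIV)
qed

lemma sum_UNIV_3: "(\<Sum>i\<in>(UNIV :: 3 set). f i) = f 0 + f 1 + f 2"
  unfolding UNIV_3 by (simp add: add.assoc)

lemma prod_UNIV_3: "(\<Prod>i\<in>(UNIV :: 3 set). f i) = f 0 * f 1 * f 2"
  unfolding UNIV_3 by (simp add: mult.assoc)

lemma forall_3: "(\<forall>i :: 3. P i) \<longleftrightarrow> P 0 \<and> P 1 \<and> P 2"
  using UNIV_3 by (metis UNIV_I insertE singletonD)

section \<open>Terms and constant polynomials\<close>

lemma poly_mapping_sum_single:
  fixes p :: "'a \<Rightarrow>\<^sub>0 'b::comm_monoid_add"
  shows "p = (\<Sum>m\<in>Poly_Mapping.keys p. Poly_Mapping.single m (Poly_Mapping.lookup p m))"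
  by (rule poly_mapping_eqI) (auto simp: lookup_sum lookup_single when_def in_keys_iff)

text \<open>The coefficient \<open>c\<close> may be 0, so the zero polynomial needs no case of its
  own. Identities that are additive in a polynomial reduce to single terms in this way.\<close>

lemma poly_mapping_induct_add [case_names single add]:
  fixes p :: "'a \<Rightarrow>\<^sub>0 'b::comm_monoid_add"
  assumes "\<And>m c. P (Poly_Mapping.single m c)" and "\<And>p q. P p \<Longrightarrow> P q \<Longrightarrow> P (p + q)"
  shows "P p"
proof -
  have "P (\<Sum>m\<in>M. Poly_Mapping.single m (Poly_Mapping.lookup p m))" if "finite M" for M
    using that
  proof (induction M)
    case empty
    show ?case using assms(1)[of undefined 0] by simp
  qed (simp add: assms)
  then show ?thesis
    by (metis poly_mapping_sum_single finite_keys)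
qed

abbreviation Const :: "'k::field \<Rightarrow> 'k poly3" where
  "Const c \<equiv> Poly_Mapping.single 0 c"

lemma Const_add: "Const (a + b) = Const a + Const b"
  and Const_mult: "Const (a * b) = Const a * Const b"
  and Const_0: "Const 0 = 0"
  by (simp_all add: single_add mult_single)

lemma Const_sum: "Const (\<Sum>x\<in>I. a x) = (\<Sum>x\<in>I. Const (a x))"
  by (induction I rule: infinite_finite_induct) (simp_all add: Const_add)

lemma Const_eq_0_iff [simp]: "Const a = 0 \<longleftrightarrow> a = 0"
  by (metis lookup_single_eq lookup_zero Const_0)

lemma Const_of_nat: "Const (of_nat n) = of_nat n"
  by simp

lemma Const_inverse_mult: "a \<noteq> 0 \<Longrightarrow> Const (inverse a) * Const a = 1"
  by (simp add: mult_single)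

lemma variable_power: "variable i ^ n = Poly_Mapping.single (Poly_Mapping.single i n) 1"
  by (induction n) (simp_all add: variable_def mult_single single_add[symmetric])

lemma single_eq_prod:
  "Poly_Mapping.single m c = Const c * (\<Prod>i\<in>UNIV. variable i ^ Poly_Mapping.lookup m i)"
proof -
  have "m = Poly_Mapping.single 0 (Poly_Mapping.lookup m 0) + Poly_Mapping.single 1 (Poly_Mapping.lookup m 1)
      + Poly_Mapping.single 2 (Poly_Mapping.lookup m 2)" (is "_ = ?r")
  proof (rule poly_mapping_eqI)
    have "\<forall>k. Poly_Mapping.lookup m k = Poly_Mapping.lookup ?r k"
      unfolding forall_3 by (simp add: lookup_add lookup_single)
    then show "\<And>k. Poly_Mapping.lookup m k = Poly_Mapping.lookup ?r k" by blast
  qed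
  then show ?thesis
    by (simp add: prod_UNIV_3 variable_power mult_single)
qed

section \<open>Homogeneous polynomials\<close>

definition tdeg :: "(3 \<Rightarrow>\<^sub>0 nat) \<Rightarrow> nat" where
  "tdeg m = (\<Sum>i\<in>UNIV. Poly_Mapping.lookup m i)"

lemma tdeg_add: "tdeg (m + n) = tdeg m + tdeg n"
  by (simp add: tdeg_def lookup_add sum.distrib)

lemma tdeg_0 [simp]: "tdeg 0 = 0"
  by (simp add: tdeg_def)

lemma tdeg_single [simp]: "tdeg (Poly_Mapping.single i n) = n"
  by (simp add: tdeg_def lookup_single when_def)

lemma tdeg_eq_0_iff: "tdeg m = 0 \<longleftrightarrow> m = 0"
  unfolding tdeg_def by (auto intro: poly_mapping_eqI)

lemma homogeneous_iff: "homogeneous_of_degree k p \<longleftrightarrow> (\<forall>m\<in>Poly_Mapping.keys p. int (tdeg m) = k)"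
  by (simp add: homogeneous_of_degree_def tdeg_def)

lemma homogeneous_0 [simp]: "homogeneous_of_degree k 0"
  by (simp add: homogeneous_iff)

lemma homogeneous_single: "homogeneous_of_degree (int (tdeg m)) (Poly_Mapping.single m c)"
  by (auto simp: homogeneous_iff split: if_splits)

lemma homogeneous_Const: "homogeneous_of_degree 0 (Const c)"
  using homogeneous_single[of 0 c] by simp

lemma homogeneous_1: "homogeneous_of_degree 0 1"
  using homogeneous_Const[of 1] by simp

lemma homogeneous_variable: "homogeneous_of_degree 1 (variable i)"
  using homogeneous_single[of "Poly_Mapping.single i 1" 1] by (simp add: variable_def)

lemma homogeneous_add:
  "homogeneous_of_degree k p \<Longrightarrow> homogeneous_of_degree k q \<Longrightarrow> homogeneous_of_degree k (p + q)"
  using keys_add[of p q] by (fastforce simp: homogeneous_iff)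

lemma homogeneous_uminus [simp]: "homogeneous_of_degree k (- p) \<longleftrightarrow> homogeneous_of_degree k p"
  by (simp add: homogeneous_iff in_keys_iff)

lemma homogeneous_sum:
  "(\<And>x. x \<in> I \<Longrightarrow> homogeneous_of_degree k (p x)) \<Longrightarrow> homogeneous_of_degree k (\<Sum>x\<in>I. p x)"
  by (induction I rule: infinite_finite_induct) (simp_all add: homogeneous_add)

lemma homogeneous_mult:
  "homogeneous_of_degree k p \<Longrightarrow> homogeneous_of_degree l q \<Longrightarrow> homogeneous_of_degree (k + l) (p * q)"
  using keys_mult[of p q] by (fastforce simp: homogeneous_iff tdeg_add)

lemma homogeneous_mult':
  "homogeneous_of_degree k p \<Longrightarrow> homogeneous_of_degree l q \<Longrightarrow> k + l = n \<Longrightarrow> homogeneous_of_degree n (p * q)"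
  using homogeneous_mult by blast

lemma homogeneous_Const_mult:
  "homogeneous_of_degree k p \<Longrightarrow> homogeneous_of_degree k (Const c * p)"
  using homogeneous_mult[OF homogeneous_Const] by fastforce

lemma homogeneous_prod:
  assumes "finite I" "\<And>x. x \<in> I \<Longrightarrow> homogeneous_of_degree 1 (p x)"
  shows "homogeneous_of_degree (int (card I)) (\<Prod>x\<in>I. p x)"
  using assms
proof (induction I)
  case (insert x I)
  then show ?case
    by (simp) (rule homogeneous_mult, auto)
qed (simp add: homogeneous_1)

text \<open>Degrees are integers, so components of negative degree are 0. Passing to components
  replaces a solution of a homogeneous linear equation by a homogeneous solution.\<close>

definition hcomp :: "int \<Rightarrow> 'k::field poly3 \<Rightarrow> 'k poly3" where
  "hcomp k p = (\<Sum>m\<in>Poly_Mapping.keys p. Poly_Mapping.single m (Poly_Mapping.lookup p m when int (tdeg m) = k))"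

lemma lookup_hcomp: "Poly_Mapping.lookup (hcomp k p) m = (Poly_Mapping.lookup p m when int (tdeg m) = k)"
  unfolding hcomp_def lookup_sum lookup_single when_def
  by (auto simp: in_keys_iff)

lemma hcomp_add: "hcomp k (p + q) = hcomp k p + hcomp k q"
  by (rule poly_mapping_eqI) (simp add: lookup_hcomp lookup_add when_def)

lemma hcomp_0 [simp]: "hcomp k 0 = 0"
  by (simp add: hcomp_def)

lemma hcomp_sum: "hcomp k (\<Sum>x\<in>I. p x) = (\<Sum>x\<in>I. hcomp k (p x))"
  by (induction I rule: infinite_finite_induct) (simp_all add: hcomp_add)

lemma homogeneous_hcomp: "homogeneous_of_degree k (hcomp k p)"
  by (auto simp: homogeneous_iff in_keys_iff lookup_hcomp when_def split: if_splits)

lemma hcomp_homogeneous: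
  "homogeneous_of_degree l p \<Longrightarrow> hcomp k p = (if k = l then p else 0)"
  by (rule poly_mapping_eqI) (auto simp: lookup_hcomp homogeneous_iff when_def in_keys_iff)

lemma hcomp_single: "hcomp k (Poly_Mapping.single m c) = (if k = int (tdeg m) then Poly_Mapping.single m c else 0)"
  by (rule hcomp_homogeneous[OF homogeneous_single])

lemma hcomp_mult_homogeneous:
  assumes "homogeneous_of_degree l g"
  shows "hcomp (l + k) (g * p) = g * hcomp k p"
proof (induction p rule: poly_mapping_induct_add)
  case (single m c)
  have "homogeneous_of_degree (l + int (tdeg m)) (g * Poly_Mapping.single m c)"
    by (rule homogeneous_mult[OF assms homogeneous_single])
  then show ?case
    by (auto simp: hcomp_homogeneous hcomp_single)
qed (simp add: hcomp_add distrib_left)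

section \<open>Partial derivatives and Euler's identity\<close>

lemma partial_deriv_single:
  "partial_deriv i (Poly_Mapping.single m c) =
     Poly_Mapping.single (m - Poly_Mapping.single i 1) (of_nat (Poly_Mapping.lookup m i) * c)"
  by (simp add: partial_deriv_def)

lemma partial_deriv_add: "partial_deriv i (p + q) = partial_deriv i p + partial_deriv i q"
  unfolding partial_deriv_def
  by (rule setsum_keys_plus_distrib) (simp_all add: single_add distrib_left)

lemma partial_deriv_0 [simp]: "partial_deriv i 0 = 0"
  by (simp add: partial_deriv_def)

lemma partial_deriv_1 [simp]: "partial_deriv i 1 = 0"
  using partial_deriv_single[of i 0 1] by simp

lemma partial_deriv_sum: "partial_deriv i (\<Sum>x\<in>I. p x) = (\<Sum>x\<in>I. partial_deriv i (p x))"
  by (induction I rule: infinite_finite_induct) (simp_all add: partial_deriv_add)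

lemma partial_deriv_mult: "partial_deriv i (p * q) = partial_deriv i p * q + p * partial_deriv i q"
proof (induction p rule: poly_mapping_induct_add)
  case (single m a)
  show ?case
  proof (induction q rule: poly_mapping_induct_add)
    case (single n b)
    \<comment> \<open>If \<open>i\<close> does not occur in \<open>m\<close>, truncated subtraction
      may give different exponents on the two sides, but then the coefficient is 0.\<close>
    have *: "Poly_Mapping.single (m + n - Poly_Mapping.single i 1) (of_nat (Poly_Mapping.lookup m i) * c)
      = Poly_Mapping.single (m - Poly_Mapping.single i 1 + n) (of_nat (Poly_Mapping.lookup m i) * c)"
      for m n :: "3 \<Rightarrow>\<^sub>0 nat" and c :: 'a
    proof (cases "Poly_Mapping.lookup m i = 0")
      case False
      have "m + n - Poly_Mapping.single i 1 = m - Poly_Mapping.single i 1 + n"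
        using False by (intro poly_mapping_eqI) (auto simp: lookup_add lookup_minus lookup_single when_def)
      then show ?thesis by simp
    qed simp
    have "partial_deriv i (Poly_Mapping.single m a * Poly_Mapping.single n b)
      = Poly_Mapping.single (m + n - Poly_Mapping.single i 1) (of_nat (Poly_Mapping.lookup m i) * (a * b))
      + Poly_Mapping.single (n + m - Poly_Mapping.single i 1) (of_nat (Poly_Mapping.lookup n i) * (a * b))"
      by (simp add: mult_single partial_deriv_single lookup_add distrib_right single_add add.commute)
    then show ?case
      unfolding * by (simp add: mult_single partial_deriv_single mult_ac add_ac)
  qed (simp add: partial_deriv_add distrib_left)
qed (simp add: partial_deriv_add distrib_right)

lemma partial_deriv_prod:
  assumes "finite I"
  shows "partial_deriv i (\<Prod>x\<in>I. p x) = (\<Sum>x\<in>I. partial_deriv i (p x) * (\<Prod>y\<in>I - {x}. p y))"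
  using assms
proof (induction I)
  case (insert a I)
  have "(\<Prod>y\<in>insert a I - {x}. p y) = p a * (\<Prod>y\<in>I - {x}. p y)" if "x \<in> I" for x
  proof -
    have "insert a I - {x} = insert a (I - {x})" using insert that by auto
    then show ?thesis using insert by simp
  qed
  then have "(\<Sum>x\<in>I. partial_deriv i (p x) * (\<Prod>y\<in>insert a I - {x}. p y))
     = p a * (\<Sum>x\<in>I. partial_deriv i (p x) * (\<Prod>y\<in>I - {x}. p y))"
    by (simp add: sum_distrib_left mult_ac)
  with insert show ?case
    by (simp add: partial_deriv_mult)
qed simp

lemma homogeneous_partial_deriv:
  assumes "homogeneous_of_degree k p"
  shows "homogeneous_of_degree (k - 1) (partial_deriv i p)"
  unfolding partial_deriv_def
proof (rule homogeneous_sum)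
  fix m assume m: "m \<in> Poly_Mapping.keys p"
  show "homogeneous_of_degree (k - 1) (Poly_Mapping.single (m - Poly_Mapping.single i 1)
       (of_nat (Poly_Mapping.lookup m i) * Poly_Mapping.lookup p m))"
  proof (cases "Poly_Mapping.lookup m i = 0")
    case False
    then have "m = (m - Poly_Mapping.single i 1) + Poly_Mapping.single i 1"
      by (intro poly_mapping_eqI) (auto simp: lookup_add lookup_minus lookup_single when_def)
    then have "tdeg m = tdeg (m - Poly_Mapping.single i 1) + 1"
      by (metis tdeg_add tdeg_single)
    then have "int (tdeg (m - Poly_Mapping.single i 1)) = k - 1"
      using assms m by (auto simp: homogeneous_iff)
    then show ?thesis
      using homogeneous_single by metis
  qed simp
qed

lemma euler_identity:
  assumes "homogeneous_of_degree (int n) p"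
  shows "(\<Sum>i\<in>UNIV. variable i * partial_deriv i p) = of_nat n * p"
proof -
  have single: "(\<Sum>i\<in>UNIV. variable i * partial_deriv i (Poly_Mapping.single m c))
    = of_nat (tdeg m) * Poly_Mapping.single m c" for m and c :: 'a
  proof -
    have "variable i * partial_deriv i (Poly_Mapping.single m c)
        = Poly_Mapping.single m (of_nat (Poly_Mapping.lookup m i) * c)" for i
    proof (cases "Poly_Mapping.lookup m i = 0")
      case False
      then have "Poly_Mapping.single i 1 + (m - Poly_Mapping.single i 1) = m"
        by (intro poly_mapping_eqI) (auto simp: lookup_add lookup_minus lookup_single when_def)
      then show ?thesis
        by (simp add: variable_def partial_deriv_single mult_single)
    qed (simp add: partial_deriv_single)
    moreover have "of_nat (tdeg m) * Poly_Mapping.single m c = Poly_Mapping.single m (of_nat (tdeg m) * c)"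
      by (metis Const_of_nat mult_single add_0)
    moreover have "(\<Sum>i\<in>UNIV. Poly_Mapping.single m (of_nat (Poly_Mapping.lookup m i) * c)) =
      Poly_Mapping.single m (of_nat (tdeg m) * c)"
      by (simp add: tdeg_def sum_UNIV_3 single_add distrib_right)
    ultimately show ?thesis by simp
  qed
  have "(\<Sum>i\<in>UNIV. variable i * partial_deriv i p)
     = (\<Sum>m\<in>Poly_Mapping.keys p. \<Sum>i\<in>UNIV. variable i * partial_deriv i (Poly_Mapping.single m (Poly_Mapping.lookup p m)))"
    by (subst sum.swap, subst poly_mapping_sum_single[of p]) (simp add: partial_deriv_sum sum_distrib_left)
  also have "\<dots> = (\<Sum>m\<in>Poly_Mapping.keys p. of_nat n * Poly_Mapping.single m (Poly_Mapping.lookup p m))"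
    unfolding single using assms by (intro sum.cong) (auto simp: homogeneous_iff)
  also have "\<dots> = of_nat n * p"
    by (metis (no_types) sum_distrib_left poly_mapping_sum_single)
  finally show ?thesis .
qed

section \<open>Linear forms\<close>

definition lin :: "(3 \<Rightarrow> 'k::field) \<Rightarrow> 'k poly3" where
  "lin c = (\<Sum>i\<in>UNIV. Const (c i) * variable i)"

lemma homogeneous_lin: "homogeneous_of_degree 1 (lin c)"
  unfolding lin_def by (intro homogeneous_sum homogeneous_Const_mult homogeneous_variable)

lemma lookup_lin: "Poly_Mapping.lookup (lin c) (Poly_Mapping.single i 1) = c i"
proof -
  have "Poly_Mapping.single j (1::nat) = Poly_Mapping.single i 1 \<longleftrightarrow> j = i" for j :: 3
    by (metis lookup_single_eq lookup_single_not_eq zero_neq_one)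
  then show ?thesis
    by (simp add: lin_def lookup_sum variable_def mult_single lookup_single when_def)
qed

lemma lin_eq_0_iff: "lin c = 0 \<longleftrightarrow> c = (\<lambda>_. 0)"
proof
  assume "lin c = 0"
  then have "c i = 0" for i by (metis lookup_lin lookup_zero)
  then show "c = (\<lambda>_. 0)" by auto
qed (simp add: lin_def)

lemma lin_lookup:
  assumes "homogeneous_of_degree 1 l"
  shows "l = lin (\<lambda>i. Poly_Mapping.lookup l (Poly_Mapping.single i 1))"
proof -
  have deg1: "\<exists>i. m = Poly_Mapping.single i 1" if m: "tdeg m = 1" for m
  proof -
    obtain i where i: "Poly_Mapping.lookup m i \<noteq> 0"
      using m by (metis poly_mapping_eqI lookup_zero tdeg_0 zero_neq_one)
    then have "m = (m - Poly_Mapping.single i 1) + Poly_Mapping.single i 1"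
      by (intro poly_mapping_eqI) (auto simp: lookup_add lookup_minus lookup_single when_def)
    then have "tdeg (m - Poly_Mapping.single i 1) = 0"
      using m by (metis add_0 add_diff_cancel_right' diff_self_eq_0 tdeg_add tdeg_single)
    then show ?thesis
      using \<open>m = _\<close> by (metis add_0 tdeg_eq_0_iff)
  qed
  show ?thesis
  proof (rule poly_mapping_eqI)
    fix m
    show "Poly_Mapping.lookup l m = Poly_Mapping.lookup (lin (\<lambda>i. Poly_Mapping.lookup l (Poly_Mapping.single i 1))) m"
    proof (cases "tdeg m = 1")
      case True
      then show ?thesis using deg1 lookup_lin by metis
    next
      case False
      have zero: "Poly_Mapping.lookup p m = 0" if "homogeneous_of_degree 1 p" for p :: "'a poly3"
          using that False by (auto simp: homogeneous_iff in_keys_iff)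
        show ?thesis
          by (simp only: zero[OF assms] zero[OF homogeneous_lin])
    qed
  qed
qed

lemma lin_add: "lin (\<lambda>i. a i + b i) = lin a + lin b"
  by (simp add: lin_def Const_add distrib_right sum.distrib)

lemma lin_scale: "lin (\<lambda>i. r * a i) = Const r * lin a"
  by (simp add: lin_def Const_mult sum_distrib_left mult.assoc)

lemma partial_deriv_lin: "partial_deriv i (lin c) = Const (c i)"
proof -
  have "partial_deriv i (Const (c j) * variable j) = Const (c j when j = i)" for j
    by (auto simp: variable_def mult_single partial_deriv_single lookup_single when_def)
  then show ?thesis
    by (simp add: lin_def partial_deriv_sum) (simp add: when_def if_distrib sum.delta cong: if_cong)
qed

lemma poly_eval_lin: "poly_eval (lin c) x = (\<Sum>i\<in>UNIV. c i * x i)"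
proof -
  have add: "poly_eval (p + q) x = poly_eval p x + poly_eval q x" for p q :: "'a poly3"
    unfolding poly_eval_def by (rule setsum_keys_plus_distrib) (simp_all add: distrib_right)
  have monom: "poly_eval (Const a * variable j) x = a * x j" for a j
  proof -
    have "(\<Prod>i\<in>UNIV. x i ^ Poly_Mapping.lookup (Poly_Mapping.single j 1) i) = x j"
      by (simp add: lookup_single when_def if_distrib prod.delta cong: if_cong)
    then show ?thesis
      by (auto simp: variable_def mult_single poly_eval_def)
  qed
  show ?thesis
    by (simp add: lin_def sum_UNIV_3 add monom)
qed

section \<open>Substitution and primality of linear forms\<close>

definition psubst :: "(3 \<Rightarrow> 'k::field poly3) \<Rightarrow> 'k poly3 \<Rightarrow> 'k poly3" where
  "psubst \<sigma> p = (\<Sum>m\<in>Poly_Mapping.keys p. Const (Poly_Mapping.lookup p m) * (\<Prod>i\<in>UNIV. \<sigma> i ^ Poly_Mapping.lookup m i))"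

lemma psubst_single: "psubst \<sigma> (Poly_Mapping.single m c) = Const c * (\<Prod>i\<in>UNIV. \<sigma> i ^ Poly_Mapping.lookup m i)"
  by (simp add: psubst_def)

lemma psubst_add: "psubst \<sigma> (p + q) = psubst \<sigma> p + psubst \<sigma> q"
  unfolding psubst_def by (rule setsum_keys_plus_distrib) (simp_all add: Const_add distrib_right)

lemma psubst_0 [simp]: "psubst \<sigma> 0 = 0"
  by (simp add: psubst_def)

lemma psubst_mult: "psubst \<sigma> (p * q) = psubst \<sigma> p * psubst \<sigma> q"
proof (induction p rule: poly_mapping_induct_add)
  case (single m a)
  show ?case
  proof (induction q rule: poly_mapping_induct_add)
    case (single n b)
    show ?case
      unfolding mult_single[of m a n b] psubst_single lookup_add power_add prod.distrib Const_mult
      by (simp only: mult_ac)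
  qed (simp add: psubst_add distrib_left)
qed (simp add: psubst_add distrib_right)

lemma psubst_variable: "psubst \<sigma> (variable i) = \<sigma> i"
  by (simp add: variable_def psubst_single lookup_single when_def if_distrib prod.delta cong: if_cong)

lemma psubst_Const: "psubst \<sigma> (Const c) = Const c"
  by (simp add: psubst_single)

lemma psubst_sum: "psubst \<sigma> (\<Sum>x\<in>I. p x) = (\<Sum>x\<in>I. psubst \<sigma> (p x))"
  by (induction I rule: infinite_finite_induct) (simp_all add: psubst_add)

lemma psubst_lin: "psubst \<sigma> (lin c) = (\<Sum>i\<in>UNIV. Const (c i) * \<sigma> i)"
  by (simp add: lin_def psubst_sum psubst_mult psubst_Const psubst_variable)

lemma dvd_diff_mult: "l dvd a - a' \<Longrightarrow> l dvd b - b' \<Longrightarrow> l dvd a * b - a' * (b' :: 'a::comm_ring_1)"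
proof -
  assume "l dvd a - a'" "l dvd b - b'"
  moreover have "a * b - a' * b' = (a - a') * b + a' * (b - b')"
    by (simp add: algebra_simps)
  ultimately show ?thesis by simp
qed

lemma dvd_diff_power: "l dvd a - a' \<Longrightarrow> l dvd a ^ n - (a' :: 'a::comm_ring_1) ^ n"
  by (induction n) (simp_all add: dvd_diff_mult)

text \<open>The substitution is a ring homomorphism that is the identity modulo \<open>l\<close> on
  the variables, hence on all polynomials.\<close>

lemma dvd_diff_psubst:
  assumes "\<And>i. l dvd variable i - \<sigma> i"
  shows "l dvd p - psubst \<sigma> p"
proof (induction p rule: poly_mapping_induct_add)
  case (single m c)
  have "l dvd Const c * (\<Prod>i\<in>UNIV. variable i ^ Poly_Mapping.lookup m i) - Const c * (\<Prod>i\<in>UNIV. \<sigma> i ^ Poly_Mapping.lookup m i)"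
    unfolding prod_UNIV_3 by (intro dvd_diff_mult dvd_diff_power assms) auto
  then show ?case
    by (simp only: psubst_single single_eq_prod[of m c, symmetric])
next
  case (add p q)
  have "p + q - psubst \<sigma> (p + q) = (p - psubst \<sigma> p) + (q - psubst \<sigma> q)"
    by (simp add: psubst_add)
  then show ?case
    using dvd_add[OF add] by (simp only:)
qed

text \<open>\<open>\<sigma>\<close> solves \<open>lin c = 0\<close> for one of the variables.\<close>

lemma lin_kernel_obtain:
  assumes "c \<noteq> (\<lambda>_. 0)"
  obtains \<sigma> where "\<And>p. lin c dvd p \<longleftrightarrow> psubst \<sigma> p = 0"
proof -
  obtain i where i: "c i \<noteq> 0"
    using assms by auto
  define \<sigma> where "\<sigma> = (\<lambda>j. variable j - (if j = i then Const (inverse (c i)) * lin c else 0))"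
  have dvd: "lin c dvd p - psubst \<sigma> p" for p
    by (rule dvd_diff_psubst) (simp add: \<sigma>_def)
  have "psubst \<sigma> (lin c) = (\<Sum>j\<in>UNIV. Const (c j) * variable j)
     - (\<Sum>j\<in>UNIV. Const (c j) * (if j = i then Const (inverse (c i)) * lin c else 0))"
    by (simp add: psubst_lin \<sigma>_def right_diff_distrib sum_subtractf)
  also have "\<dots> = lin c - Const (c i) * (Const (inverse (c i)) * lin c)"
    by (simp add: lin_def if_distrib sum.delta cong: if_cong)
  also have "\<dots> = 0"
    using i by (simp add: mult.assoc[symmetric] mult_single)
  finally have zero: "psubst \<sigma> (lin c) = 0" .
  have "lin c dvd p \<longleftrightarrow> psubst \<sigma> p = 0" for p
    using dvd[of p] zero by (auto simp: psubst_mult elim!: dvdE)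
  then show ?thesis using that by blast
qed

text \<open>By the substitution that solves for one variable, \<open>lin c\<close> generates the
  kernel of a ring homomorphism into a domain, so it is prime.\<close>

lemma lin_dvd_mult:
  assumes "c \<noteq> (\<lambda>_. 0)" "lin c dvd p * q"
  shows "lin c dvd p \<or> lin c dvd q"
proof -
  obtain \<sigma> where "\<And>p. lin c dvd p \<longleftrightarrow> psubst \<sigma> p = 0"
    using lin_kernel_obtain[OF assms(1)] by blast
  with assms(2) show ?thesis by (simp add: psubst_mult)
qed

lemma lin_dvd_prod:
  assumes "c \<noteq> (\<lambda>_. 0)" "finite I" "lin c dvd (\<Prod>x\<in>I. p x)"
  shows "\<exists>x\<in>I. lin c dvd p x"
  using assms(2,3)
proof (induction I)
  case empty
  obtain \<sigma> where \<sigma>: "\<And>p. lin c dvd p \<longleftrightarrow> psubst \<sigma> p = 0"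
    using lin_kernel_obtain[OF assms(1)] by blast
  have "psubst \<sigma> 1 = 1"
    using psubst_Const[of \<sigma> 1] by simp
  then show ?case
    using empty \<sigma>[of 1] by simp
next
  case (insert x I)
  then show ?case using lin_dvd_mult[OF assms(1)] by auto
qed

text \<open>Comparing degrees, the cofactor may be replaced by its component of degree 0, a
  constant.\<close>

lemma lin_dvd_lin:
  assumes "lin c dvd lin c'"
  shows "\<exists>r. c' = (\<lambda>i. r * c i)"
proof -
  obtain q where q: "lin c' = lin c * q" using assms by blast
  have "lin c' = lin c * hcomp 0 q"
    using hcomp_mult_homogeneous[OF homogeneous_lin[of c], of 0 q]
    unfolding q[symmetric] hcomp_homogeneous[OF homogeneous_lin] by simp
  moreover have "hcomp 0 q = Const (Poly_Mapping.lookup q 0)"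
    by (rule poly_mapping_eqI) (auto simp: lookup_hcomp lookup_single when_def tdeg_eq_0_iff)
  ultimately have "lin c' = lin (\<lambda>i. Poly_Mapping.lookup q 0 * c i)"
    by (simp only: lin_scale mult.commute[of "lin c"])
  then have "c' = (\<lambda>i. Poly_Mapping.lookup q 0 * c i)"
    by (metis lookup_lin ext)
  then show ?thesis by blast
qed

unbundle no fps_syntax

section \<open>Powers of the variables\<close>

lemma variable_neq_0 [simp]: "variable i \<noteq> 0"
  by (metis variable_def lookup_single_eq lookup_zero zero_neq_one)

lemma lookup_variable_power_mult:
  "Poly_Mapping.lookup (variable i ^ k * p) m =
     (if k \<le> Poly_Mapping.lookup m i then Poly_Mapping.lookup p (m - Poly_Mapping.single i k) else 0)"
proof (induction p rule: poly_mapping_induct_add)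
  case (single n c)
  have "Poly_Mapping.single i k + n = m \<longleftrightarrow> k \<le> Poly_Mapping.lookup m i \<and> n = m - Poly_Mapping.single i k"
  proof
    assume "Poly_Mapping.single i k + n = m"
    then show "k \<le> Poly_Mapping.lookup m i \<and> n = m - Poly_Mapping.single i k"
      by (auto simp: lookup_add)
  next
    assume "k \<le> Poly_Mapping.lookup m i \<and> n = m - Poly_Mapping.single i k"
    then show "Poly_Mapping.single i k + n = m"
      by (intro poly_mapping_eqI) (auto simp: lookup_add lookup_minus lookup_single when_def)
  qed
  then show ?case
    by (auto simp: variable_power mult_single lookup_single when_def)
qed (simp add: distrib_left lookup_add)

text \<open>The reduced remainders modulo \<open>variable i ^ k\<close>. Multiplication by another
  variable preserves them, which is the source of the regular sequences below.\<close>

definition exponents_below :: "3 \<Rightarrow> nat \<Rightarrow> 'k::field poly3 \<Rightarrow> bool" where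
  "exponents_below i k p \<longleftrightarrow> (\<forall>m\<in>Poly_Mapping.keys p. Poly_Mapping.lookup m i < k)"

lemma exponents_below_add:
  "exponents_below i k p \<Longrightarrow> exponents_below i k q \<Longrightarrow> exponents_below i k (p + q)"
  using keys_add[of p q] by (auto simp: exponents_below_def)

lemma exponents_below_variable_power_mult:
  assumes "exponents_below i k p" "j \<noteq> i"
  shows "exponents_below i k (variable j ^ l * p)"
  using assms keys_mult[of "variable j ^ l" p]
  by (fastforce simp: exponents_below_def variable_power lookup_add lookup_single)

lemma exponents_below_decompose:
  "\<exists>q r. p = variable i ^ k * q + r \<and> exponents_below i k r"
proof (induction p rule: poly_mapping_induct_add)
  case (single m c)
  show ?case
  proof (cases "Poly_Mapping.lookup m i < k")
    case True
    then have "Poly_Mapping.single m c = variable i ^ k * 0 + Poly_Mapping.single m c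
        \<and> exponents_below i k (Poly_Mapping.single m c)"
      by (simp add: exponents_below_def)
    then show ?thesis by blast
  next
    case False
    then have "Poly_Mapping.single i k + (m - Poly_Mapping.single i k) = m"
      by (intro poly_mapping_eqI) (auto simp: lookup_add lookup_minus lookup_single when_def)
    then have "Poly_Mapping.single m c = variable i ^ k * Poly_Mapping.single (m - Poly_Mapping.single i k) c + 0
        \<and> exponents_below i k (0 :: 'a poly3)"
      by (simp add: exponents_below_def variable_power mult_single)
    then show ?thesis by blast
  qed
next
  case (add p q)
  then obtain a b c d where "p = variable i ^ k * a + b" "exponents_below i k b"
    "q = variable i ^ k * c + d" "exponents_below i k d" by blast
  then have "p + q = variable i ^ k * (a + c) + (b + d) \<and> exponents_below i k (b + d)"
    by (simp add: exponents_below_add algebra_simps)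
  then show ?case by blast
qed

lemma exponents_below_unique:
  assumes "variable i ^ k * q + r = 0" "exponents_below i k r"
  shows "q = 0" and "r = 0"
proof -
  show "r = 0"
  proof (rule poly_mapping_eqI)
    fix m
    have "Poly_Mapping.lookup (variable i ^ k * q) m + Poly_Mapping.lookup r m = 0"
      using assms(1) by (metis lookup_add lookup_zero)
    then show "Poly_Mapping.lookup r m = Poly_Mapping.lookup 0 m"
      using assms(2) not_in_keys_iff_lookup_eq_zero[of m r] unfolding exponents_below_def
      by (cases "k \<le> Poly_Mapping.lookup m i") (auto simp: lookup_variable_power_mult)
  qed
  then show "q = 0"
    using assms(1) by simp
qed

text \<open>Dividing \<open>b\<close> by \<open>variable i ^ k\<close> leaves a remainder whose
  product with \<open>variable j ^ l\<close> is still reduced; by uniqueness of remainders it is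
  0.\<close>

lemma variable_powers_regular2:
  assumes "i \<noteq> j" "variable i ^ k * a = variable j ^ l * b"
  obtains c where "a = variable j ^ l * c" "b = variable i ^ k * c"
proof -
  obtain q r where qr: "b = variable i ^ k * q + r" "exponents_below i k r"
    using exponents_below_decompose by blast
  have "variable i ^ k * (variable j ^ l * q - a) + variable j ^ l * r = 0"
    using assms(2) by (simp add: qr(1) algebra_simps)
  from exponents_below_unique[OF this exponents_below_variable_power_mult[OF qr(2)]] assms(1)
  have "a = variable j ^ l * q" "r = 0" by auto
  with qr(1) show ?thesis by (intro that[of q]) simp_all
qed

text \<open>Regularity of the third power modulo the first two. Taking remainders of
  \<open>b\<close> and \<open>c\<close> modulo \<open>variable 0 ^ k\<close> leaves a relation
  between two powers only.\<close>

lemma variable_powers_regular3: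
  assumes "variable 0 ^ k * a + variable 1 ^ k * b + variable 2 ^ k * c = 0"
  obtains s t where "c = variable 0 ^ k * s + variable 1 ^ k * t"
proof -
  obtain b1 rb where b: "b = variable 0 ^ k * b1 + rb" "exponents_below 0 k rb"
    using exponents_below_decompose by blast
  obtain c1 rc where c: "c = variable 0 ^ k * c1 + rc" "exponents_below 0 k rc"
    using exponents_below_decompose by blast
  have "variable 0 ^ k * (a + variable 1 ^ k * b1 + variable 2 ^ k * c1)
      + (variable 1 ^ k * rb + variable 2 ^ k * rc) = 0"
    using assms by (simp add: b(1) c(1) algebra_simps)
  from exponents_below_unique(2)[OF this] b(2) c(2)
  have "variable 1 ^ k * rb = variable 2 ^ k * (- rc)"
    by (simp add: exponents_below_add exponents_below_variable_power_mult eq_neg_iff_add_eq_0)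
  then obtain e where "- rc = variable 1 ^ k * e"
    by (rule variable_powers_regular2[rotated]) auto
  then have "c = variable 0 ^ k * c1 + variable 1 ^ k * (- e)"
    unfolding c(1) by (metis add.inverse_inverse mult_minus_right)
  with that show ?thesis by blast
qed

section \<open>Cokernels of injective maps have no torsion at the origin\<close>

lemma smult_vec_cancel:
  fixes u v :: "'k::field poly3 vec"
  assumes "u \<in> carrier_vec n" "v \<in> carrier_vec n" "c \<cdot>\<^sub>v u = c \<cdot>\<^sub>v v" "c \<noteq> 0"
  shows "u = v"
proof (rule eq_vecI)
  fix i assume "i < dim_vec v"
  then have "c * u $ i = c * v $ i"
    using assms by (metis carrier_vecD index_smult_vec(1))
  then show "u $ i = v $ i" using assms(4) by simp
qed (use assms in simp)

lemma mult_mat_smult_vec: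
  fixes A :: "'a::comm_semiring_0 mat"
  assumes "A \<in> carrier_mat nr nc" "v \<in> carrier_vec nc"
  shows "A *\<^sub>v (k \<cdot>\<^sub>v v) = k \<cdot>\<^sub>v (A *\<^sub>v v)"
  using assms by (intro eq_vecI) (auto simp: scalar_prod_def sum_distrib_left mult.left_commute)

text \<open>If \<open>0 \<rightarrow> S\<^sup>a \<rightarrow> S\<^sup>b \<rightarrow> S\<^sup>c\<close> is exact, the image of the last map has projective dimension at most
  one, so the cokernel has no elements annihilated by powers of all variables. The proof
  is a diagram chase with the Koszul complex of the powers.\<close>

lemma saturated_image:
  fixes \<alpha> \<gamma> :: "'k::field poly3 mat"
  assumes \<alpha>: "\<alpha> \<in> carrier_mat b a" and \<gamma>: "\<gamma> \<in> carrier_mat c b"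
    and inj: "\<And>w. w \<in> carrier_vec a \<Longrightarrow> \<alpha> *\<^sub>v w = 0\<^sub>v b \<Longrightarrow> w = 0\<^sub>v a"
    and comp: "\<And>w. w \<in> carrier_vec a \<Longrightarrow> \<gamma> *\<^sub>v (\<alpha> *\<^sub>v w) = 0\<^sub>v c"
    and exact: "\<And>v. v \<in> carrier_vec b \<Longrightarrow> \<gamma> *\<^sub>v v = 0\<^sub>v c \<Longrightarrow> \<exists>w\<in>carrier_vec a. v = \<alpha> *\<^sub>v w"
    and u: "u \<in> carrier_vec c"
    and torsion: "\<And>i. \<exists>v\<in>carrier_vec b. \<gamma> *\<^sub>v v = variable i ^ k \<cdot>\<^sub>v u"
  shows "\<exists>v\<in>carrier_vec b. \<gamma> *\<^sub>v v = u"
proof -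
  define x where "x = (\<lambda>i :: 3. variable i ^ k :: 'k poly3)"
  obtain v where v: "\<And>i. v i \<in> carrier_vec b" "\<And>i. \<gamma> *\<^sub>v v i = x i \<cdot>\<^sub>v u"
    using torsion unfolding x_def by metis
  \<comment> \<open>The Koszul relation between two of the equations for \<open>u\<close>: it lies
    in the kernel of \<open>\<gamma>\<close> and is lifted through \<open>\<alpha>\<close>.\<close>
  have "\<exists>w\<in>carrier_vec a. x j \<cdot>\<^sub>v v i - x i \<cdot>\<^sub>v v j = \<alpha> *\<^sub>v w" for i j
  proof (rule exact)
    have "\<gamma> *\<^sub>v (x j \<cdot>\<^sub>v v i - x i \<cdot>\<^sub>v v j) = x j \<cdot>\<^sub>v (\<gamma> *\<^sub>v v i) - x i \<cdot>\<^sub>v (\<gamma> *\<^sub>v v j)"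
      using \<gamma> v(1) by (simp add: mult_minus_distrib_mat_vec[of _ c b] mult_mat_smult_vec[of _ c b])
    then show "\<gamma> *\<^sub>v (x j \<cdot>\<^sub>v v i - x i \<cdot>\<^sub>v v j) = 0\<^sub>v c"
      unfolding v(2) using u by (auto simp: algebra_simps)
  qed (use v in auto)
  then have ex: "\<exists>w. w \<in> carrier_vec a \<and> x j \<cdot>\<^sub>v v i - x i \<cdot>\<^sub>v v j = \<alpha> *\<^sub>v w" for i j
    by blast
  define w where "w = (\<lambda>i j. SOME w. w \<in> carrier_vec a \<and> x j \<cdot>\<^sub>v v i - x i \<cdot>\<^sub>v v j = \<alpha> *\<^sub>v w)"
  have w: "w i j \<in> carrier_vec a" "x j \<cdot>\<^sub>v v i - x i \<cdot>\<^sub>v v j = \<alpha> *\<^sub>v w i j" for i j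
    using someI_ex[OF ex[of j i]] unfolding w_def by auto
  \<comment> \<open>The alternating sum of the three Koszul relations vanishes, and injectivity of
    \<open>\<alpha>\<close> carries this over to their lifts.\<close>
  have "x 0 \<cdot>\<^sub>v w 1 2 + (- x 1) \<cdot>\<^sub>v w 0 2 + x 2 \<cdot>\<^sub>v w 0 1 = 0\<^sub>v a"
  proof (rule inj)
    have "\<alpha> *\<^sub>v (x 0 \<cdot>\<^sub>v w 1 2 + (- x 1) \<cdot>\<^sub>v w 0 2 + x 2 \<cdot>\<^sub>v w 0 1)
       = x 0 \<cdot>\<^sub>v (\<alpha> *\<^sub>v w 1 2) + (- x 1) \<cdot>\<^sub>v (\<alpha> *\<^sub>v w 0 2) + x 2 \<cdot>\<^sub>v (\<alpha> *\<^sub>v w 0 1)"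
      using \<alpha> w(1) by (simp add: mult_add_distrib_mat_vec[of _ b a] mult_mat_smult_vec[of _ b a])
    also have "\<dots> = 0\<^sub>v b"
      unfolding w(2)[symmetric] using v(1) by (intro eq_vecI) (auto simp: algebra_simps carrier_vecD[OF v(1)])
    finally show "\<alpha> *\<^sub>v (x 0 \<cdot>\<^sub>v w 1 2 + (- x 1) \<cdot>\<^sub>v w 0 2 + x 2 \<cdot>\<^sub>v w 0 1) = 0\<^sub>v b" .
  qed (use w in auto)
  then have eq: "x 0 * w 1 2 $ e + x 1 * (- w 0 2 $ e) + x 2 * w 0 1 $ e = 0" if "e < a" for e
  proof -
    assume *: "x 0 \<cdot>\<^sub>v w 1 2 + (- x 1) \<cdot>\<^sub>v w 0 2 + x 2 \<cdot>\<^sub>v w 0 1 = 0\<^sub>v a"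
    have "(x 0 \<cdot>\<^sub>v w 1 2 + (- x 1) \<cdot>\<^sub>v w 0 2 + x 2 \<cdot>\<^sub>v w 0 1) $ e = 0"
      unfolding * using that by simp
    then show ?thesis
      using that by (simp add: carrier_vecD[OF w(1)])
  qed
  \<comment> \<open>By regularity \<open>w 0 1\<close> splits into \<open>x 0\<close> times
    \<open>S\<close> and \<open>x 1\<close> times \<open>T\<close>; these parts correct
    \<open>v 1\<close> and \<open>v 0\<close>.\<close>
  have "\<exists>s t. w 0 1 $ e = x 0 * s + x 1 * t" if "e < a" for e
    using variable_powers_regular3[OF eq[OF that, unfolded x_def]] unfolding x_def by metis
  then obtain s t where st: "\<And>e. e < a \<Longrightarrow> w 0 1 $ e = x 0 * s e + x 1 * t e"
    by metis
  define S T where "S = vec a s" and "T = vec a t"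
  have ST: "S \<in> carrier_vec a" "T \<in> carrier_vec a" by (auto simp: S_def T_def)
  have "w 0 1 = x 0 \<cdot>\<^sub>v S + x 1 \<cdot>\<^sub>v T"
    by (intro eq_vecI) (auto simp: S_def T_def st carrier_vecD[OF w(1)])
  then have "x 1 \<cdot>\<^sub>v v 0 - x 0 \<cdot>\<^sub>v v 1 = x 0 \<cdot>\<^sub>v (\<alpha> *\<^sub>v S) + x 1 \<cdot>\<^sub>v (\<alpha> *\<^sub>v T)"
    unfolding w(2) using \<alpha> ST by (simp add: mult_add_distrib_mat_vec[of _ b a] mult_mat_smult_vec[of _ b a])
  then have *: "(x 1 \<cdot>\<^sub>v v 0 - x 0 \<cdot>\<^sub>v v 1) $ e = (x 0 \<cdot>\<^sub>v (\<alpha> *\<^sub>v S) + x 1 \<cdot>\<^sub>v (\<alpha> *\<^sub>v T)) $ e" for e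
    by simp
  have "x 0 * (v 1 $ e + (\<alpha> *\<^sub>v S) $ e) = x 1 * (v 0 $ e - (\<alpha> *\<^sub>v T) $ e)" if "e < b" for e
    using *[of e] that \<alpha> by (simp add: carrier_vecD[OF v(1)] algebra_simps)
  then have "\<exists>c. v 0 $ e - (\<alpha> *\<^sub>v T) $ e = x 0 * c" if "e < b" for e
    using variable_powers_regular2[of 0 1 k "v 1 $ e + (\<alpha> *\<^sub>v S) $ e" k] that unfolding x_def
    by (metis zero_neq_one)
  \<comment> \<open>The corrected \<open>v 0\<close> is divisible by \<open>x 0\<close>. As
    \<open>\<gamma>\<close> vanishes on the image of \<open>\<alpha>\<close>, the correction does
    not change its image, so the quotient is a preimage of \<open>u\<close>.\<close>
  then obtain y where y: "\<And>e. e < b \<Longrightarrow> v 0 $ e - (\<alpha> *\<^sub>v T) $ e = x 0 * y e"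
    by metis
  have Y: "v 0 - \<alpha> *\<^sub>v T = x 0 \<cdot>\<^sub>v vec b y"
  proof (rule eq_vecI)
    fix e assume "e < dim_vec (x 0 \<cdot>\<^sub>v vec b y)"
    then show "(v 0 - \<alpha> *\<^sub>v T) $ e = (x 0 \<cdot>\<^sub>v vec b y) $ e"
      using \<alpha> y[of e] by simp
  qed (use \<alpha> in simp)
  have "x 0 \<cdot>\<^sub>v (\<gamma> *\<^sub>v vec b y) = \<gamma> *\<^sub>v (v 0 - \<alpha> *\<^sub>v T)"
    unfolding Y using \<gamma> by (simp add: mult_mat_smult_vec[of _ c b])
  also have "\<dots> = x 0 \<cdot>\<^sub>v u"
    unfolding mult_minus_distrib_mat_vec[OF \<gamma> v(1) mult_mat_vec_carrier[OF \<alpha> ST(2)]] comp[OF ST(2)] v(2)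
    using u by (intro eq_vecI) auto
  finally have "\<gamma> *\<^sub>v vec b y = u"
    using \<gamma> by (intro smult_vec_cancel[OF _ u, of _ "x 0"]) (auto simp: x_def)
  then show ?thesis by (intro bexI[of _ "vec b y"]) auto
qed

section \<open>Ideals\<close>

lemma S_ring_simps [simp]:
  "carrier (S_ring :: 'k::field poly3 ring) = UNIV"
  "a \<otimes>\<^bsub>S_ring\<^esub> b = (a :: 'k poly3) * b"
  "a \<oplus>\<^bsub>S_ring\<^esub> b = a + b"
  "\<zero>\<^bsub>S_ring\<^esub> = (0 :: 'k poly3)"
  "\<one>\<^bsub>S_ring\<^esub> = (1 :: 'k poly3)"
  by (simp_all add: ring_of_type_algebra_def)

lemma cring_S_ring: "cring (S_ring :: 'k::field poly3 ring)"
  by (rule cring_from_type_algebra)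

lemma ring_S_ring: "ring (S_ring :: 'k::field poly3 ring)"
  by (rule ring_from_type_algebra)

lemma S_ring_idealI:
  fixes I :: "'k::field poly3 set"
  assumes "0 \<in> I" "\<And>a b. a \<in> I \<Longrightarrow> b \<in> I \<Longrightarrow> a + b \<in> I" "\<And>a b. a \<in> I \<Longrightarrow> b * a \<in> I"
  shows "ideal I S_ring"
proof (rule idealI[OF ring_S_ring])
  interpret S: ring "S_ring :: 'k poly3 ring" by (rule ring_S_ring)
  have inv: "\<ominus>\<^bsub>S_ring\<^esub> a = - a" for a :: "'k poly3"
    by (rule S.minus_equality) auto
  show "subgroup I (add_monoid S_ring)"
  proof
    fix a assume "a \<in> I"
    then have "- 1 * a \<in> I" by (rule assms(3))
    then show "inv\<^bsub>add_monoid S_ring\<^esub> a \<in> I"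
      using inv[of a] by (simp add: a_inv_def)
  qed (use assms in auto)
qed (use assms in \<open>auto simp: mult.commute\<close>)

lemma S_ring_ideal_add: "ideal I S_ring \<Longrightarrow> a \<in> I \<Longrightarrow> b \<in> I \<Longrightarrow> a + b \<in> I"
  using additive_subgroup.a_closed[OF ideal.axioms(1), of I S_ring a b] by simp

lemma S_ring_ideal_0: "ideal I S_ring \<Longrightarrow> 0 \<in> I"
  using additive_subgroup.zero_closed[OF ideal.axioms(1), of I S_ring] by simp

lemma S_ring_ideal_mult: "ideal I S_ring \<Longrightarrow> a \<in> I \<Longrightarrow> b * a \<in> I"
  using ideal.I_l_closed[of I S_ring a b] by simp

lemma S_ring_ideal_sum:
  "ideal I S_ring \<Longrightarrow> (\<And>x. x \<in> F \<Longrightarrow> p x \<in> I) \<Longrightarrow> (\<Sum>x\<in>F. p x) \<in> I"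
  by (induction F rule: infinite_finite_induct) (simp_all add: S_ring_ideal_0 S_ring_ideal_add)

lemma S_ring_ideal_diff: "ideal I S_ring \<Longrightarrow> a \<in> I \<Longrightarrow> b \<in> I \<Longrightarrow> a - b \<in> I"
  using S_ring_ideal_add[of I a "- 1 * b"] S_ring_ideal_mult[of I b "- 1"] by simp

lemma genideal_range:
  fixes g :: "3 \<Rightarrow> 'k::field poly3"
  shows "Idl\<^bsub>S_ring\<^esub> (range g) = {p. \<exists>\<theta>. p = (\<Sum>i\<in>UNIV. \<theta> i * g i)}" (is "_ = ?I")
proof -
  interpret S: cring "S_ring :: 'k poly3 ring" by (rule cring_S_ring)
  have "ideal ?I S_ring"
  proof (rule S_ring_idealI)
    show "0 \<in> ?I" by (auto intro: exI[of _ "\<lambda>_. 0"])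
    show "a + b \<in> ?I" if "a \<in> ?I" "b \<in> ?I" for a b
    proof -
      from that obtain s t where "a = (\<Sum>i\<in>UNIV. s i * g i)" "b = (\<Sum>i\<in>UNIV. t i * g i)" by blast
      then have "a + b = (\<Sum>i\<in>UNIV. (s i + t i) * g i)"
        by (simp add: distrib_right sum.distrib)
      then show ?thesis by (intro CollectI exI)
    qed
    show "b * a \<in> ?I" if "a \<in> ?I" for a b
    proof -
      from that obtain s where "a = (\<Sum>i\<in>UNIV. s i * g i)" by blast
      then have "b * a = (\<Sum>i\<in>UNIV. (b * s i) * g i)"
        by (simp add: sum_distrib_left mult.assoc)
      then show ?thesis by (intro CollectI exI)
    qed
  qed
  moreover have "range g \<subseteq> ?I"
  proof
    fix p assume "p \<in> range g"
    then obtain j where "p = g j" by blast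
    then have "p = (\<Sum>i\<in>UNIV. (if i = j then 1 else 0) * g i)"
      by (simp add: if_distrib[of "\<lambda>x. x * _"] sum.delta cong: if_cong)
    then show "p \<in> ?I" by (intro CollectI exI)
  qed
  ultimately have "Idl\<^bsub>S_ring\<^esub> (range g) \<subseteq> ?I"
    by (rule S.genideal_minimal)
  moreover have "?I \<subseteq> Idl\<^bsub>S_ring\<^esub> (range g)"
  proof
    fix p assume "p \<in> ?I"
    then obtain s where p: "p = (\<Sum>i\<in>UNIV. s i * g i)" by blast
    have "ideal (Idl\<^bsub>S_ring\<^esub> (range g)) S_ring" "range g \<subseteq> Idl\<^bsub>S_ring\<^esub> (range g)"
      by (auto intro!: S.genideal_ideal S.genideal_self)
    then show "p \<in> Idl\<^bsub>S_ring\<^esub> (range g)"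
      unfolding p by (intro S_ring_ideal_sum S_ring_ideal_mult) auto
  qed
  ultimately show ?thesis by blast
qed

lemma ideal_genideal_range: "ideal (Idl\<^bsub>S_ring\<^esub> (range (g :: 3 \<Rightarrow> 'k::field poly3))) S_ring"
proof -
  interpret S: cring "S_ring :: 'k poly3 ring" by (rule cring_S_ring)
  show ?thesis by (rule S.genideal_ideal) simp
qed

lemma irrelevant_ideal_iff: "p \<in> irrelevant_ideal \<longleftrightarrow> Poly_Mapping.lookup p 0 = 0"
proof
  assume "p \<in> irrelevant_ideal"
  then obtain \<theta> where "p = (\<Sum>i\<in>UNIV. variable i ^ 1 * \<theta> i)"
    unfolding irrelevant_ideal_def genideal_range by (auto simp: mult.commute)
  then show "Poly_Mapping.lookup p 0 = 0"
    by (simp add: lookup_sum lookup_variable_power_mult[of _ 1, simplified])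
next
  assume p: "Poly_Mapping.lookup p 0 = 0"
  have I: "ideal irrelevant_ideal (S_ring :: 'a poly3 ring)"
    unfolding irrelevant_ideal_def by (rule ideal_genideal_range)
  have "Poly_Mapping.single m (Poly_Mapping.lookup p m) \<in> irrelevant_ideal" for m
  proof (cases "m = 0")
    case True
    then show ?thesis using p S_ring_ideal_0[OF I] by simp
  next
    case False
    then obtain i where i: "Poly_Mapping.lookup m i \<noteq> 0"
      by (metis poly_mapping_eqI lookup_zero)
    then have "(m - Poly_Mapping.single i 1) + Poly_Mapping.single i 1 = m"
      by (intro poly_mapping_eqI) (auto simp: lookup_add lookup_minus lookup_single when_def)
    then have "Poly_Mapping.single m (Poly_Mapping.lookup p m)
       = Poly_Mapping.single (m - Poly_Mapping.single i 1) (Poly_Mapping.lookup p m) * variable i"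
      by (simp add: variable_def mult_single)
    moreover interpret S: cring "S_ring :: 'a poly3 ring" by (rule cring_S_ring)
    have "(variable i :: 'a poly3) \<in> irrelevant_ideal"
      unfolding irrelevant_ideal_def using S.genideal_self[of "range variable"] by (simp add: subset_iff)
    ultimately show ?thesis
      using S_ring_ideal_mult[OF I] by metis
  qed
  then show "p \<in> irrelevant_ideal"
    by (subst poly_mapping_sum_single) (intro S_ring_ideal_sum[OF I])
qed

text \<open>A form of negative degree is 0, so a nonzero degree suffices. Minimality of the
  resolutions is read off from degrees in this way.\<close>

lemma homogeneous_irrelevant:
  "homogeneous_of_degree k p \<Longrightarrow> k \<noteq> 0 \<Longrightarrow> p \<in> irrelevant_ideal"
  unfolding irrelevant_ideal_iff homogeneous_iff not_in_keys_iff_lookup_eq_zero[symmetric] by fastforce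

lemma variable_power_in_ideal_power: "variable i ^ n \<in> ideal_power S_ring irrelevant_ideal n"
proof (induction n)
  case (Suc n)
  have "(variable i :: 'a poly3) \<in> irrelevant_ideal"
    by (rule homogeneous_irrelevant[OF homogeneous_variable]) simp
  from ideal_prod.prod[OF this Suc, of S_ring] show ?case
    by (simp add: ideal_power_def)
qed (simp add: ideal_power_def)

lemma ideal_power_tdeg:
  assumes "g \<in> ideal_power S_ring irrelevant_ideal n" "m \<in> Poly_Mapping.keys g"
  shows "n \<le> tdeg m"
  using assms
proof (induction n arbitrary: g m)
  case (Suc n)
  have "g \<in> ideal_prod S_ring irrelevant_ideal (ideal_power S_ring irrelevant_ideal n)"
    using Suc.prems by (simp add: ideal_power_def)
  then have "\<forall>m\<in>Poly_Mapping.keys g. Suc n \<le> tdeg m"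
  proof (induction g rule: ideal_prod.induct)
    case (prod p q)
    show ?case
    proof
      fix m assume "m \<in> Poly_Mapping.keys (p \<otimes>\<^bsub>S_ring\<^esub> q)"
      then obtain a b where ab: "m = a + b" "a \<in> Poly_Mapping.keys p" "b \<in> Poly_Mapping.keys q"
        using keys_mult[of p q] by auto
      then have "a \<noteq> 0"
        using prod by (auto simp: irrelevant_ideal_iff in_keys_iff)
      moreover have "n \<le> tdeg b"
        using Suc.IH prod ab by blast
      ultimately show "Suc n \<le> tdeg m"
        using ab tdeg_eq_0_iff[of a] by (simp add: tdeg_add)
    qed
  next
    case (sum p q)
    then show ?case using keys_add[of p q] by auto
  qed
  with Suc.prems show ?case by blast
qed simp

text \<open>The n-th power of the maximal ideal contains the n-th powers of the variables;
  conversely, a monomial of degree at least 3n has an exponent of at least n.\<close>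

lemma saturation_iff:
  fixes I :: "'k::field poly3 set"
  assumes I: "ideal I S_ring"
  shows "u \<in> saturation I \<longleftrightarrow> (\<exists>n. \<forall>i. variable i ^ n * u \<in> I)"
proof
  assume "u \<in> saturation I"
  then show "\<exists>n. \<forall>i. variable i ^ n * u \<in> I"
    unfolding saturation_def using variable_power_in_ideal_power by (fastforce simp: mult.commute)
next
  assume "\<exists>n. \<forall>i. variable i ^ n * u \<in> I"
  then obtain n where n: "\<And>i. variable i ^ n * u \<in> I" by blast
  have "u * g \<in> I" if g: "g \<in> ideal_power S_ring irrelevant_ideal (3 * n)" for g
  proof -
    have "u * Poly_Mapping.single m (Poly_Mapping.lookup g m) \<in> I" if m: "m \<in> Poly_Mapping.keys g" for m
    proof -
      have "3 * n \<le> tdeg m" using ideal_power_tdeg[OF g m] .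
      then have "n \<le> Poly_Mapping.lookup m 0 \<or> n \<le> Poly_Mapping.lookup m 1 \<or> n \<le> Poly_Mapping.lookup m 2"
        unfolding tdeg_def sum_UNIV_3 by arith
      then obtain i where i: "n \<le> Poly_Mapping.lookup m i" by blast
      then have "(m - Poly_Mapping.single i n) + Poly_Mapping.single i n = m"
        by (intro poly_mapping_eqI) (auto simp: lookup_add lookup_minus lookup_single when_def)
      then have "u * Poly_Mapping.single m (Poly_Mapping.lookup g m)
          = Poly_Mapping.single (m - Poly_Mapping.single i n) (Poly_Mapping.lookup g m) * (variable i ^ n * u)"
        by (simp only: variable_power mult_single mult.assoc[symmetric] mult_1_right)
           (simp only: mult.commute)
      moreover have "Poly_Mapping.single (m - Poly_Mapping.single i n) (Poly_Mapping.lookup g m) * (variable i ^ n * u) \<in> I"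
        by (rule S_ring_ideal_mult[OF I n])
      ultimately show ?thesis by (simp only:)
    qed
    then have "(\<Sum>m\<in>Poly_Mapping.keys g. u * Poly_Mapping.single m (Poly_Mapping.lookup g m)) \<in> I"
      by (rule S_ring_ideal_sum[OF I])
    then show ?thesis
      by (metis poly_mapping_sum_single sum_distrib_left)
  qed
  then show "u \<in> saturation I"
    unfolding saturation_def by blast
qed

section \<open>Resolutions given by matrices\<close>

lemma free_graded_module_simps [simp]:
  "carrier (free_graded_module as) = carrier_vec (length as)"
  "ring.zero (free_graded_module as) = 0\<^sub>v (length as)"
  "ring.add (free_graded_module as) = (+)"
  "module.smult (free_graded_module as) = (\<cdot>\<^sub>v)"
  "component (free_graded_module as) k = {v \<in> carrier_vec (length as).
     \<forall>j<length as. homogeneous_of_degree (as ! j + k) (v $ j)}"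
  by (simp_all add: free_graded_module_def)

text \<open>A degree-preserving map from S(b) to S(a) is multiplication by a form of degree a - b;
  this fixes the degrees required of all matrices below.\<close>

lemma homogeneous_mult_mat_vec:
  fixes M :: "'k::field poly3 mat" and v :: "'k poly3 vec"
  assumes "M \<in> carrier_mat (length as) (length bs)" "v \<in> carrier_vec (length bs)"
    and "\<And>a b. a < length as \<Longrightarrow> b < length bs \<Longrightarrow> homogeneous_of_degree (as ! a - bs ! b) (M $$ (a, b))"
    and "\<And>b. b < length bs \<Longrightarrow> homogeneous_of_degree (bs ! b + k) (v $ b)"
    and "a < length as"
  shows "homogeneous_of_degree (as ! a + k) ((M *\<^sub>v v) $ a)"
proof -
  have "(M *\<^sub>v v) $ a = (\<Sum>b\<in>{0..<length bs}. M $$ (a, b) * v $ b)"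
    using assms(1,2,5) by (simp add: scalar_prod_def)
  also have "homogeneous_of_degree (as ! a + k) \<dots>"
    by (rule homogeneous_sum, rule homogeneous_mult'[OF assms(3) assms(4)]) (use assms(5) in auto)
  finally show ?thesis .
qed

lemma graded_hom_mat:
  fixes M :: "'k::field poly3 mat"
  assumes "M \<in> carrier_mat (length as) (length bs)"
    and "\<And>a b. a < length as \<Longrightarrow> b < length bs \<Longrightarrow> homogeneous_of_degree (as ! a - bs ! b) (M $$ (a, b))"
  shows "graded_hom (free_graded_module bs) (free_graded_module as) ((*\<^sub>v) M)"
  unfolding graded_hom_def free_graded_module_simps
proof (intro conjI ballI allI)
  show "(*\<^sub>v) M \<in> carrier_vec (length bs) \<rightarrow> carrier_vec (length as)"
    using assms(1) by auto
  show "M *\<^sub>v (x + y) = M *\<^sub>v x + M *\<^sub>v y"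
    if "x \<in> carrier_vec (length bs)" "y \<in> carrier_vec (length bs)" for x y
    by (rule mult_add_distrib_mat_vec[OF assms(1) that])
  show "M *\<^sub>v (c \<cdot>\<^sub>v x) = c \<cdot>\<^sub>v (M *\<^sub>v x)" if "x \<in> carrier_vec (length bs)" for c x
    by (rule mult_mat_smult_vec[OF assms(1) that])
  fix k
  show "(*\<^sub>v) M ` {v \<in> carrier_vec (length bs). \<forall>j<length bs. homogeneous_of_degree (bs ! j + k) (v $ j)}
      \<subseteq> {v \<in> carrier_vec (length as). \<forall>j<length as. homogeneous_of_degree (as ! j + k) (v $ j)}"
    using assms(1) homogeneous_mult_mat_vec[OF assms(1) _ assms(2)] by auto
qed

text \<open>The definition of a resolution asks for infinitely many maps; here only
  \<open>D 0\<close> up to \<open>D r\<close>, between the \<open>r + 2\<close> listed free modules,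
  have to be supplied.\<close>

lemma resolution_of_matrices:
  fixes D :: "nat \<Rightarrow> 'k::field poly3 mat" and tws :: "int list list"
  assumes len: "length tws = Suc (Suc r)"
    and D: "\<And>i. i \<le> r \<Longrightarrow> D i \<in> carrier_mat (length (tws ! i)) (length (tws ! Suc i))"
    and hom: "\<And>i a b. i \<le> r \<Longrightarrow> a < length (tws ! i) \<Longrightarrow> b < length (tws ! Suc i) \<Longrightarrow>
       homogeneous_of_degree (tws ! i ! a - tws ! Suc i ! b) (D i $$ (a, b))"
    and irrelevant: "\<And>i a b. i \<le> r \<Longrightarrow> a < length (tws ! i) \<Longrightarrow> b < length (tws ! Suc i) \<Longrightarrow>
       D i $$ (a, b) \<in> irrelevant_ideal"
    and eps: "graded_hom (free_graded_module (tws ! 0)) N \<epsilon>"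
      "\<epsilon> ` carrier_vec (length (tws ! 0)) = carrier N"
    and eps_kernel: "\<And>v. v \<in> carrier_vec (length (tws ! 0)) \<Longrightarrow>
       \<epsilon> v = \<zero>\<^bsub>N\<^esub> \<longleftrightarrow> (\<exists>w\<in>carrier_vec (length (tws ! 1)). v = D 0 *\<^sub>v w)"
    and exact: "\<And>i v. i < r \<Longrightarrow> v \<in> carrier_vec (length (tws ! Suc i)) \<Longrightarrow>
       D i *\<^sub>v v = 0\<^sub>v (length (tws ! i)) \<longleftrightarrow> (\<exists>w\<in>carrier_vec (length (tws ! Suc (Suc i))). v = D (Suc i) *\<^sub>v w)"
    and inj: "\<And>v. v \<in> carrier_vec (length (tws ! Suc r)) \<Longrightarrow> D r *\<^sub>v v = 0\<^sub>v (length (tws ! r)) \<Longrightarrow>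
       v = 0\<^sub>v (length (tws ! Suc r))"
  shows "has_graded_minimal_free_resolution N (map mset tws)"
proof -
  define tw where "tw = (\<lambda>i. if i < length tws then tws ! i else [])"
  \<comment> \<open>Padding by matrices without columns; for \<open>i = r + 1\<close> the rows are
    still those of the last free module.\<close>
  define Y where "Y = (\<lambda>i. if i \<le> r then D i else 0\<^sub>m (length (tw i)) 0)"
  have tw: "tw i = tws ! i" if "i \<le> Suc r" for i
    using that len by (simp add: tw_def)
  have tw_Nil: "tw i = []" if "i > Suc r" for i
    using that len by (simp add: tw_def)
  have Y: "Y i \<in> carrier_mat (length (tw i)) (length (tw (Suc i)))" for i
    using D[of i] by (auto simp: Y_def tw tw_Nil)
  have Y_entry: "homogeneous_of_degree (tw i ! a - tw (Suc i) ! b) (Y i $$ (a, b))"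
    "Y i $$ (a, b) \<in> irrelevant_ideal"
    if "a < length (tw i)" "b < length (tw (Suc i))" for i a b
  proof -
    have "i \<le> r" using that tw_Nil[of "Suc i"] by (cases "i \<le> r") auto
    then show "homogeneous_of_degree (tw i ! a - tw (Suc i) ! b) (Y i $$ (a, b))"
      "Y i $$ (a, b) \<in> irrelevant_ideal"
      using that hom[of i a b] irrelevant[of i a b] by (simp_all add: Y_def tw)
  qed
  have Y_exact: "Y i *\<^sub>v v = 0\<^sub>v (length (tw i)) \<longleftrightarrow> (\<exists>w\<in>carrier_vec (length (tw (Suc (Suc i)))). v = Y (Suc i) *\<^sub>v w)"
    if v: "v \<in> carrier_vec (length (tw (Suc i)))" for i and v :: "'k poly3 vec"
  proof -
    consider "i < r" | "i = r" | "i > r" by linarith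
    then show ?thesis
    proof cases
      case 1
      then show ?thesis using exact[of i v] v by (simp add: Y_def tw)
    next
      case 2
      \<comment> \<open>The incoming map starts from the zero module, so exactness at this place is
        injectivity of \<open>D r\<close>.\<close>
      have "(\<exists>w\<in>carrier_vec 0. v = 0\<^sub>m (length (tw (Suc r))) 0 *\<^sub>v w) \<longleftrightarrow> v = 0\<^sub>v (length (tw (Suc r)))"
        by (auto simp: scalar_prod_def intro!: eq_vecI bexI[of _ "0\<^sub>v 0"])
      moreover have "D r *\<^sub>v 0\<^sub>v (length (tw (Suc r))) = 0\<^sub>v (length (tw r))"
        using D[of r] by (auto simp: tw)
      ultimately show ?thesis
        using 2 inj[of v] v by (auto simp: Y_def tw tw_Nil)
    next
      case 3
      then have "v = 0\<^sub>v 0" using v tw_Nil[of "Suc i"] by auto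
      then show ?thesis
        using 3 by (auto simp: Y_def tw_Nil scalar_prod_def intro!: eq_vecI bexI[of _ "0\<^sub>v 0"])
    qed
  qed
  show ?thesis
    unfolding has_graded_minimal_free_resolution_def Let_def
  proof (intro exI[of _ tw] exI[of _ "\<lambda>i. (*\<^sub>v) (Y i)"] exI[of _ \<epsilon>] conjI allI ballI impI)
    fix i
    show "mset (tw i) = (if i < length (map mset tws) then map mset tws ! i else {#})"
      by (simp add: tw_def)
    show "graded_hom (free_graded_module (tw 0)) N \<epsilon>"
      using eps(1) by (simp add: tw)
    show "graded_hom (free_graded_module (tw (Suc i))) (free_graded_module (tw i)) ((*\<^sub>v) (Y i))"
      by (rule graded_hom_mat[OF Y Y_entry(1)])
    show "\<epsilon> ` carrier (free_graded_module (tw 0)) = carrier N"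
      using eps(2) by (simp add: tw)
    show "hom_kernel (free_graded_module (tw 0)) N \<epsilon> = (*\<^sub>v) (Y 0) ` carrier (free_graded_module (tw 1))"
      using eps_kernel D[of 0] unfolding hom_kernel_def
      by (auto simp: tw Y_def image_iff)
    show "hom_kernel (free_graded_module (tw (Suc i))) (free_graded_module (tw i)) ((*\<^sub>v) (Y i)) =
        (*\<^sub>v) (Y (Suc i)) ` carrier (free_graded_module (tw (Suc (Suc i))))"
      unfolding hom_kernel_def using Y_exact[of _ i] mult_mat_vec_carrier[OF Y[of "Suc i"]]
      by (auto simp: image_iff)
    fix v :: "'k poly3 vec" and j
    assume v: "v \<in> carrier (free_graded_module (tw (Suc i)))" and j: "j < length (tw i)"
    have "ideal irrelevant_ideal (S_ring :: 'k poly3 ring)"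
      unfolding irrelevant_ideal_def by (rule ideal_genideal_range)
    moreover have "(Y i *\<^sub>v v) $ j = (\<Sum>b\<in>{0..<length (tw (Suc i))}. v $ b * Y i $$ (j, b))"
      using v j Y[of i] by (simp add: scalar_prod_def mult.commute)
    ultimately show "(Y i *\<^sub>v v) $ j \<in> irrelevant_ideal"
      using Y_entry(2)[OF j] by (auto intro!: S_ring_ideal_sum S_ring_ideal_mult)
  qed
qed

definition vec_ideal :: "'k::field poly3 vec \<Rightarrow> 'k poly3 set" where
  "vec_ideal y = {y \<bullet> v | v. v \<in> carrier_vec (dim_vec y)}"

lemma vec_idealI: "v \<in> carrier_vec (dim_vec y) \<Longrightarrow> y \<bullet> v \<in> vec_ideal y"
  by (auto simp: vec_ideal_def)

lemma vec_idealE: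
  assumes "a \<in> vec_ideal y" obtains v where "v \<in> carrier_vec (dim_vec y)" "a = y \<bullet> v"
  using assms by (auto simp: vec_ideal_def)

lemma ideal_vec_ideal: "ideal (vec_ideal y) S_ring"
proof (rule S_ring_idealI)
  have y: "y \<in> carrier_vec (dim_vec y)" by simp
  show "0 \<in> vec_ideal y"
    using vec_idealI[of "0\<^sub>v (dim_vec y)" y] by simp
  show "a + b \<in> vec_ideal y" if ab: "a \<in> vec_ideal y" "b \<in> vec_ideal y" for a b
  proof -
    obtain u v where "u \<in> carrier_vec (dim_vec y)" "v \<in> carrier_vec (dim_vec y)" "a = y \<bullet> u" "b = y \<bullet> v"
      using ab unfolding vec_ideal_def by blast
    then show ?thesis
      using vec_idealI[of "u + v" y] scalar_prod_add_distrib[OF y, of u v] by simp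
  qed
  show "b * a \<in> vec_ideal y" if a: "a \<in> vec_ideal y" for a b
  proof -
    obtain v where "v \<in> carrier_vec (dim_vec y)" "a = y \<bullet> v"
      using a by (rule vec_idealE)
    then show ?thesis
      using vec_idealI[of "b \<cdot>\<^sub>v v" y] by simp
  qed
qed

lemma ideal_module_simps [simp]:
  "carrier (ideal_module I) = I"
  "ring.zero (ideal_module I) = 0"
  "ring.add (ideal_module I) = (+)"
  "module.smult (ideal_module I) = (*)"
  "component (ideal_module I) k = {x \<in> I. homogeneous_of_degree k x}"
  by (simp_all add: ideal_module_def)

lemma homogeneous_scalar_prod:
  fixes v y :: "'k::field poly3 vec"
  assumes "dim_vec v = n" "\<And>e. e < n \<Longrightarrow> homogeneous_of_degree D (y $ e)"
    and "\<And>e. e < n \<Longrightarrow> homogeneous_of_degree (k - D) (v $ e)"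
  shows "homogeneous_of_degree k (y \<bullet> v)"
  unfolding scalar_prod_def using assms
  by (intro homogeneous_sum homogeneous_mult'[of D _ "k - D"]) auto

lemma graded_hom_vec_ideal:
  fixes y :: "'k::field poly3 vec"
  assumes y: "y \<in> carrier_vec n" and "\<And>e. e < n \<Longrightarrow> homogeneous_of_degree D (y $ e)"
  shows "graded_hom (free_graded_module (replicate n (- D))) (ideal_module (vec_ideal y)) ((\<bullet>) y)"
    and "(\<bullet>) y ` carrier_vec (length (replicate n (- D))) = carrier (ideal_module (vec_ideal y))"
proof -
  show "graded_hom (free_graded_module (replicate n (- D))) (ideal_module (vec_ideal y)) ((\<bullet>) y)"
    unfolding graded_hom_def free_graded_module_simps ideal_module_simps
  proof (intro conjI ballI allI)
    show "(\<bullet>) y \<in> carrier_vec (length (replicate n (- D))) \<rightarrow> vec_ideal y"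
      using y by (auto intro!: vec_idealI)
    show "y \<bullet> (u + v) = y \<bullet> u + y \<bullet> v"
      if "u \<in> carrier_vec (length (replicate n (- D)))" "v \<in> carrier_vec (length (replicate n (- D)))" for u v
      using that y scalar_prod_add_distrib[of y n u v] by simp
    show "y \<bullet> (c \<cdot>\<^sub>v v) = c * (y \<bullet> v)" if "v \<in> carrier_vec (length (replicate n (- D)))" for c v
      using that y by simp
    show "(\<bullet>) y ` {v \<in> carrier_vec (length (replicate n (- D))).
         \<forall>j<length (replicate n (- D)). homogeneous_of_degree (replicate n (- D) ! j + k) (v $ j)}
        \<subseteq> {x \<in> vec_ideal y. homogeneous_of_degree k x}" for k
      using y by (auto intro!: vec_idealI homogeneous_scalar_prod[OF _ assms(2)])
  qed
  show "(\<bullet>) y ` carrier_vec (length (replicate n (- D))) = carrier (ideal_module (vec_ideal y))"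
    using y by (auto intro: vec_idealI elim: vec_idealE)
qed

section \<open>Quotients of ideals\<close>

lemma a_r_coset_S_ring: "J +>\<^bsub>S_ring\<^esub> x = {h + x | h. h \<in> (J :: 'k::field poly3 set)}"
  by (auto simp: a_r_coset_def r_coset_def)

lemma coset_eq_iff:
  assumes "ideal J (S_ring :: 'k::field poly3 ring)"
  shows "J +>\<^bsub>S_ring\<^esub> x = J +>\<^bsub>S_ring\<^esub> y \<longleftrightarrow> x - y \<in> J"
proof
  assume "J +>\<^bsub>S_ring\<^esub> x = J +>\<^bsub>S_ring\<^esub> y"
  moreover have "0 + x \<in> J +>\<^bsub>S_ring\<^esub> x"
    unfolding a_r_coset_S_ring using S_ring_ideal_0[OF assms] by blast
  ultimately show "x - y \<in> J"
    unfolding a_r_coset_S_ring by auto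
next
  assume xy: "x - y \<in> J"
  have "\<exists>h'. h + x = h' + y \<and> h' \<in> J" if "h \<in> J" for h
    using S_ring_ideal_add[OF assms that xy] by (intro exI[of _ "h + (x - y)"]) simp
  moreover have "\<exists>h'. h + y = h' + x \<and> h' \<in> J" if "h \<in> J" for h
    using S_ring_ideal_diff[OF assms that xy] by (intro exI[of _ "h - (x - y)"]) simp
  ultimately show "J +>\<^bsub>S_ring\<^esub> x = J +>\<^bsub>S_ring\<^esub> y"
    unfolding a_r_coset_S_ring by blast
qed

lemma coset_0: "J +>\<^bsub>S_ring\<^esub> (0 :: 'k::field poly3) = J"
  by (auto simp: a_r_coset_S_ring)

lemma coset_add:
  assumes "ideal J (S_ring :: 'k::field poly3 ring)"
  shows "(J +>\<^bsub>S_ring\<^esub> x) <+>\<^bsub>S_ring\<^esub> (J +>\<^bsub>S_ring\<^esub> y) = J +>\<^bsub>S_ring\<^esub> (x + y)"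
proof -
  interpret ideal J "S_ring :: 'k poly3 ring" by fact
  show ?thesis using a_rcos_sum[of x y] by simp
qed

lemma coset_smult:
  assumes "ideal J (S_ring :: 'k::field poly3 ring)"
  shows "(\<Union>z\<in>J +>\<^bsub>S_ring\<^esub> x. J +>\<^bsub>S_ring\<^esub> (a * z)) = J +>\<^bsub>S_ring\<^esub> (a * x)"
proof -
  have "J +>\<^bsub>S_ring\<^esub> (a * z) = J +>\<^bsub>S_ring\<^esub> (a * x)" if "z \<in> J +>\<^bsub>S_ring\<^esub> x" for z
  proof -
    from that obtain h where "h \<in> J" "z = h + x" by (auto simp: a_r_coset_S_ring)
    then have "a * z - a * x \<in> J"
      using S_ring_ideal_mult[OF assms \<open>h \<in> J\<close>, of a] by (simp add: distrib_left)
    then show ?thesis by (simp add: coset_eq_iff[OF assms])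
  qed
  moreover have "0 + x \<in> J +>\<^bsub>S_ring\<^esub> x"
    unfolding a_r_coset_S_ring using S_ring_ideal_0[OF assms] by blast
  ultimately show ?thesis by blast
qed

lemma quotient_module_simps [simp]:
  "carrier (quotient_module I J) = (\<lambda>x. J +>\<^bsub>S_ring\<^esub> x) ` I"
  "ring.zero (quotient_module I J) = J"
  "ring.add (quotient_module I J) = set_add S_ring"
  "module.smult (quotient_module I J) = (\<lambda>a C. \<Union>x\<in>C. J +>\<^bsub>S_ring\<^esub> (a * x))"
  "component (quotient_module I J) k = (\<lambda>x. J +>\<^bsub>S_ring\<^esub> x) ` {x \<in> I. homogeneous_of_degree k x}"
  by (simp_all add: quotient_module_def)

section \<open>The cross product, that is, Koszul syzygies of three elements\<close>

definition cross_mat :: "'a::comm_ring_1 vec \<Rightarrow> 'a mat" where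
  "cross_mat u = mat_of_rows_list 3 [[0, - u $ 2, u $ 1], [u $ 2, 0, - u $ 0], [- u $ 1, u $ 0, 0]]"

lemma cross_mat_carrier [simp]: "cross_mat u \<in> carrier_mat 3 3"
  by (auto simp: cross_mat_def mat_of_rows_list_def numeral_3_eq_3)

lemma less_3_iff: "i < (3::nat) \<longleftrightarrow> i = 0 \<or> i = 1 \<or> i = 2"
  by auto

lemma scalar_prod_3: "v \<in> carrier_vec 3 \<Longrightarrow> u \<bullet> v = u $ 0 * v $ 0 + u $ 1 * v $ 1 + u $ 2 * v $ 2"
  by (simp add: scalar_prod_def numeral_3_eq_3 numeral_2_eq_2)

lemma vec_eq_3_iff:
  "v \<in> carrier_vec 3 \<Longrightarrow> w \<in> carrier_vec 3 \<Longrightarrow> v = w \<longleftrightarrow> v $ 0 = w $ 0 \<and> v $ 1 = w $ 1 \<and> v $ 2 = w $ 2"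
  by (auto simp: vec_eq_iff less_3_iff)

lemma cross_mat_index:
  assumes "w \<in> carrier_vec 3"
  shows "(cross_mat u *\<^sub>v w) $ 0 = u $ 1 * w $ 2 - u $ 2 * w $ 1"
    and "(cross_mat u *\<^sub>v w) $ 1 = u $ 2 * w $ 0 - u $ 0 * w $ 2"
    and "(cross_mat u *\<^sub>v w) $ 2 = u $ 0 * w $ 1 - u $ 1 * w $ 0"
  using assms by (simp_all add: cross_mat_def mat_of_rows_list_def scalar_prod_3 row_def)

lemmas cross_simps = vec_eq_3_iff scalar_prod_3 cross_mat_index cross_mat_index(2)[unfolded One_nat_def]

lemma cross_mat_carrier_vec [simp]: "w \<in> carrier_vec 3 \<Longrightarrow> cross_mat u *\<^sub>v w \<in> carrier_vec 3"
  by (rule mult_mat_vec_carrier[OF cross_mat_carrier])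

lemma cross_self: "u \<in> carrier_vec 3 \<Longrightarrow> cross_mat u *\<^sub>v u = 0\<^sub>v 3"
  by (simp add: cross_simps)

lemma scalar_prod_cross_self: "w \<in> carrier_vec 3 \<Longrightarrow> u \<bullet> (cross_mat u *\<^sub>v w) = 0"
  by (simp add: cross_simps algebra_simps)

lemma scalar_prod_cross_self': "w \<in> carrier_vec 3 \<Longrightarrow> w \<bullet> (cross_mat u *\<^sub>v w) = 0"
  by (simp add: cross_simps algebra_simps)

lemma cross_cross:
  assumes "u \<in> carrier_vec 3" "v \<in> carrier_vec 3" "w \<in> carrier_vec 3"
  shows "cross_mat u *\<^sub>v (cross_mat v *\<^sub>v w) = (u \<bullet> w) \<cdot>\<^sub>v v - (u \<bullet> v) \<cdot>\<^sub>v w"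
  using assms by (simp add: cross_simps algebra_simps)

text \<open>Free modules are projective: lifting the columns one by one lifts the matrix.\<close>

lemma factor_columns:
  fixes A :: "'a::comm_semiring_1 mat"
  assumes A: "A \<in> carrier_mat m q" and M: "M \<in> carrier_mat m c"
    and "\<And>j. j < c \<Longrightarrow> \<exists>w\<in>carrier_vec q. M *\<^sub>v unit_vec c j = A *\<^sub>v w"
  shows "\<exists>W\<in>carrier_mat q c. M = A * W"
proof -
  obtain w where w: "\<And>j. j < c \<Longrightarrow> w j \<in> carrier_vec q" "\<And>j. j < c \<Longrightarrow> M *\<^sub>v unit_vec c j = A *\<^sub>v w j"
    using assms(3) by metis
  define W where "W = mat q c (\<lambda>(i, j). w j $ i)"
  have W: "W \<in> carrier_mat q c" by (simp add: W_def)
  have "M = A * W"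
  proof (rule eq_matI)
    fix i j assume ij: "i < dim_row (A * W)" "j < dim_col (A * W)"
    then have i: "i < m" and j: "j < c" using A W by auto
    have "col W j = w j"
      using w(1)[OF j] j by (intro eq_vecI) (auto simp: W_def)
    then have "(A * W) $$ (i, j) = (A *\<^sub>v w j) $ i"
      using A W i j by simp
    also have "\<dots> = M $$ (i, j)"
      unfolding w(2)[OF j, symmetric] using M i j by (simp add: scalar_prod_right_unit[of j c])
    finally show "M $$ (i, j) = (A * W) $$ (i, j)" by simp
  qed (use A M W in auto)
  with W show ?thesis by blast
qed

lemma vec_eq_scalar_prodI:
  fixes u v :: "'a::comm_semiring_1 vec"
  assumes "u \<in> carrier_vec n" "v \<in> carrier_vec n" "\<And>w. w \<in> carrier_vec n \<Longrightarrow> u \<bullet> w = v \<bullet> w"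
  shows "u = v"
proof (rule eq_vecI)
  fix i assume "i < dim_vec v"
  then show "u $ i = v $ i"
    using assms(1,2) assms(3)[of "unit_vec n i"] scalar_prod_right_unit[of i n u] scalar_prod_right_unit[of i n v] by simp
qed (use assms in simp)

section \<open>Duality for presentations of finite length\<close>

text \<open>The columns of \<open>A\<close> freely generate the syzygies of the forms in
  \<open>y\<close>. The entries of column \<open>j\<close> have degree \<open>\<delta> j\<close>,
  which is nonzero so that they lie in the maximal ideal.\<close>

locale free_resolution_2 =
  fixes m q :: nat and y :: "'k::field poly3 vec" and A :: "'k poly3 mat"
    and D :: int and \<delta> :: "nat \<Rightarrow> int"
  assumes y: "y \<in> carrier_vec m" and A: "A \<in> carrier_mat m q"
    and exact: "\<And>v. v \<in> carrier_vec m \<Longrightarrow> y \<bullet> v = 0 \<longleftrightarrow> (\<exists>w\<in>carrier_vec q. v = A *\<^sub>v w)"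
    and A_inj: "\<And>w. w \<in> carrier_vec q \<Longrightarrow> A *\<^sub>v w = 0\<^sub>v m \<Longrightarrow> w = 0\<^sub>v q"
    and y_hom: "\<And>e. e < m \<Longrightarrow> homogeneous_of_degree D (y $ e)"
    and A_hom: "\<And>e j. e < m \<Longrightarrow> j < q \<Longrightarrow> homogeneous_of_degree (\<delta> j) (A $$ (e, j))"
    and \<delta>_pos: "\<And>j. j < q \<Longrightarrow> \<delta> j \<noteq> 0"
begin

lemma A_cancel:
  assumes "u \<in> carrier_vec q" "v \<in> carrier_vec q" "A *\<^sub>v u = A *\<^sub>v v"
  shows "u = v"
proof -
  have "A *\<^sub>v (u - v) = A *\<^sub>v u - A *\<^sub>v v"
    by (rule mult_minus_distrib_mat_vec[OF A assms(1,2)])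
  also have "\<dots> = 0\<^sub>v m"
    unfolding assms(3) using A assms(2) by simp
  finally have "u - v = 0\<^sub>v q"
    using assms by (intro A_inj) auto
  then have "(u - v) $ i = 0" if "i < q" for i using that by simp
  then show ?thesis
    using assms by (intro eq_vecI) auto
qed

lemma y_A: "w \<in> carrier_vec q \<Longrightarrow> y \<bullet> (A *\<^sub>v w) = 0"
  using exact[of "A *\<^sub>v w"] A by auto

text \<open>Preimages under \<open>A\<close> are unique, and the components of \<open>w\<close> in
  the right degrees form another preimage.\<close>

lemma A_graded:
  assumes w: "w \<in> carrier_vec q"
    and "\<And>e. e < m \<Longrightarrow> homogeneous_of_degree g ((A *\<^sub>v w) $ e)" and j: "j < q"
  shows "homogeneous_of_degree (g - \<delta> j) (w $ j)"
proof -
  define w' where "w' = vec q (\<lambda>j. hcomp (g - \<delta> j) (w $ j))"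
  have "A *\<^sub>v w' = A *\<^sub>v w"
  proof (rule eq_vecI)
    fix e assume "e < dim_vec (A *\<^sub>v w)"
    then have e: "e < m" using A by simp
    have "(A *\<^sub>v w') $ e = (\<Sum>j\<in>{0..<q}. A $$ (e, j) * hcomp (g - \<delta> j) (w $ j))"
      using A e by (simp add: scalar_prod_def w'_def)
    also have "\<dots> = (\<Sum>j\<in>{0..<q}. hcomp g (A $$ (e, j) * w $ j))"
      using hcomp_mult_homogeneous[OF A_hom[OF e], of _ "g - \<delta> _"]
      by (intro sum.cong refl) (metis add.commute atLeastLessThan_iff diff_add_cancel)
    also have "\<dots> = hcomp g ((A *\<^sub>v w) $ e)"
      using A e w by (simp add: scalar_prod_def hcomp_sum)
    also have "\<dots> = (A *\<^sub>v w) $ e"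
      using hcomp_homogeneous[OF assms(2)[OF e]] by simp
    finally show "(A *\<^sub>v w') $ e = (A *\<^sub>v w) $ e" .
  qed (use A in simp)
  then have "w' = w"
    by (rule A_cancel[rotated 2]) (simp_all only: w'_def w vec_carrier)
  moreover have "w' $ j = hcomp (g - \<delta> j) (w $ j)"
    using j by (simp add: w'_def)
  ultimately show ?thesis
    using homogeneous_hcomp[of "g - \<delta> j" "w $ j"] by simp
qed

text \<open>The cokernel of the row \<open>y\<close> is S modulo the ideal, so the absence of
  torsion at the origin says that the ideal is saturated.\<close>

lemma saturated_vec_ideal: "saturation (vec_ideal y) = vec_ideal y"
proof
  show "vec_ideal y \<subseteq> saturation (vec_ideal y)"
    using saturation_iff[OF ideal_vec_ideal] S_ring_ideal_mult[OF ideal_vec_ideal] by blast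
  show "saturation (vec_ideal y) \<subseteq> vec_ideal y"
  proof
    fix u assume "u \<in> saturation (vec_ideal y)"
    then obtain n where n: "\<And>i. variable i ^ n * u \<in> vec_ideal y"
      unfolding saturation_iff[OF ideal_vec_ideal] by blast
    define \<gamma> where "\<gamma> = mat_of_rows m [y]"
    have \<gamma>: "\<gamma> \<in> carrier_mat 1 m"
      using mat_of_rows_carrier(1)[of m "[y]"] by (simp add: \<gamma>_def)
    have \<gamma>_vec: "\<gamma> *\<^sub>v v = vec 1 (\<lambda>_. y \<bullet> v)" for v
      using y by (intro eq_vecI) (auto simp: \<gamma>_def)
    have zero: "\<gamma> *\<^sub>v v = 0\<^sub>v 1 \<longleftrightarrow> y \<bullet> v = 0" for v
      unfolding \<gamma>_vec by (auto simp: vec_eq_iff)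
    have "\<exists>v\<in>carrier_vec m. \<gamma> *\<^sub>v v = vec 1 (\<lambda>_. u)"
    proof (rule saturated_image[OF A \<gamma> A_inj, where k = n])
      fix i
      from n[of i] obtain v where v: "v \<in> carrier_vec m" "variable i ^ n * u = y \<bullet> v"
        using y by (metis vec_idealE carrier_vecD)
      then have "\<gamma> *\<^sub>v v = variable i ^ n \<cdot>\<^sub>v vec 1 (\<lambda>_. u)"
        unfolding \<gamma>_vec by (intro eq_vecI) auto
      with v(1) show "\<exists>v\<in>carrier_vec m. \<gamma> *\<^sub>v v = variable i ^ n \<cdot>\<^sub>v vec 1 (\<lambda>_. u)" by blast
    qed (use exact in \<open>auto simp: zero[unfolded One_nat_def] y_A\<close>)
    then obtain v where v: "v \<in> carrier_vec m" "vec 1 (\<lambda>_. y \<bullet> v) = vec 1 (\<lambda>_. u)"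
      unfolding \<gamma>_vec by blast
    then have "y \<bullet> v = u" by (metis index_vec less_numeral_extra(1))
    then show "u \<in> vec_ideal y"
      using v(1) y vec_idealI[of v y] by simp
  qed
qed

lemma resolution_vec_ideal:
  "has_graded_minimal_free_resolution (ideal_module (vec_ideal y))
     [replicate_mset m (- D), mset (map (\<lambda>j. - D - \<delta> j) [0..<q])]"
proof -
  have "has_graded_minimal_free_resolution (ideal_module (vec_ideal y))
     (map mset [replicate m (- D), map (\<lambda>j. - D - \<delta> j) [0..<q]])" (is "has_graded_minimal_free_resolution _ (map mset ?tws)")
  proof (rule resolution_of_matrices[where r = 0 and D = "\<lambda>_. A" and \<epsilon> = "(\<bullet>) y"])
    show "graded_hom (free_graded_module (?tws ! 0)) (ideal_module (vec_ideal y)) ((\<bullet>) y)"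
      using graded_hom_vec_ideal(1)[OF y y_hom] by simp
    show "(\<bullet>) y ` carrier_vec (length (?tws ! 0)) = carrier (ideal_module (vec_ideal y))"
      using graded_hom_vec_ideal(2)[OF y y_hom] by simp
    show "A $$ (a, b) \<in> irrelevant_ideal" if "a < length (?tws ! i)" "b < length (?tws ! Suc i)" "i \<le> 0" for i a b
      using that homogeneous_irrelevant[OF A_hom \<delta>_pos, of a b] by simp
  qed (use A exact A_inj A_hom in auto)
  then show ?thesis by simp
qed

end

lemma mult_mat_zero_vec: "M \<in> carrier_mat nr nc \<Longrightarrow> M *\<^sub>v 0\<^sub>v nc = 0\<^sub>v nr"
  by (intro eq_vecI) auto

lemma zero_mat_mult_vec: "v \<in> carrier_vec nc \<Longrightarrow> 0\<^sub>m nr nc *\<^sub>v v = 0\<^sub>v nr"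
  by (intro eq_vecI) auto

lemma smult_mat_mult_vec:
  fixes M :: "'a::comm_semiring_0 mat"
  shows "M \<in> carrier_mat nr nc \<Longrightarrow> v \<in> carrier_vec nc \<Longrightarrow> (c \<cdot>\<^sub>m M) *\<^sub>v v = c \<cdot>\<^sub>v (M *\<^sub>v v)"
  by (intro eq_vecI) (auto simp: scalar_prod_def sum_distrib_left mult.assoc)

text \<open>Here \<open>y\<close> generates an ideal containing the Jacobian ideal, which is generated by \<open>F\<close>. The constant
  matrix \<open>\<Lambda>\<close> expresses \<open>F\<close> by \<open>y\<close>, and \<open>L\<close>, \<open>T\<close>, \<open>P\<close> split it off. Thus \<open>P * A\<close> presents the quotient
  of the two ideals, and \<open>L * A\<close> maps the kernel of \<open>P * A\<close> isomorphically onto the syzygies of \<open>F\<close>.\<close>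

locale jacobian_presentation = free_resolution_2 m q y A D \<delta>
  for m q :: nat and y :: "'k::field poly3 vec" and A :: "'k poly3 mat" and D :: int and \<delta> :: "nat \<Rightarrow> int" +
  fixes p k :: nat and F :: "'k poly3 vec" and \<Lambda> L T P :: "'k poly3 mat"
  assumes F: "F \<in> carrier_vec 3" and \<Lambda>: "\<Lambda> \<in> carrier_mat m 3" and L: "L \<in> carrier_mat 3 m"
    and T: "T \<in> carrier_mat m p" and P: "P \<in> carrier_mat p m"
    and L_\<Lambda>: "L * \<Lambda> = 1\<^sub>m 3" and P_T: "P * T = 1\<^sub>m p" and P_\<Lambda>: "P * \<Lambda> = 0\<^sub>m p 3"
    and \<Lambda>_L_T_P: "\<Lambda> * L + T * P = 1\<^sub>m m"
    and \<Lambda>_F: "\<And>\<theta>. \<theta> \<in> carrier_vec 3 \<Longrightarrow> y \<bullet> (\<Lambda> *\<^sub>v \<theta>) = F \<bullet> \<theta>"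
    and torsion: "\<And>i v. v \<in> carrier_vec m \<Longrightarrow> \<exists>\<theta>\<in>carrier_vec 3. variable i ^ k * (y \<bullet> v) = F \<bullet> \<theta>"
    and pairing: "\<And>\<theta> \<eta>. \<theta> \<in> carrier_vec 3 \<Longrightarrow> \<eta> \<in> carrier_vec 3 \<Longrightarrow> F \<bullet> \<theta> = 0 \<Longrightarrow> F \<bullet> \<eta> = 0 \<Longrightarrow>
      \<exists>c. cross_mat \<theta> *\<^sub>v \<eta> = c \<cdot>\<^sub>v F"
    and F_nonzero: "F \<noteq> 0\<^sub>v 3"
    and F_hom: "\<And>i. i < 3 \<Longrightarrow> homogeneous_of_degree D (F $ i)"
    and \<Lambda>_hom: "\<And>e i. e < m \<Longrightarrow> i < 3 \<Longrightarrow> homogeneous_of_degree 0 (\<Lambda> $$ (e, i))"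
    and T_hom: "\<And>e i. e < m \<Longrightarrow> i < p \<Longrightarrow> homogeneous_of_degree 0 (T $$ (e, i))"
    and P_hom: "\<And>e i. e < p \<Longrightarrow> i < m \<Longrightarrow> homogeneous_of_degree 0 (P $$ (e, i))"
    and degree_1: "\<And>j. j < q \<Longrightarrow> D - \<delta> j \<noteq> 0"
    and degree_2: "\<And>i j. i < q \<Longrightarrow> j < q \<Longrightarrow> i \<noteq> j \<Longrightarrow> D - \<delta> i - \<delta> j \<noteq> 0"
begin

definition N :: "'k poly3 mat" where "N = L * A"
definition B :: "'k poly3 mat" where "B = P * A"

lemma N: "N \<in> carrier_mat 3 q" and B: "B \<in> carrier_mat p q"
  using L A P by (simp_all add: N_def B_def)

lemma N_vec: "v \<in> carrier_vec q \<Longrightarrow> N *\<^sub>v v = L *\<^sub>v (A *\<^sub>v v)"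
  and B_vec: "v \<in> carrier_vec q \<Longrightarrow> B *\<^sub>v v = P *\<^sub>v (A *\<^sub>v v)"
  unfolding N_def B_def using assoc_mult_mat_vec[OF L A] assoc_mult_mat_vec[OF P A] by auto

lemma carriers [simp]:
  "v \<in> carrier_vec q \<Longrightarrow> N *\<^sub>v v \<in> carrier_vec 3"
  "v \<in> carrier_vec q \<Longrightarrow> B *\<^sub>v v \<in> carrier_vec p"
  "v \<in> carrier_vec q \<Longrightarrow> A *\<^sub>v v \<in> carrier_vec m"
  "\<theta> \<in> carrier_vec 3 \<Longrightarrow> \<Lambda> *\<^sub>v \<theta> \<in> carrier_vec m"
  "w \<in> carrier_vec p \<Longrightarrow> T *\<^sub>v w \<in> carrier_vec m"
  "u \<in> carrier_vec m \<Longrightarrow> P *\<^sub>v u \<in> carrier_vec p"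
  "u \<in> carrier_vec m \<Longrightarrow> L *\<^sub>v u \<in> carrier_vec 3"
  "F \<in> carrier_vec 3" "y \<in> carrier_vec m" "dim_vec F = 3" "dim_vec y = m"
  using N B A \<Lambda> T P L F y by auto

lemma split_vec: "u \<in> carrier_vec m \<Longrightarrow> u = \<Lambda> *\<^sub>v (L *\<^sub>v u) + T *\<^sub>v (P *\<^sub>v u)"
proof -
  assume u: "u \<in> carrier_vec m"
  have "(\<Lambda> * L + T * P) *\<^sub>v u = (\<Lambda> * L) *\<^sub>v u + (T * P) *\<^sub>v u"
    using \<Lambda> L T P u by (intro add_mult_distrib_mat_vec[of _ m m]) auto
  then show ?thesis
    unfolding \<Lambda>_L_T_P assoc_mult_mat_vec[OF \<Lambda> L u] assoc_mult_mat_vec[OF T P u] using u by simp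
qed

lemma L_\<Lambda>_vec: "\<theta> \<in> carrier_vec 3 \<Longrightarrow> L *\<^sub>v (\<Lambda> *\<^sub>v \<theta>) = \<theta>"
  using assoc_mult_mat_vec[OF L \<Lambda>, of \<theta>] unfolding L_\<Lambda> by simp

lemma P_\<Lambda>_vec: "\<theta> \<in> carrier_vec 3 \<Longrightarrow> P *\<^sub>v (\<Lambda> *\<^sub>v \<theta>) = 0\<^sub>v p"
  using assoc_mult_mat_vec[OF P \<Lambda>, of \<theta>] unfolding P_\<Lambda> by (simp add: zero_mat_mult_vec)

lemma P_T_vec: "w \<in> carrier_vec p \<Longrightarrow> P *\<^sub>v (T *\<^sub>v w) = w"
  using assoc_mult_mat_vec[OF P T, of w] unfolding P_T by simp

text \<open>If \<open>B\<close> kills \<open>v\<close>, the \<open>T\<close>-part of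
  \<open>A *\<^sub>v v\<close> vanishes, so \<open>A *\<^sub>v v\<close> comes from a syzygy of
  \<open>F\<close>.\<close>

lemma kernel_B:
  assumes "v \<in> carrier_vec q" "B *\<^sub>v v = 0\<^sub>v p"
  shows "A *\<^sub>v v = \<Lambda> *\<^sub>v (N *\<^sub>v v)" and "F \<bullet> (N *\<^sub>v v) = 0"
proof -
  show *: "A *\<^sub>v v = \<Lambda> *\<^sub>v (N *\<^sub>v v)"
    using split_vec[of "A *\<^sub>v v"] assms by (simp add: N_vec B_vec mult_mat_zero_vec[OF T])
  show "F \<bullet> (N *\<^sub>v v) = 0"
    using y_A[OF assms(1)] assms(1) unfolding * by (simp add: \<Lambda>_F)
qed

lemma syzygy_lift:
  assumes "\<theta> \<in> carrier_vec 3" "F \<bullet> \<theta> = 0"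
  shows "\<exists>v\<in>carrier_vec q. \<Lambda> *\<^sub>v \<theta> = A *\<^sub>v v"
  using exact[of "\<Lambda> *\<^sub>v \<theta>"] assms by (simp add: \<Lambda>_F)

lemma of_syzygy_lift:
  assumes "v \<in> carrier_vec q" "\<theta> \<in> carrier_vec 3" "A *\<^sub>v v = \<Lambda> *\<^sub>v \<theta>"
  shows "B *\<^sub>v v = 0\<^sub>v p" and "N *\<^sub>v v = \<theta>"
  using assms by (simp_all add: B_vec N_vec P_\<Lambda>_vec L_\<Lambda>_vec)

text \<open>This identifies the cokernel of \<open>B\<close> with the quotient of the two ideals. If
  \<open>T *\<^sub>v w\<close> and \<open>\<Lambda> *\<^sub>v \<theta>\<close> give the same
  element, their difference is a relation, and \<open>P\<close> recovers \<open>w\<close> from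
  it.\<close>

lemma T_in_jacobian:
  assumes w: "w \<in> carrier_vec p"
  shows "y \<bullet> (T *\<^sub>v w) \<in> vec_ideal F \<longleftrightarrow> (\<exists>v\<in>carrier_vec q. w = B *\<^sub>v v)"
proof
  assume "y \<bullet> (T *\<^sub>v w) \<in> vec_ideal F"
  then obtain \<theta> where \<theta>: "\<theta> \<in> carrier_vec 3" "y \<bullet> (T *\<^sub>v w) = F \<bullet> \<theta>"
    using F by (metis vec_idealE carrier_vecD)
  have "y \<bullet> (T *\<^sub>v w - \<Lambda> *\<^sub>v \<theta>) = 0"
    using scalar_prod_minus_distrib[of y m "T *\<^sub>v w" "\<Lambda> *\<^sub>v \<theta>"] w \<theta> by (simp add: \<Lambda>_F)
  then obtain v where v: "v \<in> carrier_vec q" "T *\<^sub>v w - \<Lambda> *\<^sub>v \<theta> = A *\<^sub>v v"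
    using exact[of "T *\<^sub>v w - \<Lambda> *\<^sub>v \<theta>"] w \<theta>(1) by auto
  have "B *\<^sub>v v = P *\<^sub>v (T *\<^sub>v w) - P *\<^sub>v (\<Lambda> *\<^sub>v \<theta>)"
    unfolding B_vec[OF v(1)] v(2)[symmetric] using w \<theta>(1) by (intro mult_minus_distrib_mat_vec[OF P]) auto
  also have "\<dots> = w"
    using w \<theta>(1) by (simp add: P_T_vec P_\<Lambda>_vec)
  finally show "\<exists>v\<in>carrier_vec q. w = B *\<^sub>v v" using v(1) by metis
next
  assume "\<exists>v\<in>carrier_vec q. w = B *\<^sub>v v"
  then obtain v where v: "v \<in> carrier_vec q" "w = B *\<^sub>v v" by blast
  have "A *\<^sub>v v = \<Lambda> *\<^sub>v (N *\<^sub>v v) + T *\<^sub>v w"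
    using split_vec[of "A *\<^sub>v v"] v by (simp add: N_vec B_vec)
  then have "0 = F \<bullet> (N *\<^sub>v v) + y \<bullet> (T *\<^sub>v w)"
    using y_A[OF v(1)] v scalar_prod_add_distrib[of y m "\<Lambda> *\<^sub>v (N *\<^sub>v v)" "T *\<^sub>v w"] by (simp add: \<Lambda>_F)
  then have "y \<bullet> (T *\<^sub>v w) = - 1 * (F \<bullet> (N *\<^sub>v v))"
    by (simp add: eq_neg_iff_add_eq_0 add.commute)
  moreover have "F \<bullet> (N *\<^sub>v v) \<in> vec_ideal F"
    using v F by (intro vec_idealI) auto
  ultimately show "y \<bullet> (T *\<^sub>v w) \<in> vec_ideal F"
    using S_ring_ideal_mult[OF ideal_vec_ideal] by metis
qed

lemma y_split: "u \<in> carrier_vec m \<Longrightarrow> y \<bullet> u - y \<bullet> (T *\<^sub>v (P *\<^sub>v u)) \<in> vec_ideal F"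
proof -
  assume u: "u \<in> carrier_vec m"
  have "y \<bullet> u = F \<bullet> (L *\<^sub>v u) + y \<bullet> (T *\<^sub>v (P *\<^sub>v u))"
    using arg_cong[OF split_vec[OF u], of "(\<bullet>) y"] u
      scalar_prod_add_distrib[of y m "\<Lambda> *\<^sub>v (L *\<^sub>v u)" "T *\<^sub>v (P *\<^sub>v u)"] by (simp add: \<Lambda>_F)
  then show ?thesis
    using vec_idealI[of "L *\<^sub>v u" F] u F by simp
qed

text \<open>The power of the variable annihilates the cokernel of \<open>B\<close>, so
  \<open>B\<close> has a section up to this factor. The duality arguments below use finite length in
  this form.\<close>

lemma scaled_section: "\<exists>W\<in>carrier_mat q p. variable i ^ k \<cdot>\<^sub>m 1\<^sub>m p = B * W"
proof (rule factor_columns[OF B])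
  fix e assume e: "e < p"
  define w where "w = variable i ^ k \<cdot>\<^sub>v (unit_vec p e :: 'k poly3 vec)"
  have w: "w \<in> carrier_vec p" by (simp add: w_def)
  obtain \<theta> where "\<theta> \<in> carrier_vec 3" "variable i ^ k * (y \<bullet> (T *\<^sub>v unit_vec p e)) = F \<bullet> \<theta>"
    using torsion[of "T *\<^sub>v unit_vec p e" i] by auto
  moreover have "y \<bullet> (T *\<^sub>v w) = variable i ^ k * (y \<bullet> (T *\<^sub>v unit_vec p e))"
    unfolding w_def using T by (simp add: mult_mat_smult_vec[OF T])
  ultimately have "y \<bullet> (T *\<^sub>v w) \<in> vec_ideal F"
    using F by (auto intro!: vec_idealI)
  then obtain v where "v \<in> carrier_vec q" "w = B *\<^sub>v v"
    using T_in_jacobian[OF w] by blast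
  moreover have "(variable i ^ k \<cdot>\<^sub>m 1\<^sub>m p) *\<^sub>v unit_vec p e = w"
    unfolding w_def by (simp add: smult_mat_mult_vec[of _ p p])
  ultimately show "\<exists>v\<in>carrier_vec q. (variable i ^ k \<cdot>\<^sub>m 1\<^sub>m p) *\<^sub>v unit_vec p e = B *\<^sub>v v" by metis
qed simp

definition W :: "3 \<Rightarrow> 'k poly3 mat" where
  "W i = (SOME W. W \<in> carrier_mat q p \<and> variable i ^ k \<cdot>\<^sub>m 1\<^sub>m p = B * W)"

lemma W: "W i \<in> carrier_mat q p" and B_W: "variable i ^ k \<cdot>\<^sub>m 1\<^sub>m p = B * W i"
  using someI_ex[of "\<lambda>W. W \<in> carrier_mat q p \<and> variable i ^ k \<cdot>\<^sub>m 1\<^sub>m p = B * W"] scaled_section[of i]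
  unfolding W_def by (auto simp: Bex_def)

lemma W_carrier [simp]: "u \<in> carrier_vec p \<Longrightarrow> W i *\<^sub>v u \<in> carrier_vec q"
  using W[of i] by auto

lemma B_W_vec: "u \<in> carrier_vec p \<Longrightarrow> B *\<^sub>v (W i *\<^sub>v u) = variable i ^ k \<cdot>\<^sub>v u"
  using assoc_mult_mat_vec[OF B W, of u i] unfolding B_W[symmetric]
  by (simp add: smult_mat_mult_vec[of _ p p])

subsection \<open>The syzygies of \<open>F\<close> and the dual of \<open>A\<close>\<close>

text \<open>The columns of \<open>Z\<close> are the lifts of the Koszul syzygies.\<close>

lemma Z_exists: "\<exists>Z\<in>carrier_mat q 3. \<Lambda> * cross_mat F = A * Z"
proof (rule factor_columns[OF A])
  show "\<Lambda> * cross_mat F \<in> carrier_mat m 3"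
    using \<Lambda> cross_mat_carrier by (rule mult_carrier_mat)
  fix j assume "j < (3::nat)"
  have "(\<Lambda> * cross_mat F) *\<^sub>v unit_vec 3 j = \<Lambda> *\<^sub>v (cross_mat F *\<^sub>v unit_vec 3 j)"
    by (rule assoc_mult_mat_vec[OF \<Lambda> cross_mat_carrier]) simp
  then show "\<exists>w\<in>carrier_vec q. (\<Lambda> * cross_mat F) *\<^sub>v unit_vec 3 j = A *\<^sub>v w"
    using syzygy_lift[of "cross_mat F *\<^sub>v unit_vec 3 j"] by (simp add: scalar_prod_cross_self)
qed

definition Z :: "'k poly3 mat" where
  "Z = (SOME Z. Z \<in> carrier_mat q 3 \<and> \<Lambda> * cross_mat F = A * Z)"

lemma Z: "Z \<in> carrier_mat q 3" and A_Z: "\<Lambda> * cross_mat F = A * Z"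
  using someI_ex[of "\<lambda>Z. Z \<in> carrier_mat q 3 \<and> \<Lambda> * cross_mat F = A * Z"] Z_exists
  unfolding Z_def by (auto simp: Bex_def)

lemma Z_carrier [simp]: "w \<in> carrier_vec 3 \<Longrightarrow> Z *\<^sub>v w \<in> carrier_vec q"
  using Z by auto

lemma A_Z_vec: "w \<in> carrier_vec 3 \<Longrightarrow> A *\<^sub>v (Z *\<^sub>v w) = \<Lambda> *\<^sub>v (cross_mat F *\<^sub>v w)"
  using assoc_mult_mat_vec[OF A Z, of w] assoc_mult_mat_vec[OF \<Lambda> cross_mat_carrier, of w F]
  unfolding A_Z by simp

lemma B_Z_vec: "w \<in> carrier_vec 3 \<Longrightarrow> B *\<^sub>v (Z *\<^sub>v w) = 0\<^sub>v p"
  and N_Z_vec: "w \<in> carrier_vec 3 \<Longrightarrow> N *\<^sub>v (Z *\<^sub>v w) = cross_mat F *\<^sub>v w"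
  using of_syzygy_lift[of "Z *\<^sub>v w" "cross_mat F *\<^sub>v w"] by (simp_all add: A_Z_vec)

text \<open>Since \<open>N *\<^sub>v v\<close> is orthogonal to \<open>F\<close>, the double cross
  product has a single term. So the Koszul syzygies reach every kernel vector of \<open>B\<close>
  after multiplication by a polynomial.\<close>

lemma Z_cross:
  assumes v: "v \<in> carrier_vec q" "B *\<^sub>v v = 0\<^sub>v p" and w: "w \<in> carrier_vec 3"
  shows "Z *\<^sub>v (cross_mat w *\<^sub>v (N *\<^sub>v v)) = (- (F \<bullet> w)) \<cdot>\<^sub>v v"
proof (rule A_cancel)
  have "cross_mat F *\<^sub>v (cross_mat w *\<^sub>v (N *\<^sub>v v)) = (- (F \<bullet> w)) \<cdot>\<^sub>v (N *\<^sub>v v)"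
    using v w carrier_matD(1)[OF N] carrier_vecD[OF w]
    by (subst cross_cross) (simp_all add: vec_eq_3_iff kernel_B(2)[OF v])
  then have "A *\<^sub>v (Z *\<^sub>v (cross_mat w *\<^sub>v (N *\<^sub>v v))) = \<Lambda> *\<^sub>v ((- (F \<bullet> w)) \<cdot>\<^sub>v (N *\<^sub>v v))"
    using v w by (simp add: A_Z_vec)
  also have "\<dots> = (- (F \<bullet> w)) \<cdot>\<^sub>v (A *\<^sub>v v)"
    unfolding kernel_B(1)[OF v] using v(1) by (intro mult_mat_smult_vec[OF \<Lambda>]) simp
  also have "\<dots> = A *\<^sub>v ((- (F \<bullet> w)) \<cdot>\<^sub>v v)"
    by (rule mult_mat_smult_vec[OF A v(1), symmetric])
  finally show "A *\<^sub>v (Z *\<^sub>v (cross_mat w *\<^sub>v (N *\<^sub>v v))) = A *\<^sub>v ((- (F \<bullet> w)) \<cdot>\<^sub>v v)" .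
qed (use v w in auto)

lemma F_scalar_nonzero: "\<exists>w\<in>carrier_vec 3. F \<bullet> w \<noteq> 0"
proof (rule ccontr)
  assume "\<not> ?thesis"
  then have "F = 0\<^sub>v 3"
    by (intro vec_eq_scalar_prodI[of _ 3]) auto
  with F_nonzero show False by simp
qed

text \<open>\<open>Z\<close> maps into the kernel of \<open>B\<close>, so its transpose kills the
  image of \<open>Bt\<close>. The image of \<open>R\<close> turns out to be the whole syzygy module
  of \<open>F\<close>.\<close>

definition R :: "'k poly3 mat" where "R = transpose_mat Z"

lemma R: "R \<in> carrier_mat 3 q"
  using Z by (simp add: R_def)

lemma R_carrier [simp]: "v \<in> carrier_vec q \<Longrightarrow> R *\<^sub>v v \<in> carrier_vec 3"
  using R by auto

lemma R_scalar_prod: "v \<in> carrier_vec q \<Longrightarrow> w \<in> carrier_vec 3 \<Longrightarrow> (R *\<^sub>v v) \<bullet> w = v \<bullet> (Z *\<^sub>v w)"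
  unfolding R_def by (rule transpose_vec_mult_scalar[OF Z])

lemma F_R: "v \<in> carrier_vec q \<Longrightarrow> F \<bullet> (R *\<^sub>v v) = 0"
proof -
  assume v: "v \<in> carrier_vec q"
  have "Z *\<^sub>v F = 0\<^sub>v q"
    by (rule A_inj) (simp_all add: A_Z_vec cross_self mult_mat_zero_vec[OF \<Lambda>])
  then show ?thesis
    using R_scalar_prod[OF v, of F] v comm_scalar_prod[of F 3 "R *\<^sub>v v"] by simp
qed

abbreviation Bt :: "'k poly3 mat" where "Bt \<equiv> transpose_mat B"

lemma Bt: "Bt \<in> carrier_mat q p"
  using B by simp

lemma Bt_carrier [simp]: "w \<in> carrier_vec p \<Longrightarrow> Bt *\<^sub>v w \<in> carrier_vec q"
  using B by auto

lemma Bt_scalar_prod: "w \<in> carrier_vec p \<Longrightarrow> v \<in> carrier_vec q \<Longrightarrow> (Bt *\<^sub>v w) \<bullet> v = w \<bullet> (B *\<^sub>v v)"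
  by (rule transpose_vec_mult_scalar[OF B])

text \<open>Hom(M, S) = 0: a linear form that vanishes on the image of \<open>B\<close> vanishes on
  all multiples of \<open>variable 0 ^ k\<close>, hence everywhere.\<close>

lemma Bt_inj:
  assumes w: "w \<in> carrier_vec p" "Bt *\<^sub>v w = 0\<^sub>v q"
  shows "w = 0\<^sub>v p"
proof (rule vec_eq_scalar_prodI[of _ p])
  fix u :: "'k poly3 vec" assume u: "u \<in> carrier_vec p"
  have "variable 0 ^ k * (w \<bullet> u) = (Bt *\<^sub>v w) \<bullet> (W 0 *\<^sub>v u)"
    using w(1) u by (simp add: Bt_scalar_prod B_W_vec)
  also have "\<dots> = 0"
    unfolding w(2) using u by simp
  finally show "w \<bullet> u = 0\<^sub>v p \<bullet> u" using u by simp
qed (use w in auto)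

lemma R_Bt: "w \<in> carrier_vec p \<Longrightarrow> R *\<^sub>v (Bt *\<^sub>v w) = 0\<^sub>v 3"
  by (rule vec_eq_scalar_prodI[of _ 3]) (simp_all add: R_scalar_prod Bt_scalar_prod B_Z_vec)

text \<open>A vector killed by \<open>R\<close> annihilates the kernel of \<open>B\<close>, so it is
  a linear form on the image of \<open>B\<close>. That it extends to the whole free module
  corresponds to Ext^1(M, S) = 0.\<close>

lemma kernel_R:
  assumes v: "v \<in> carrier_vec q" "R *\<^sub>v v = 0\<^sub>v 3"
  shows "\<exists>w\<in>carrier_vec p. v = Bt *\<^sub>v w"
proof -
  \<comment> \<open>By \<open>Z_cross\<close> a nonzero multiple of \<open>\<zeta>\<close> lies in
    the image of \<open>Z\<close>, on which \<open>v\<close> vanishes because \<open>R\<close> kills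
    it.\<close>
  have orth: "v \<bullet> \<zeta> = 0" if \<zeta>: "\<zeta> \<in> carrier_vec q" "B *\<^sub>v \<zeta> = 0\<^sub>v p" for \<zeta>
  proof -
    obtain w where w: "w \<in> carrier_vec 3" "F \<bullet> w \<noteq> 0"
      using F_scalar_nonzero by blast
    have "- (F \<bullet> w) * (v \<bullet> \<zeta>) = v \<bullet> (Z *\<^sub>v (cross_mat w *\<^sub>v (N *\<^sub>v \<zeta>)))"
      unfolding Z_cross[OF \<zeta> w(1)] using v(1) \<zeta>(1) by simp
    also have "\<dots> = (R *\<^sub>v v) \<bullet> (cross_mat w *\<^sub>v (N *\<^sub>v \<zeta>))"
      using v(1) \<zeta>(1) w(1) by (simp add: R_scalar_prod)
    also have "\<dots> = 0"
      unfolding v(2) using \<zeta>(1) by simp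
    finally show ?thesis using w(2) by simp
  qed
  \<comment> \<open>The sections for two variables, scaled crosswise, differ by a kernel vector of
    \<open>B\<close>. Regularity then makes the value divisible by \<open>variable 0 ^ k\<close>;
    the quotients are the coordinates of the extension.\<close>
  have "\<exists>c. v \<bullet> (W 0 *\<^sub>v unit_vec p e) = variable 0 ^ k * c" if "e < p" for e
  proof -
    define a b where "a = W 0 *\<^sub>v unit_vec p e" and "b = W 1 *\<^sub>v unit_vec p e"
    have ab: "a \<in> carrier_vec q" "b \<in> carrier_vec q" by (simp_all add: a_def b_def)
    have "B *\<^sub>v (variable 1 ^ k \<cdot>\<^sub>v a - variable 0 ^ k \<cdot>\<^sub>v b) =
       variable 1 ^ k \<cdot>\<^sub>v (B *\<^sub>v a) - variable 0 ^ k \<cdot>\<^sub>v (B *\<^sub>v b)"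
      using ab by (simp add: mult_minus_distrib_mat_vec[OF B] mult_mat_smult_vec[OF B])
    also have "\<dots> = 0\<^sub>v p"
      unfolding a_def b_def by (simp add: B_W_vec smult_smult_assoc mult.commute)
    finally have "v \<bullet> (variable 1 ^ k \<cdot>\<^sub>v a - variable 0 ^ k \<cdot>\<^sub>v b) = 0"
      using ab by (intro orth) auto
    then have "variable 1 ^ k * (v \<bullet> a) = variable 0 ^ k * (v \<bullet> b)"
      using v(1) ab scalar_prod_minus_distrib[of v q "variable 1 ^ k \<cdot>\<^sub>v a" "variable 0 ^ k \<cdot>\<^sub>v b"] by simp
    then show ?thesis
      unfolding a_def by (rule variable_powers_regular2[rotated]) auto
  qed
  then obtain c where c: "\<And>e. e < p \<Longrightarrow> v \<bullet> (W 0 *\<^sub>v unit_vec p e) = variable 0 ^ k * c e" by metis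
  define w where "w = vec p c"
  have w: "w \<in> carrier_vec p" by (simp add: w_def)
  have "transpose_mat (W 0) *\<^sub>v v = variable 0 ^ k \<cdot>\<^sub>v w"
  proof (rule eq_vecI)
    fix e assume "e < dim_vec (variable 0 ^ k \<cdot>\<^sub>v w)"
    then have e: "e < p" by (simp add: w_def)
    have "(transpose_mat (W 0) *\<^sub>v v) $ e = (transpose_mat (W 0) *\<^sub>v v) \<bullet> unit_vec p e"
      using W[of 0] v(1) e by (subst scalar_prod_right_unit) auto
    also have "\<dots> = v \<bullet> (W 0 *\<^sub>v unit_vec p e)"
      by (rule transpose_vec_mult_scalar[OF W _ v(1)]) simp
    finally show "(transpose_mat (W 0) *\<^sub>v v) $ e = (variable 0 ^ k \<cdot>\<^sub>v w) $ e"
      using c[OF e] e by (simp add: w_def)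
  qed (use W[of 0] in \<open>simp add: w_def\<close>)
  then have Wv: "v \<bullet> (W 0 *\<^sub>v u) = variable 0 ^ k * (w \<bullet> u)" if "u \<in> carrier_vec p" for u
    using transpose_vec_mult_scalar[OF W that v(1), of 0] w that by simp
  have "v = Bt *\<^sub>v w"
  proof (rule vec_eq_scalar_prodI[of _ q])
    fix u :: "'k poly3 vec" assume u: "u \<in> carrier_vec q"
    \<comment> \<open>Both vectors have the same image under \<open>B\<close>, so \<open>v\<close>
      takes the same value on them.\<close>
    have "B *\<^sub>v (variable 0 ^ k \<cdot>\<^sub>v u - W 0 *\<^sub>v (B *\<^sub>v u)) = 0\<^sub>v p"
      using u by (simp add: mult_minus_distrib_mat_vec[OF B] mult_mat_smult_vec[OF B] B_W_vec)
    then have "v \<bullet> (variable 0 ^ k \<cdot>\<^sub>v u - W 0 *\<^sub>v (B *\<^sub>v u)) = 0"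
      using u by (intro orth) auto
    then have "variable 0 ^ k * (v \<bullet> u) = variable 0 ^ k * (w \<bullet> (B *\<^sub>v u))"
      using u v(1) scalar_prod_minus_distrib[of v q "variable 0 ^ k \<cdot>\<^sub>v u" "W 0 *\<^sub>v (B *\<^sub>v u)"] by (simp add: Wv)
    then show "v \<bullet> u = (Bt *\<^sub>v w) \<bullet> u"
      using u w by (simp add: Bt_scalar_prod)
  qed (use v w in auto)
  with w show ?thesis by blast
qed

text \<open>A syzygy \<open>\<theta>\<close> pairs with the kernel of \<open>B\<close> by \<open>\<theta> \<times> N \<zeta> = c F\<close>. Composing with the scaled projection
  \<open>x\<^sub>i\<^sup>k - W B\<close> onto this kernel represents \<open>x\<^sub>i\<^sup>k \<theta>\<close> in the image of \<open>R\<close>.\<close>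

lemma R_surjective:
  assumes \<theta>: "\<theta> \<in> carrier_vec 3" "F \<bullet> \<theta> = 0"
  shows "\<exists>v\<in>carrier_vec q. R *\<^sub>v v = \<theta>"
\<comment> \<open>The cokernel of \<open>R\<close> has no torsion at the origin, so it suffices to
  reach the multiples of \<open>\<theta>\<close> by powers of the variables. This corresponds to
  Ext^2(M, S) = 0.\<close>
proof (rule saturated_image[OF Bt R Bt_inj R_Bt kernel_R \<theta>(1), where k = k])
  fix i :: 3
  define x where "x = (variable i ^ k :: 'k poly3)"
  define \<pi> where "\<pi> = (\<lambda>u. x \<cdot>\<^sub>v u - W i *\<^sub>v (B *\<^sub>v u))"
  have \<pi>: "\<pi> u \<in> carrier_vec q" "B *\<^sub>v \<pi> u = 0\<^sub>v p" if "u \<in> carrier_vec q" for u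
    using that by (simp_all add: \<pi>_def x_def mult_minus_distrib_mat_vec[OF B] mult_mat_smult_vec[OF B] B_W_vec)
  define M where "M = cross_mat \<theta> * (N * (x \<cdot>\<^sub>m 1\<^sub>m q - W i * B))"
  have M: "M \<in> carrier_mat 3 q"
    using N W[of i] B unfolding M_def by (intro mult_carrier_mat[OF cross_mat_carrier] mult_carrier_mat[of _ 3 q]) auto
  have M_vec: "M *\<^sub>v u = cross_mat \<theta> *\<^sub>v (N *\<^sub>v \<pi> u)" if u: "u \<in> carrier_vec q" for u
  proof -
    have "(x \<cdot>\<^sub>m 1\<^sub>m q - W i * B) *\<^sub>v u = \<pi> u"
      using u W[of i] B unfolding \<pi>_def
      by (subst minus_mult_distrib_mat_vec[of _ q q]) (auto simp: smult_mat_mult_vec[of _ q q])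
    moreover have "M *\<^sub>v u = cross_mat \<theta> *\<^sub>v ((N * (x \<cdot>\<^sub>m 1\<^sub>m q - W i * B)) *\<^sub>v u)"
      unfolding M_def using N W[of i] B u by (intro assoc_mult_mat_vec[OF cross_mat_carrier]) auto
    moreover have "(N * (x \<cdot>\<^sub>m 1\<^sub>m q - W i * B)) *\<^sub>v u = N *\<^sub>v ((x \<cdot>\<^sub>m 1\<^sub>m q - W i * B) *\<^sub>v u)"
      using W[of i] B u by (intro assoc_mult_mat_vec[OF N]) auto
    ultimately show ?thesis by simp
  qed
  \<comment> \<open>The pairing makes each column of \<open>M\<close> a multiple of
    \<open>F\<close>; the factors are the entries of the vector sought.\<close>
  have "\<exists>c. M *\<^sub>v unit_vec q j = c \<cdot>\<^sub>v F" for j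
    using pairing[OF \<theta>(1) _ \<theta>(2), of "N *\<^sub>v \<pi> (unit_vec q j)"] \<pi>[of "unit_vec q j"] kernel_B(2)
    by (simp add: M_vec)
  then obtain c where c: "\<And>j. M *\<^sub>v unit_vec q j = c j \<cdot>\<^sub>v F" by metis
  define v where "v = vec q c"
  have v: "v \<in> carrier_vec q" by (simp add: v_def)
  have M_v: "M *\<^sub>v u = (v \<bullet> u) \<cdot>\<^sub>v F" if u: "u \<in> carrier_vec q" for u
  proof (rule eq_vecI)
    fix r assume "r < dim_vec ((v \<bullet> u) \<cdot>\<^sub>v F)"
    then have r: "r < 3" using F by simp
    have "M $$ (r, j) = c j * F $ r" if j: "j < q" for j
    proof -
      have "M $$ (r, j) = (M *\<^sub>v unit_vec q j) $ r"
        using M r j by simp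
      then show ?thesis unfolding c using r F by simp
    qed
    then have "(M *\<^sub>v u) $ r = (\<Sum>j\<in>{0..<q}. c j * F $ r * u $ j)"
      using M r u by (simp add: scalar_prod_def)
    also have "\<dots> = (v \<bullet> u) * F $ r"
      using u by (simp add: scalar_prod_def v_def sum_distrib_left mult_ac)
    finally show "(M *\<^sub>v u) $ r = ((v \<bullet> u) \<cdot>\<^sub>v F) $ r"
      using r F by simp
  qed (use M F in simp)
  have "R *\<^sub>v v = x \<cdot>\<^sub>v \<theta>"
  proof (rule vec_eq_scalar_prodI[of _ 3])
    fix w :: "'k poly3 vec" assume w: "w \<in> carrier_vec 3"
    \<comment> \<open>As \<open>B\<close> kills the image of \<open>Z\<close>, the scaled projection
      acts there as the scalar \<open>x\<close>. What remains is the cross product of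
      \<open>\<theta>\<close> with that of \<open>F\<close> and \<open>w\<close>, which is
      \<open>\<theta> \<bullet> w\<close> times \<open>F\<close>.\<close>
    have "\<pi> (Z *\<^sub>v w) = x \<cdot>\<^sub>v (Z *\<^sub>v w)"
    proof -
      have "x \<cdot>\<^sub>v u - 0\<^sub>v q = x \<cdot>\<^sub>v u" if "u \<in> carrier_vec q" for u
        using that by (intro eq_vecI) auto
      then show ?thesis
        using w by (simp add: \<pi>_def B_Z_vec mult_mat_zero_vec[OF W])
    qed
    then have "N *\<^sub>v \<pi> (Z *\<^sub>v w) = x \<cdot>\<^sub>v (cross_mat F *\<^sub>v w)"
      using w by (simp add: mult_mat_smult_vec[OF N] N_Z_vec)
    then have "M *\<^sub>v (Z *\<^sub>v w) = x \<cdot>\<^sub>v (cross_mat \<theta> *\<^sub>v (cross_mat F *\<^sub>v w))"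
      using w by (simp add: M_vec mult_mat_smult_vec[OF cross_mat_carrier])
    also have "\<dots> = (x * (\<theta> \<bullet> w)) \<cdot>\<^sub>v F"
      using \<theta> w comm_scalar_prod[OF \<theta>(1) F]
      by (subst cross_cross[OF \<theta>(1) F w]) (simp_all add: vec_eq_3_iff)
    finally have *: "((v \<bullet> (Z *\<^sub>v w)) \<cdot>\<^sub>v F) = (x * (\<theta> \<bullet> w)) \<cdot>\<^sub>v F"
      using w by (simp add: M_v)
    obtain u where u: "u \<in> carrier_vec 3" "F \<bullet> u \<noteq> 0"
      using F_scalar_nonzero by blast
    have "(v \<bullet> (Z *\<^sub>v w)) * (F \<bullet> u) = (x * (\<theta> \<bullet> w)) * (F \<bullet> u)"
      using arg_cong[OF *, of "\<lambda>z. z \<bullet> u"] u(1) by simp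
    then show "(R *\<^sub>v v) \<bullet> w = (x \<cdot>\<^sub>v \<theta>) \<bullet> w"
      using u(2) v w \<theta>(1) by (simp add: R_scalar_prod)
  qed (use v \<theta> in auto)
  with v show "\<exists>v\<in>carrier_vec q. R *\<^sub>v v = variable i ^ k \<cdot>\<^sub>v \<theta>"
    unfolding x_def by blast
qed

text \<open>This splices the two halves: \<open>R\<close> onto the syzygies of \<open>F\<close>,
  followed by their isomorphism with the kernel of \<open>B\<close>.\<close>

lemma \<Phi>_exists: "\<exists>\<Phi>\<in>carrier_mat q q. \<Lambda> * R = A * \<Phi>"
proof (rule factor_columns[OF A])
  show "\<Lambda> * R \<in> carrier_mat m q"
    using \<Lambda> R by (rule mult_carrier_mat)
  fix j
  show "\<exists>w\<in>carrier_vec q. (\<Lambda> * R) *\<^sub>v unit_vec q j = A *\<^sub>v w"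
    using syzygy_lift[of "R *\<^sub>v unit_vec q j"] assoc_mult_mat_vec[OF \<Lambda> R, of "unit_vec q j"] by (simp add: F_R)
qed

definition \<Phi> :: "'k poly3 mat" where
  "\<Phi> = (SOME M. M \<in> carrier_mat q q \<and> \<Lambda> * R = A * M)"

lemma \<Phi>: "\<Phi> \<in> carrier_mat q q" and A_\<Phi>: "\<Lambda> * R = A * \<Phi>"
  using someI_ex[of "\<lambda>M. M \<in> carrier_mat q q \<and> \<Lambda> * R = A * M"] \<Phi>_exists
  unfolding \<Phi>_def by (auto simp: Bex_def)

lemma \<Phi>_carrier [simp]: "v \<in> carrier_vec q \<Longrightarrow> \<Phi> *\<^sub>v v \<in> carrier_vec q"
  using \<Phi> by auto

lemma A_\<Phi>_vec: "v \<in> carrier_vec q \<Longrightarrow> A *\<^sub>v (\<Phi> *\<^sub>v v) = \<Lambda> *\<^sub>v (R *\<^sub>v v)"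
  using assoc_mult_mat_vec[OF A \<Phi>, of v] assoc_mult_mat_vec[OF \<Lambda> R, of v] unfolding A_\<Phi> by simp

lemma B_\<Phi>_vec: "v \<in> carrier_vec q \<Longrightarrow> B *\<^sub>v (\<Phi> *\<^sub>v v) = 0\<^sub>v p"
  and N_\<Phi>_vec: "v \<in> carrier_vec q \<Longrightarrow> N *\<^sub>v (\<Phi> *\<^sub>v v) = R *\<^sub>v v"
  using of_syzygy_lift[of "\<Phi> *\<^sub>v v" "R *\<^sub>v v"] by (simp_all add: A_\<Phi>_vec)

lemma exact_B_\<Phi>:
  assumes v: "v \<in> carrier_vec q"
  shows "B *\<^sub>v v = 0\<^sub>v p \<longleftrightarrow> (\<exists>w\<in>carrier_vec q. v = \<Phi> *\<^sub>v w)"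
proof
  assume Bv: "B *\<^sub>v v = 0\<^sub>v p"
  obtain w where w: "w \<in> carrier_vec q" "R *\<^sub>v w = N *\<^sub>v v"
    using R_surjective[OF _ kernel_B(2)[OF v Bv]] v by auto
  have "v = \<Phi> *\<^sub>v w"
    by (rule A_cancel[OF v]) (use w in \<open>simp_all add: A_\<Phi>_vec kernel_B(1)[OF v Bv]\<close>)
  with w show "\<exists>w\<in>carrier_vec q. v = \<Phi> *\<^sub>v w" by blast
qed (auto simp: B_\<Phi>_vec)

lemma \<Phi>_zero_iff:
  assumes v: "v \<in> carrier_vec q"
  shows "\<Phi> *\<^sub>v v = 0\<^sub>v q \<longleftrightarrow> R *\<^sub>v v = 0\<^sub>v 3"
proof
  assume "\<Phi> *\<^sub>v v = 0\<^sub>v q"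
  then show "R *\<^sub>v v = 0\<^sub>v 3"
    using N_\<Phi>_vec[OF v] mult_mat_zero_vec[OF N] by simp
next
  assume "R *\<^sub>v v = 0\<^sub>v 3"
  then have "A *\<^sub>v (\<Phi> *\<^sub>v v) = 0\<^sub>v m"
    using A_\<Phi>_vec[OF v] mult_mat_zero_vec[OF \<Lambda>] by simp
  then show "\<Phi> *\<^sub>v v = 0\<^sub>v q"
    using v by (intro A_inj) auto
qed

text \<open>\<open>\<Phi>\<close> is alternating. This makes the resolution minimal even when the degree of a diagonal
  entry is 0.\<close>

lemma \<Phi>_diagonal:
  assumes j: "j < q"
  shows "\<Phi> $$ (j, j) = 0"
proof -
  define e where "e = (unit_vec q j :: 'k poly3 vec)"
  have e: "e \<in> carrier_vec q" by (simp add: e_def)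
  obtain w where w: "w \<in> carrier_vec 3" "F \<bullet> w \<noteq> 0"
    using F_scalar_nonzero by blast
  \<comment> \<open>\<open>Z_cross\<close> expresses a multiple of \<open>\<Phi> *\<^sub>v e\<close>
    by \<open>Z\<close>; moving \<open>Z\<close> to the left factor gives a triple product in which
    \<open>R *\<^sub>v e\<close> occurs twice.\<close>
  have "- (F \<bullet> w) * (e \<bullet> (\<Phi> *\<^sub>v e)) = e \<bullet> (Z *\<^sub>v (cross_mat w *\<^sub>v (R *\<^sub>v e)))"
    using Z_cross[OF _ B_\<Phi>_vec[OF e] w(1)] e w(1) by (simp add: N_\<Phi>_vec)
  also have "\<dots> = (R *\<^sub>v e) \<bullet> (cross_mat w *\<^sub>v (R *\<^sub>v e))"
    using e w(1) by (simp add: R_scalar_prod)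
  also have "\<dots> = 0"
    using e by (intro scalar_prod_cross_self') simp
  finally have "e \<bullet> (\<Phi> *\<^sub>v e) = 0" using w(2) by simp
  then show ?thesis
    unfolding e_def using \<Phi> j by (simp add: scalar_prod_left_unit[of _ q])
qed

lemma mat_vec_hom:
  assumes "M \<in> carrier_mat r s" "v \<in> carrier_vec s" "i < r"
    and "\<And>a b. a < r \<Longrightarrow> b < s \<Longrightarrow> homogeneous_of_degree 0 (M $$ (a, b))"
    and "\<And>b. b < s \<Longrightarrow> homogeneous_of_degree g (v $ b)"
  shows "homogeneous_of_degree g ((M *\<^sub>v v) $ i)"
proof -
  have "(M *\<^sub>v v) $ i = (\<Sum>b\<in>{0..<s}. M $$ (i, b) * v $ b)"
    using assms(1-3) by (simp add: scalar_prod_def)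
  also have "homogeneous_of_degree g \<dots>"
    using assms(3) by (intro homogeneous_sum homogeneous_mult'[OF assms(4,5)]) auto
  finally show ?thesis .
qed

lemma B_hom: 
  assumes "e < p" "j < q"
  shows "homogeneous_of_degree (\<delta> j) (B $$ (e, j))"
proof -
  have "B $$ (e, j) = (P *\<^sub>v col A j) $ e"
    using A P assms by (simp add: B_def)
  also have "homogeneous_of_degree (\<delta> j) \<dots>"
    using A assms by (intro mat_vec_hom[OF P _ _ P_hom]) (auto simp: A_hom)
  finally show ?thesis .
qed

lemma Z_hom: 
  assumes "j < q" "i < 3"
  shows "homogeneous_of_degree (D - \<delta> j) (Z $$ (j, i))"
proof -
  have "homogeneous_of_degree (D - \<delta> j) ((Z *\<^sub>v unit_vec 3 i) $ j)"
  proof (rule A_graded[OF _ _ assms(1)])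
    fix e assume e: "e < m"
    have c: "homogeneous_of_degree D ((cross_mat F *\<^sub>v unit_vec 3 i) $ b)" if "b < 3" for b
      using that F_hom[of 0] F_hom[of 1] F_hom[of 2] assms(2)
      by (auto simp: less_3_iff cross_simps unit_vec_def)
    show "homogeneous_of_degree D ((A *\<^sub>v (Z *\<^sub>v unit_vec 3 i)) $ e)"
      unfolding A_Z_vec[OF unit_vec_carrier] by (rule mat_vec_hom[OF \<Lambda> _ e \<Lambda>_hom c]) auto
  qed simp
  moreover have "(Z *\<^sub>v unit_vec 3 i) $ j = Z $$ (j, i)"
    using Z assms by simp
  ultimately show ?thesis by simp
qed

lemma R_hom: "i < 3 \<Longrightarrow> j < q \<Longrightarrow> homogeneous_of_degree (D - \<delta> j) (R $$ (i, j))"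
  using Z Z_hom by (simp add: R_def)

lemma \<Phi>_hom: 
  assumes "i < q" "j < q"
  shows "homogeneous_of_degree (D - \<delta> i - \<delta> j) (\<Phi> $$ (i, j))"
proof -
  have "homogeneous_of_degree (D - \<delta> j - \<delta> i) ((\<Phi> *\<^sub>v unit_vec q j) $ i)"
  proof (rule A_graded[OF _ _ assms(1)])
    fix e assume e: "e < m"
    have c: "homogeneous_of_degree (D - \<delta> j) ((R *\<^sub>v unit_vec q j) $ b)" if "b < 3" for b
      using that R R_hom[OF that assms(2)] assms(2) by simp
    show "homogeneous_of_degree (D - \<delta> j) ((A *\<^sub>v (\<Phi> *\<^sub>v unit_vec q j)) $ e)"
      unfolding A_\<Phi>_vec[OF unit_vec_carrier] by (rule mat_vec_hom[OF \<Lambda> _ e \<Lambda>_hom c]) auto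
  qed simp
  moreover have "(\<Phi> *\<^sub>v unit_vec q j) $ i = \<Phi> $$ (i, j)"
    using \<Phi> assms by simp
  ultimately show ?thesis by (simp add: algebra_simps)
qed

lemma B_irrelevant: "e < p \<Longrightarrow> j < q \<Longrightarrow> B $$ (e, j) \<in> irrelevant_ideal"
  by (rule homogeneous_irrelevant[OF B_hom \<delta>_pos])

lemma R_irrelevant: "i < 3 \<Longrightarrow> j < q \<Longrightarrow> R $$ (i, j) \<in> irrelevant_ideal"
  by (rule homogeneous_irrelevant[OF R_hom degree_1])

lemma \<Phi>_irrelevant:
  assumes "i < q" "j < q"
  shows "\<Phi> $$ (i, j) \<in> irrelevant_ideal"
proof (cases "i = j")
  case True
  then show ?thesis using \<Phi>_diagonal assms by (simp add: irrelevant_ideal_iff)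
next
  case False
  then show ?thesis using homogeneous_irrelevant[OF \<Phi>_hom degree_2] assms by blast
qed

text \<open>The twists follow from the degrees: column \<open>j\<close> of \<open>R\<close> has
  degree \<open>D - \<delta> j\<close>, and row \<open>j\<close> of \<open>Bt\<close> has degree
  \<open>\<delta> j\<close>, so all last twists agree.\<close>

lemma resolution_jacobian:
  "has_graded_minimal_free_resolution (ideal_module (vec_ideal F))
     [replicate_mset 3 (- D), mset (map (\<lambda>j. - 2 * D + \<delta> j) [0..<q]), replicate_mset p (- 2 * D)]"
proof -
  have "has_graded_minimal_free_resolution (ideal_module (vec_ideal F))
     (map mset [replicate 3 (- D), map (\<lambda>j. - 2 * D + \<delta> j) [0..<q], replicate p (- 2 * D)])"
    (is "has_graded_minimal_free_resolution _ (map mset ?tws)")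
  proof (rule resolution_of_matrices[where r = 1 and D = "\<lambda>i. if i = 0 then R else Bt" and \<epsilon> = "(\<bullet>) F"])
    show "graded_hom (free_graded_module (?tws ! 0)) (ideal_module (vec_ideal F)) ((\<bullet>) F)"
      using graded_hom_vec_ideal(1)[OF F F_hom] by simp
    show "(\<bullet>) F ` carrier_vec (length (?tws ! 0)) = carrier (ideal_module (vec_ideal F))"
      using graded_hom_vec_ideal(2)[OF F F_hom] by simp
    fix i :: nat assume "i \<le> 1"
    then consider "i = 0" | "i = 1" by linarith
    note i = this
    then show "(if i = 0 then R else Bt) \<in> carrier_mat (length (?tws ! i)) (length (?tws ! Suc i))"
      using R Bt by cases auto
    fix a b assume "a < length (?tws ! i)" "b < length (?tws ! Suc i)"
    with i show "homogeneous_of_degree (?tws ! i ! a - ?tws ! Suc i ! b) ((if i = 0 then R else Bt) $$ (a, b))"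
      "(if i = 0 then R else Bt) $$ (a, b) \<in> irrelevant_ideal"
      using B R_hom[of a b] R_irrelevant[of a b] B_hom[of b a] B_irrelevant[of b a]
      by (cases; simp add: algebra_simps)+
  next
    fix v :: "'k poly3 vec"
    show "v \<in> carrier_vec (length (?tws ! 0)) \<Longrightarrow> (F \<bullet> v = \<zero>\<^bsub>ideal_module (vec_ideal F)\<^esub>) \<longleftrightarrow>
       (\<exists>w\<in>carrier_vec (length (?tws ! 1)). v = (if (0::nat) = 0 then R else Bt) *\<^sub>v w)"
      using R_surjective[of v] F_R by auto
  next
    fix i v
    show "i < 1 \<Longrightarrow> v \<in> carrier_vec (length (?tws ! Suc i)) \<Longrightarrow>
       (if i = 0 then R else Bt) *\<^sub>v v = 0\<^sub>v (length (?tws ! i)) \<longleftrightarrow>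
       (\<exists>w\<in>carrier_vec (length (?tws ! Suc (Suc i))). v = (if Suc i = 0 then R else Bt) *\<^sub>v w)"
      using kernel_R[of v] R_Bt by auto
  next
    fix v
    show "v \<in> carrier_vec (length (?tws ! Suc 1)) \<Longrightarrow> (if (1::nat) = 0 then R else Bt) *\<^sub>v v = 0\<^sub>v (length (?tws ! 1)) \<Longrightarrow>
      v = 0\<^sub>v (length (?tws ! Suc 1))"
      using Bt_inj[of v] by simp
  qed simp
  then show ?thesis by simp
qed

lemma vec_ideal_subset: "vec_ideal F \<subseteq> vec_ideal y"
proof
  fix a assume "a \<in> vec_ideal F"
  then obtain \<theta> where "\<theta> \<in> carrier_vec 3" "a = F \<bullet> \<theta>"
    using F by (metis vec_idealE carrier_vecD)
  then have "a = y \<bullet> (\<Lambda> *\<^sub>v \<theta>)" "\<Lambda> *\<^sub>v \<theta> \<in> carrier_vec (dim_vec y)"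
    using y by (simp_all add: \<Lambda>_F)
  then show "a \<in> vec_ideal y" using vec_idealI by metis
qed

lemma graded_hom_quotient:
  "graded_hom (free_graded_module (replicate p (- D))) (quotient_module (vec_ideal y) (vec_ideal F))
     (\<lambda>w. vec_ideal F +>\<^bsub>S_ring\<^esub> (y \<bullet> (T *\<^sub>v w)))"
  unfolding graded_hom_def free_graded_module_simps quotient_module_simps
proof (intro conjI ballI allI)
  have in_y: "y \<bullet> (T *\<^sub>v w) \<in> vec_ideal y" if "w \<in> carrier_vec p" for w
    using that y by (intro vec_idealI) auto
  show "(\<lambda>w. vec_ideal F +>\<^bsub>S_ring\<^esub> (y \<bullet> (T *\<^sub>v w))) \<in> carrier_vec (length (replicate p (- D))) \<rightarrow>
      (\<lambda>x. vec_ideal F +>\<^bsub>S_ring\<^esub> x) ` vec_ideal y"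
    using in_y by auto
  fix u v :: "'k poly3 vec" and c
  assume u: "u \<in> carrier_vec (length (replicate p (- D)))"
  show "vec_ideal F +>\<^bsub>S_ring\<^esub> (y \<bullet> (T *\<^sub>v (c \<cdot>\<^sub>v u))) =
     (\<Union>x\<in>vec_ideal F +>\<^bsub>S_ring\<^esub> (y \<bullet> (T *\<^sub>v u)). vec_ideal F +>\<^bsub>S_ring\<^esub> (c * x))"
    unfolding coset_smult[OF ideal_vec_ideal] using u T by (simp add: mult_mat_smult_vec[OF T])
  assume v: "v \<in> carrier_vec (length (replicate p (- D)))"
  show "vec_ideal F +>\<^bsub>S_ring\<^esub> (y \<bullet> (T *\<^sub>v (u + v))) =
     (vec_ideal F +>\<^bsub>S_ring\<^esub> (y \<bullet> (T *\<^sub>v u))) <+>\<^bsub>S_ring\<^esub> (vec_ideal F +>\<^bsub>S_ring\<^esub> (y \<bullet> (T *\<^sub>v v)))"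
    unfolding coset_add[OF ideal_vec_ideal] using u v
    by (simp add: mult_add_distrib_mat_vec[OF T] scalar_prod_add_distrib[of y m])
next
  fix g
  have "y \<bullet> (T *\<^sub>v w) \<in> {x \<in> vec_ideal y. homogeneous_of_degree g x}"
    if w: "w \<in> carrier_vec p" "\<forall>j<p. homogeneous_of_degree (g - D) (w $ j)" for w
  proof -
    have "dim_vec (T *\<^sub>v w) = m" using T by simp
    then have "homogeneous_of_degree g (y \<bullet> (T *\<^sub>v w))"
      by (rule homogeneous_scalar_prod[OF _ y_hom]) (use w in \<open>auto intro: mat_vec_hom[OF T _ _ T_hom]\<close>)
    moreover have "y \<bullet> (T *\<^sub>v w) \<in> vec_ideal y"
      using w(1) by (intro vec_idealI) simp
    ultimately show ?thesis by simp
  qed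
  then show "(\<lambda>w. vec_ideal F +>\<^bsub>S_ring\<^esub> (y \<bullet> (T *\<^sub>v w))) `
      {v \<in> carrier_vec (length (replicate p (- D))).
        \<forall>j<length (replicate p (- D)). homogeneous_of_degree (replicate p (- D) ! j + g) (v $ j)}
      \<subseteq> (\<lambda>x. vec_ideal F +>\<^bsub>S_ring\<^esub> x) ` {x \<in> vec_ideal y. homogeneous_of_degree g x}"
    by auto
qed

lemma quotient_surjective:
  "(\<lambda>w. vec_ideal F +>\<^bsub>S_ring\<^esub> (y \<bullet> (T *\<^sub>v w))) ` carrier_vec p =
     carrier (quotient_module (vec_ideal y) (vec_ideal F))"
proof -
  have "\<exists>w\<in>carrier_vec p. vec_ideal F +>\<^bsub>S_ring\<^esub> (y \<bullet> u) = vec_ideal F +>\<^bsub>S_ring\<^esub> (y \<bullet> (T *\<^sub>v w))"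
    if "u \<in> carrier_vec m" for u
    using y_split[OF that] that unfolding coset_eq_iff[OF ideal_vec_ideal]
    by (intro bexI[of _ "P *\<^sub>v u"]) auto
  then show ?thesis
    by (fastforce elim!: vec_idealE intro: vec_idealI simp: image_iff)
qed

lemma resolution_quotient:
  "has_graded_minimal_free_resolution (quotient_module (vec_ideal y) (vec_ideal F))
     [replicate_mset p (- D), mset (map (\<lambda>j. - D - \<delta> j) [0..<q]),
      mset (map (\<lambda>j. - 2 * D + \<delta> j) [0..<q]), replicate_mset p (- 2 * D)]"
proof -
  let ?\<epsilon> = "\<lambda>w. vec_ideal F +>\<^bsub>S_ring\<^esub> (y \<bullet> (T *\<^sub>v w))"
  let ?X = "\<lambda>i :: nat. if i = 0 then B else if i = 1 then \<Phi> else Bt"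
  have "has_graded_minimal_free_resolution (quotient_module (vec_ideal y) (vec_ideal F))
     (map mset [replicate p (- D), map (\<lambda>j. - D - \<delta> j) [0..<q],
      map (\<lambda>j. - 2 * D + \<delta> j) [0..<q], replicate p (- 2 * D)])"
    (is "has_graded_minimal_free_resolution ?N (map mset ?tws)")
  proof (rule resolution_of_matrices[where r = 2 and D = ?X and \<epsilon> = ?\<epsilon>])
    show "graded_hom (free_graded_module (?tws ! 0)) ?N ?\<epsilon>"
      using graded_hom_quotient by simp
    show "?\<epsilon> ` carrier_vec (length (?tws ! 0)) = carrier ?N"
      using quotient_surjective by simp
    fix i :: nat assume "i \<le> 2"
    then consider "i = 0" | "i = 1" | "i = 2" by linarith
    note i = this
    then show "?X i \<in> carrier_mat (length (?tws ! i)) (length (?tws ! Suc i))"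
      using B \<Phi> Bt by cases auto
    fix a b assume "a < length (?tws ! i)" "b < length (?tws ! Suc i)"
    with i show "homogeneous_of_degree (?tws ! i ! a - ?tws ! Suc i ! b) (?X i $$ (a, b))"
      "?X i $$ (a, b) \<in> irrelevant_ideal"
      using B \<Phi>_hom[of a b] \<Phi>_irrelevant[of a b] B_hom[of b a] B_irrelevant[of b a] B_hom[of a b] B_irrelevant[of a b]
      by (cases; simp add: algebra_simps)+
  next
    fix v :: "'k poly3 vec"
    show "v \<in> carrier_vec (length (?tws ! 0)) \<Longrightarrow> (?\<epsilon> v = \<zero>\<^bsub>?N\<^esub>) \<longleftrightarrow>
       (\<exists>w\<in>carrier_vec (length (?tws ! 1)). v = ?X 0 *\<^sub>v w)"
      using T_in_jacobian[of v] coset_eq_iff[OF ideal_vec_ideal, of F "y \<bullet> (T *\<^sub>v v)" 0]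
      by (simp add: coset_0)
  next
    fix i :: nat and v :: "'k poly3 vec" assume "i < 2" "v \<in> carrier_vec (length (?tws ! Suc i))"
    then consider "i = 0" "v \<in> carrier_vec q" | "i = 1" "v \<in> carrier_vec q"
      by (cases "i = 0") auto
    then show "?X i *\<^sub>v v = 0\<^sub>v (length (?tws ! i)) \<longleftrightarrow>
       (\<exists>w\<in>carrier_vec (length (?tws ! Suc (Suc i))). v = ?X (Suc i) *\<^sub>v w)"
      using exact_B_\<Phi>[of v] \<Phi>_zero_iff[of v] kernel_R[of v] R_Bt by cases auto
  next
    fix v
    show "v \<in> carrier_vec (length (?tws ! Suc 2)) \<Longrightarrow> ?X 2 *\<^sub>v v = 0\<^sub>v (length (?tws ! 2)) \<Longrightarrow>
      v = 0\<^sub>v (length (?tws ! Suc 2))"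
      using Bt_inj[of v] by simp
  qed simp
  then show ?thesis by simp
qed

lemma saturation_jacobian: "saturation (vec_ideal F) = vec_ideal y"
proof
  have "saturation (vec_ideal F) \<subseteq> saturation (vec_ideal y)"
    using vec_ideal_subset unfolding saturation_def by blast
  then show "saturation (vec_ideal F) \<subseteq> vec_ideal y"
    by (simp add: saturated_vec_ideal)
  show "vec_ideal y \<subseteq> saturation (vec_ideal F)"
  proof
    fix a assume "a \<in> vec_ideal y"
    then obtain v where v: "v \<in> carrier_vec m" "a = y \<bullet> v"
      using y by (metis vec_idealE carrier_vecD)
    have "variable i ^ k * a \<in> vec_ideal F" for i
      using torsion[OF v(1), of i] F unfolding v(2) by (auto intro!: vec_idealI)
    then show "a \<in> saturation (vec_ideal F)"
      unfolding saturation_iff[OF ideal_vec_ideal] by blast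
  qed
qed

text \<open>Nakayama's argument: otherwise a unit vector would lie in the image of \<open>B\<close>,
  whose entries are in the maximal ideal.\<close>

lemma vec_ideal_neq:
  assumes "0 < p"
  shows "vec_ideal F \<noteq> vec_ideal y"
proof
  assume "vec_ideal F = vec_ideal y"
  then have "y \<bullet> (T *\<^sub>v unit_vec p 0) \<in> vec_ideal F"
    using y vec_idealI[of "T *\<^sub>v unit_vec p 0" y] by simp
  then obtain v where v: "v \<in> carrier_vec q" "unit_vec p 0 = B *\<^sub>v v"
    using T_in_jacobian[of "unit_vec p 0"] by auto
  have "1 = (B *\<^sub>v v) $ 0"
    unfolding v(2)[symmetric] using assms by simp
  also have "\<dots> = (\<Sum>j\<in>{0..<q}. v $ j * B $$ (0, j))"
    using B v(1) assms by (simp add: scalar_prod_def mult.commute)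
  also have "\<dots> \<in> irrelevant_ideal"
    using assms unfolding irrelevant_ideal_def
    by (intro S_ring_ideal_sum S_ring_ideal_mult ideal_genideal_range B_irrelevant[unfolded irrelevant_ideal_def]) auto
  finally show False
    by (simp add: irrelevant_ideal_iff)
qed

end

section \<open>Linear algebra in three-dimensional space\<close>

definition det3 :: "(3 \<Rightarrow> 'k::comm_ring) \<Rightarrow> (3 \<Rightarrow> 'k) \<Rightarrow> (3 \<Rightarrow> 'k) \<Rightarrow> 'k" where
  "det3 a b c = a 0 * (b 1 * c 2 - b 2 * c 1) - a 1 * (b 0 * c 2 - b 2 * c 0) + a 2 * (b 0 * c 1 - b 1 * c 0)"

definition dot3 :: "(3 \<Rightarrow> 'k::comm_ring) \<Rightarrow> (3 \<Rightarrow> 'k) \<Rightarrow> 'k" where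
  "dot3 a b = (\<Sum>i\<in>UNIV. a i * b i)"

definition cross3 :: "(3 \<Rightarrow> 'k::comm_ring) \<Rightarrow> (3 \<Rightarrow> 'k) \<Rightarrow> 3 \<Rightarrow> 'k" where
  "cross3 a b i = (if i = 0 then a 1 * b 2 - a 2 * b 1 else if i = 1 then a 2 * b 0 - a 0 * b 2
     else a 0 * b 1 - a 1 * b 0)"

lemma dot3_eq: "dot3 a b = a 0 * b 0 + a 1 * b 1 + a 2 * b 2"
  by (simp add: dot3_def sum_UNIV_3)

lemma fun_eq_3_iff: "a = b \<longleftrightarrow> a (0::3) = b 0 \<and> a 1 = b 1 \<and> a 2 = b 2"
  unfolding fun_eq_iff forall_3 ..

lemma cross3_index [simp]: "cross3 a b 0 = a 1 * b 2 - a 2 * b 1"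
  "cross3 a b 1 = a 2 * b 0 - a 0 * b 2" "cross3 a b 2 = a 0 * b 1 - a 1 * b 0"
  by (simp_all add: cross3_def)

lemma dot3_cross3: "dot3 a (cross3 b c) = det3 a b c"
  by (simp add: dot3_eq det3_def algebra_simps)

lemma dot3_scale_right: "dot3 a (\<lambda>i. r * b i) = r * dot3 a b"
  by (simp add: dot3_eq algebra_simps)

lemma dot3_commute: "dot3 a b = dot3 b a"
  by (simp add: dot3_eq algebra_simps)

lemma cramer3:
  assumes "det3 a b c \<noteq> (0 :: 'k::field)"
  shows "\<exists>r s t. v = (\<lambda>i. r * a i + s * b i + t * c i)"
proof -
  have "det3 a b c * v i = det3 v b c * a i + det3 a v c * b i + det3 a b v * c i" for i
  proof -
    have "\<forall>i. det3 a b c * v i = det3 v b c * a i + det3 a v c * b i + det3 a b v * c i"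
      unfolding forall_3 det3_def by (simp add: algebra_simps)
    then show ?thesis by blast
  qed
  then have "v = (\<lambda>i. det3 v b c / det3 a b c * a i + det3 a v c / det3 a b c * b i + det3 a b v / det3 a b c * c i)"
    using assms by (auto simp: field_simps)
  then show ?thesis by blast
qed

lemma cross3_eq_0:
  assumes "cross3 a b = (\<lambda>_. 0)" "a \<noteq> (\<lambda>_. 0 :: 'k::field)"
  shows "\<exists>x. b = (\<lambda>i. x * a i)"
proof -
  have eqs: "a 1 * b 2 = a 2 * b 1" "a 2 * b 0 = a 0 * b 2" "a 0 * b 1 = a 1 * b 0"
    using assms(1) unfolding fun_eq_3_iff by simp_all
  from assms(2) consider "a 0 \<noteq> 0" | "a 1 \<noteq> 0" | "a 2 \<noteq> 0"
    unfolding fun_eq_3_iff by auto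
  then show ?thesis
  proof cases
    case 1
    then have "b = (\<lambda>i. b 0 / a 0 * a i)"
      using eqs unfolding fun_eq_3_iff by (simp add: field_simps)
    then show ?thesis by blast
  next
    case 2
    then have "b = (\<lambda>i. b 1 / a 1 * a i)"
      using eqs unfolding fun_eq_3_iff by (simp add: field_simps)
    then show ?thesis by blast
  next
    case 3
    then have "b = (\<lambda>i. b 2 / a 2 * a i)"
      using eqs unfolding fun_eq_3_iff by (simp add: field_simps)
    then show ?thesis by blast
  qed
qed

lemma dual_vector1:
  assumes "a \<noteq> (\<lambda>_. 0 :: 'k::field)"
  shows "\<exists>v. dot3 a v = 1"
proof -
  obtain j where j: "a j \<noteq> 0" using assms by auto
  have "dot3 a (\<lambda>i. if i = j then 1 / a j else 0) = 1"
    using j by (simp add: dot3_def if_distrib sum.delta cong: if_cong)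
  then show ?thesis by blast
qed

lemma dual_vector3:
  assumes "det3 a b c \<noteq> (0 :: 'k::field)"
  shows "\<exists>v. dot3 a v = 1 \<and> dot3 b v = 0 \<and> dot3 c v = 0"
proof -
  have "dot3 a (cross3 b c) = det3 a b c" "dot3 b (cross3 b c) = 0" "dot3 c (cross3 b c) = 0"
    by (simp_all add: dot3_eq det3_def algebra_simps)
  then have "dot3 a (\<lambda>i. 1 / det3 a b c * cross3 b c i) = 1 \<and> dot3 b (\<lambda>i. 1 / det3 a b c * cross3 b c i) = 0
      \<and> dot3 c (\<lambda>i. 1 / det3 a b c * cross3 b c i) = 0"
    using assms unfolding dot3_scale_right by simp
  then show ?thesis by blast
qed

lemma dual_vector2:
  assumes "\<And>x. b \<noteq> (\<lambda>i. x * a i)" "a \<noteq> (\<lambda>_. 0 :: 'k::field)"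
  shows "\<exists>v. dot3 a v = 1 \<and> dot3 b v = 0"
proof -
  have "cross3 a b \<noteq> (\<lambda>_. 0)"
    using cross3_eq_0 assms by blast
  then obtain u where "dot3 (cross3 a b) u = 1"
    using dual_vector1 by blast
  then have "det3 a b u \<noteq> 0"
    by (simp add: dot3_eq det3_def algebra_simps)
  then show ?thesis using dual_vector3 by blast
qed

lemma lin_combination: "lin (\<lambda>i. r * a i + s * b i) = Const r * lin a + Const s * lin b"
  unfolding lin_add lin_scale ..

section \<open>Ideals enlarged by one generator\<close>

definition plus_multiples :: "'k::field poly3 set \<Rightarrow> 'k poly3 \<Rightarrow> 'k poly3 set" where
  "plus_multiples I p = {a + p * b | a b. a \<in> I}"

lemma ideal_plus_multiples:
  assumes "ideal I (S_ring :: 'k::field poly3 ring)"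
  shows "ideal (plus_multiples I p) S_ring"
proof (rule S_ring_idealI)
  show "0 \<in> plus_multiples I p"
    using S_ring_ideal_0[OF assms] by (auto simp: plus_multiples_def intro!: exI[of _ 0])
  show "a + b \<in> plus_multiples I p" if ab: "a \<in> plus_multiples I p" "b \<in> plus_multiples I p" for a b
  proof -
    obtain a1 a2 b1 b2 where "a = a1 + p * a2" "b = b1 + p * b2" "a1 \<in> I" "b1 \<in> I"
      using ab unfolding plus_multiples_def by blast
    then have "a + b = (a1 + b1) + p * (a2 + b2)" "a1 + b1 \<in> I"
      using S_ring_ideal_add[OF assms] by (simp_all add: algebra_simps)
    then show ?thesis unfolding plus_multiples_def by blast
  qed
  show "b * a \<in> plus_multiples I p" if a: "a \<in> plus_multiples I p" for a b
  proof -
    obtain a1 a2 where "a = a1 + p * a2" "a1 \<in> I"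
      using a unfolding plus_multiples_def by blast
    then have "b * a = b * a1 + p * (b * a2)" "b * a1 \<in> I"
      using S_ring_ideal_mult[OF assms] by (simp_all add: algebra_simps)
    then show ?thesis unfolding plus_multiples_def by blast
  qed
qed

lemma plus_multiples_superset: "a \<in> I \<Longrightarrow> a \<in> plus_multiples I p"
proof -
  have "a = a + p * 0" by simp
  then show "a \<in> I \<Longrightarrow> a \<in> plus_multiples I p"
    unfolding plus_multiples_def by blast
qed

lemma plus_multiples_generator: "ideal I S_ring \<Longrightarrow> p * b \<in> plus_multiples I p"
  unfolding plus_multiples_def using S_ring_ideal_0[of I] by force

lemma plus_multiples_eq:
  assumes "ideal I S_ring" "p \<in> I"
  shows "plus_multiples I p = I"
proof -
  have "a + p * b \<in> I" if "a \<in> I" for a b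
    using S_ring_ideal_add[OF assms(1) that S_ring_ideal_mult[OF assms, of b]] by (simp add: mult.commute)
  then show ?thesis
    using plus_multiples_superset by (auto simp: plus_multiples_def)
qed

text \<open>Multiplying the representations of the powers leaves an element of \<open>I\<close> plus
  a multiple of the product. In terms of zeros, a union of hypersurfaces can be treated one
  component at a time.\<close>

lemma power_in_plus_multiples_prod:
  fixes u :: "'k::field poly3"
  assumes I: "ideal I S_ring" and "finite V" "\<And>x. x \<in> V \<Longrightarrow> \<exists>n. u ^ n \<in> plus_multiples I (p x)"
  shows "\<exists>n. u ^ n \<in> plus_multiples I (\<Prod>x\<in>V. p x)"
  using assms(2,3)
proof (induction V)
  case empty
  have "u ^ 0 = 0 + 1 * 1" by simp
  then show ?case using S_ring_ideal_0[OF I] unfolding plus_multiples_def by (metis (mono_tags, lifting) mem_Collect_eq prod.empty)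
next
  case (insert x V)
  obtain n where "u ^ n \<in> plus_multiples I (p x)" using insert.prems by blast
  then obtain a b where ab: "u ^ n = a + p x * b" "a \<in> I" unfolding plus_multiples_def by blast
  obtain k where "u ^ k \<in> plus_multiples I (\<Prod>x\<in>V. p x)" using insert by blast
  then obtain a' b' where ab': "u ^ k = a' + (\<Prod>x\<in>V. p x) * b'" "a' \<in> I" unfolding plus_multiples_def by blast
  have "u ^ (n + k) = (u ^ k * a + (p x * b) * a') + (\<Prod>x\<in>insert x V. p x) * (b * b')"
    unfolding power_add using insert.hyps by (simp add: ab(1) ab'(1) algebra_simps)
  moreover have "u ^ k * a + (p x * b) * a' \<in> I"
    using I ab ab' by (intro S_ring_ideal_add S_ring_ideal_mult)
  ultimately show ?case unfolding plus_multiples_def by blast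
qed

lemma power_in_ideal_mono:
  "ideal I S_ring \<Longrightarrow> u ^ n * a \<in> I \<Longrightarrow> n \<le> n' \<Longrightarrow> u ^ n' * (a :: 'k::field poly3) \<in> I"
  using S_ring_ideal_mult[of I "u ^ n * a" "u ^ (n' - n)"] by (simp add: mult.assoc[symmetric] power_add[symmetric])

section \<open>Grouped arrangements\<close>

text \<open>The lines are partitioned into the pencils \<open>\<D>\<close> through the multiple points and into singletons. In
  every group, \<open>c (e1 G)\<close> and \<open>c (e2 G)\<close> span the coefficient vectors, with coordinates \<open>r\<close> and \<open>s\<close>; for
  singletons \<open>e2\<close> is irrelevant.\<close>

locale grouped_arrangement =
  fixes Ar :: "'l set" and c :: "'l \<Rightarrow> 3 \<Rightarrow> 'k::field_char_0" and \<P> \<D> :: "'l set set"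
    and e1 e2 :: "'l set \<Rightarrow> 'l" and r s :: "'l \<Rightarrow> 'k" and G\<^sub>0 :: "'l set"
  assumes finite_Ar: "finite Ar"
    and c_nonzero: "\<And>L. L \<in> Ar \<Longrightarrow> c L \<noteq> (\<lambda>_. 0)"
    and not_proportional: "\<And>L L' x. L \<in> Ar \<Longrightarrow> L' \<in> Ar \<Longrightarrow> L \<noteq> L' \<Longrightarrow> c L' \<noteq> (\<lambda>i. x * c L i)"
    and Union_\<P>: "\<Union>\<P> = Ar"
    and disjoint: "\<And>G H. G \<in> \<P> \<Longrightarrow> H \<in> \<P> \<Longrightarrow> G \<noteq> H \<Longrightarrow> G \<inter> H = {}"
    and \<D>_subset: "\<D> \<subseteq> \<P>"
    and e1: "\<And>G. G \<in> \<P> \<Longrightarrow> e1 G \<in> G"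
    and e2: "\<And>G. G \<in> \<D> \<Longrightarrow> e2 G \<in> G" "\<And>G. G \<in> \<D> \<Longrightarrow> e1 G \<noteq> e2 G"
    and singleton: "\<And>G. G \<in> \<P> \<Longrightarrow> G \<notin> \<D> \<Longrightarrow> G = {e1 G}"
    and coords: "\<And>G L. G \<in> \<P> \<Longrightarrow> L \<in> G \<Longrightarrow> c L = (\<lambda>i. r L * c (e1 G) i + s L * c (e2 G) i)"
    and coords_singleton: "\<And>G L. G \<in> \<P> \<Longrightarrow> G \<notin> \<D> \<Longrightarrow> L \<in> G \<Longrightarrow> s L = 0"
    and coords_e1: "\<And>G. G \<in> \<P> \<Longrightarrow> r (e1 G) = 1" "\<And>G. G \<in> \<P> \<Longrightarrow> s (e1 G) = 0"
    and coords_e2: "\<And>G. G \<in> \<D> \<Longrightarrow> r (e2 G) = 0" "\<And>G. G \<in> \<D> \<Longrightarrow> s (e2 G) = 1"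
    and generic: "\<And>G L L' L''. G \<in> \<P> \<Longrightarrow> L \<in> G \<Longrightarrow> L' \<in> Ar - G \<Longrightarrow> L'' \<in> Ar - {L, L'} \<Longrightarrow>
       det3 (c L) (c L') (c L'') \<noteq> 0"
    and G0: "G\<^sub>0 \<in> \<P>"
begin

abbreviation l :: "'l \<Rightarrow> 'k poly3" where "l L \<equiv> lin (c L)"

definition lprod :: "'l set \<Rightarrow> 'k poly3" where "lprod V = (\<Prod>L\<in>V. l L)"

abbreviation f :: "'k poly3" where "f \<equiv> lprod Ar"

abbreviation h :: "'l set \<Rightarrow> 'k poly3" where "h G \<equiv> lprod (Ar - G)"

text \<open>The partial derivatives of \<open>lprod G\<close> as a form in \<open>l (e1 G)\<close>
  and \<open>l (e2 G)\<close>: \<open>False\<close> stands for the first of the two and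
  \<open>True\<close> for the second.\<close>

definition \<gamma> :: "'l set \<Rightarrow> bool \<Rightarrow> 'k poly3" where
  "\<gamma> G b = (\<Sum>L\<in>G. Const (if b then s L else r L) * lprod (G - {L}))"

abbreviation ce :: "'l set \<Rightarrow> bool \<Rightarrow> 3 \<Rightarrow> 'k" where
  "ce G b \<equiv> c (if b then e2 G else e1 G)"

lemma group_subset: "G \<in> \<P> \<Longrightarrow> G \<subseteq> Ar"
  using Union_\<P> by blast

lemma finite_group: "G \<in> \<P> \<Longrightarrow> finite G"
  using group_subset finite_Ar finite_subset by blast

lemma finite_\<P>: "finite \<P>" "finite \<D>"
proof -
  show "finite \<P>" using finite_Ar Union_\<P> by (metis finite_UnionD)
  then show "finite \<D>" using \<D>_subset finite_subset by blast
qed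

lemma card_group_pos: "G \<in> \<P> \<Longrightarrow> 0 < card G"
  using e1 finite_group card_gt_0_iff by blast

lemma lprod_Un: "V \<inter> Y = {} \<Longrightarrow> V \<subseteq> Ar \<Longrightarrow> Y \<subseteq> Ar \<Longrightarrow> lprod (V \<union> Y) = lprod V * lprod Y"
  unfolding lprod_def using finite_Ar by (metis prod.union_disjoint finite_subset)

lemma lprod_insert: "L \<notin> V \<Longrightarrow> V \<subseteq> Ar \<Longrightarrow> lprod (insert L V) = l L * lprod V"
  unfolding lprod_def using finite_Ar finite_subset by (metis prod.insert)

lemma lprod_remove: "L \<in> V \<Longrightarrow> V \<subseteq> Ar \<Longrightarrow> lprod V = l L * lprod (V - {L})"
  using lprod_insert[of L "V - {L}"] by (simp add: insert_absorb subset_iff)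

lemma lprod_dvd_mono: "V \<subseteq> Y \<Longrightarrow> Y \<subseteq> Ar \<Longrightarrow> lprod V dvd lprod Y"
  using lprod_Un[of V "Y - V"] by (metis Diff_disjoint Diff_partition Diff_subset dvd_triv_left order_trans)

lemma lprod_group: "G \<in> \<P> \<Longrightarrow> f = lprod G * h G"
  using lprod_Un[of G "Ar - G"] group_subset by (metis Diff_disjoint Diff_partition Diff_subset)

lemma lprod_group_remove:
  assumes "G \<in> \<P>" "L \<in> G"
  shows "lprod (Ar - {L}) = h G * lprod (G - {L})"
proof -
  have "Ar - {L} = (Ar - G) \<union> (G - {L})" using assms group_subset by blast
  then show ?thesis
    using lprod_Un[of "Ar - G" "G - {L}"] assms group_subset by (metis Diff_disjoint Diff_subset Int_Diff Int_commute order_trans inf_bot_left)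
qed

lemma not_dvd_lprod:
  assumes "V \<subseteq> Ar" "L \<in> Ar" "L \<notin> V"
  shows "\<not> l L dvd lprod V"
proof
  assume "l L dvd lprod V"
  then obtain L' where L': "L' \<in> V" "l L dvd l L'"
    unfolding lprod_def using lin_dvd_prod[OF c_nonzero[OF assms(2)]] finite_subset[OF assms(1) finite_Ar] by blast
  then obtain x where "c L' = (\<lambda>i. x * c L i)"
    using lin_dvd_lin by blast
  moreover have "L' \<in> Ar" "L \<noteq> L'"
    using L' assms by auto
  ultimately show False
    using not_proportional[OF assms(2)] by blast
qed

lemma lprod_dvd:
  assumes "V \<subseteq> Ar" "\<And>L. L \<in> V \<Longrightarrow> l L dvd p"
  shows "lprod V dvd p"
  using finite_subset[OF assms(1) finite_Ar] assms
proof (induction V)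
  case empty
  then show ?case by (simp add: lprod_def)
next
  case (insert L V)
  then obtain q where q: "p = lprod V * q" by (auto elim!: dvdE)
  have "l L dvd lprod V * q" using insert.prems(2)[of L] q by simp
  moreover have "\<not> l L dvd lprod V"
    using insert by (intro not_dvd_lprod) auto
  ultimately have "l L dvd q"
    using lin_dvd_mult[OF c_nonzero[of L]] insert.prems by blast
  then show ?case
    using insert q lprod_insert[of L V] by (simp add: mult.commute mult_dvd_mono)
qed

lemma lprod_nonzero: "V \<subseteq> Ar \<Longrightarrow> lprod V \<noteq> 0"
  unfolding lprod_def using finite_subset[OF _ finite_Ar] c_nonzero by (auto simp: lin_eq_0_iff)

lemma homogeneous_lprod: "V \<subseteq> Ar \<Longrightarrow> homogeneous_of_degree (int (card V)) (lprod V)"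
  unfolding lprod_def using finite_subset[OF _ finite_Ar] homogeneous_lin by (intro homogeneous_prod) auto

lemma partial_deriv_f: "partial_deriv i f = (\<Sum>L\<in>Ar. Const (c L i) * lprod (Ar - {L}))"
  unfolding lprod_def by (simp add: partial_deriv_prod[OF finite_Ar] partial_deriv_lin)

lemma sum_groups: "(\<Sum>L\<in>Ar. \<phi> L) = (\<Sum>G\<in>\<P>. \<Sum>L\<in>G. \<phi> L)"
  unfolding Union_\<P>[symmetric] using finite_group disjoint by (subst sum.Union_disjoint) auto

definition Y :: "'l set \<times> bool \<Rightarrow> 'k poly3" where "Y e = h (fst e) * \<gamma> (fst e) (snd e)"

text \<open>A pencil contributes both derivatives, a singleton only the first one, as its second
  derivative is 0.\<close>

definition E :: "('l set \<times> bool) set" where "E = \<P> \<times> {False} \<union> \<D> \<times> {True}"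

lemma finite_E: "finite E"
  using finite_\<P> by (simp add: E_def)

lemma card_E: "card E = card \<P> + card \<D>"
  unfolding E_def using finite_\<P> by (subst card_Un_disjoint) (auto simp: card_cartesian_product)

lemma sum_E: "(\<Sum>e\<in>E. \<phi> e) = (\<Sum>G\<in>\<P>. \<phi> (G, False)) + (\<Sum>G\<in>\<D>. \<phi> (G, True))"
proof -
  have "(\<Sum>e\<in>E. \<phi> e) = (\<Sum>e\<in>\<P> \<times> {False}. \<phi> e) + (\<Sum>e\<in>\<D> \<times> {True}. \<phi> e)"
    unfolding E_def using finite_\<P> by (intro sum.union_disjoint) auto
  moreover have "\<P> \<times> {False} = (\<lambda>G. (G, False)) ` \<P>" "\<D> \<times> {True} = (\<lambda>G. (G, True)) ` \<D>"
    by auto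
  ultimately show ?thesis
    by (simp add: sum.reindex inj_on_def)
qed

lemma sum_E_groups:
  "(\<Sum>e\<in>E. \<phi> e) = (\<Sum>G\<in>\<P>. \<phi> (G, False) + (if G \<in> \<D> then \<phi> (G, True) else 0))"
proof -
  have "(\<Sum>G\<in>\<D>. \<phi> (G, True)) = (\<Sum>G\<in>\<P>. if G \<in> \<D> then \<phi> (G, True) else 0)"
    using finite_\<P> \<D>_subset by (simp add: sum.If_cases Int_absorb1)
  then show ?thesis by (simp add: sum_E sum.distrib)
qed

lemma \<gamma>_singleton: "G \<in> \<P> \<Longrightarrow> G \<notin> \<D> \<Longrightarrow> \<gamma> G True = 0"
  by (simp add: \<gamma>_def coords_singleton)

lemma \<gamma>_singleton': "G \<in> \<P> \<Longrightarrow> G \<notin> \<D> \<Longrightarrow> \<gamma> G False = 1"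
proof -
  assume G: "G \<in> \<P>" "G \<notin> \<D>"
  have "\<gamma> G False = (\<Sum>L\<in>{e1 G}. Const (r L) * lprod (G - {L}))"
    unfolding \<gamma>_def using singleton[OF G] by simp
  also have "\<dots> = lprod (G - {e1 G})"
    using coords_e1[OF G(1)] by simp
  also have "G - {e1 G} = {}" using singleton[OF G] by blast
  finally show ?thesis by (simp add: lprod_def)
qed

lemma group_sum: 
  assumes G: "G \<in> \<P>"
  shows "(\<Sum>L\<in>G. Const (r L * x + s L * z) * lprod (G - {L})) = Const x * \<gamma> G False + Const z * \<gamma> G True"
proof -
  have "Const (r L * x + s L * z) * lprod (G - {L}) =
     Const x * (Const (r L) * lprod (G - {L})) + Const z * (Const (s L) * lprod (G - {L}))" for L
    unfolding Const_add Const_mult by (simp only: distrib_right distrib_left mult_ac)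
  then show ?thesis
    by (simp add: \<gamma>_def sum.distrib sum_distrib_left)
qed

text \<open>The chain rule within each group. The coefficients are constants, so whether the partial
  derivatives recover the generators is a question of linear algebra over the field.\<close>

lemma partial_deriv_f_E: "partial_deriv i f = (\<Sum>e\<in>E. Const (ce (fst e) (snd e) i) * Y e)"
proof -
  have "(\<Sum>L\<in>G. Const (c L i) * lprod (Ar - {L})) =
     Const (c (e1 G) i) * Y (G, False) + (if G \<in> \<D> then Const (c (e2 G) i) * Y (G, True) else 0)"
    if G: "G \<in> \<P>" for G
  proof -
    have "(\<Sum>L\<in>G. Const (c L i) * lprod (Ar - {L})) =
       (\<Sum>L\<in>G. h G * (Const (r L * c (e1 G) i + s L * c (e2 G) i) * lprod (G - {L})))"
    proof (rule sum.cong[OF refl])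
      fix L assume L: "L \<in> G"
      have "c L i = r L * c (e1 G) i + s L * c (e2 G) i"
        using coords[OF G L] by (rule fun_cong)
      then show "Const (c L i) * lprod (Ar - {L}) =
          h G * (Const (r L * c (e1 G) i + s L * c (e2 G) i) * lprod (G - {L}))"
        by (simp only: lprod_group_remove[OF G L] mult_ac)
    qed
    also have "\<dots> = h G * (Const (c (e1 G) i) * \<gamma> G False + Const (c (e2 G) i) * \<gamma> G True)"
      unfolding sum_distrib_left[symmetric] group_sum[OF G] ..
    finally show ?thesis
      using \<gamma>_singleton[OF G] by (simp add: Y_def algebra_simps)
  qed
  then show ?thesis
    unfolding partial_deriv_f sum_groups sum_E_groups by (intro sum.cong) auto
qed

lemma group_euler:
  assumes G: "G \<in> \<P>"
  shows "l (e1 G) * \<gamma> G False + l (e2 G) * \<gamma> G True = of_nat (card G) * lprod G"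
proof -
  have "l (e1 G) * \<gamma> G False + l (e2 G) * \<gamma> G True = (\<Sum>L\<in>G. l L * lprod (G - {L}))"
  proof -
    have "l L * lprod (G - {L}) = l (e1 G) * (Const (r L) * lprod (G - {L})) + l (e2 G) * (Const (s L) * lprod (G - {L}))"
      if "L \<in> G" for L
    proof -
      have "l L = Const (r L) * l (e1 G) + Const (s L) * l (e2 G)"
        by (subst coords[OF G that]) (rule lin_combination)
      then show ?thesis by (simp add: algebra_simps)
    qed
    then show ?thesis
      by (simp add: \<gamma>_def sum.distrib sum_distrib_left)
  qed
  also have "\<dots> = (\<Sum>L\<in>G. lprod G)"
    using lprod_remove group_subset[OF G] by (intro sum.cong) auto
  finally show ?thesis by simp
qed

text \<open>Modulo \<open>l L\<close> only the summand that omits this factor survives.\<close>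

lemma \<gamma>_dvd_diff:
  assumes G: "G \<in> \<P>" and L: "L \<in> G"
  shows "l L dvd \<gamma> G b - Const (if b then s L else r L) * lprod (G - {L})"
proof -
  have "\<gamma> G b - Const (if b then s L else r L) * lprod (G - {L}) =
     (\<Sum>L'\<in>G - {L}. Const (if b then s L' else r L') * lprod (G - {L'}))"
    unfolding \<gamma>_def using finite_group[OF G] L by (subst sum.remove[of G L]) auto
  also have "l L dvd \<dots>"
  proof (rule dvd_sum)
    fix L' assume "L' \<in> G - {L}"
    then have "lprod (G - {L'}) = l L * lprod (G - {L'} - {L})"
      using L group_subset[OF G] by (intro lprod_remove) auto
    then show "l L dvd Const (if b then s L' else r L') * lprod (G - {L'})" by simp
  qed
  finally show ?thesis .
qed

lemma \<gamma>_dvd_iff: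
  assumes G: "G \<in> \<P>" and L: "L \<in> G"
  shows "l L dvd \<gamma> G b \<longleftrightarrow> (if b then s L else r L) = 0"
proof
  let ?a = "if b then s L else r L"
  assume "l L dvd \<gamma> G b"
  with \<gamma>_dvd_diff[OF G L, of b] have dvd: "l L dvd Const ?a * lprod (G - {L})"
    by (metis dvd_diff_right_iff dvd_diff add_diff_cancel_left' diff_add_cancel dvd_minus_iff minus_diff_eq)
  show "?a = 0"
  proof (rule ccontr)
    assume "?a \<noteq> 0"
    then have "Const (inverse ?a) * (Const ?a * lprod (G - {L})) = lprod (G - {L})"
      by (simp only: mult.assoc[symmetric] Const_inverse_mult[OF \<open>?a \<noteq> 0\<close>] mult_1_left)
    then have "l L dvd lprod (G - {L})" using dvd by (metis dvd_mult)
    then show False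
      using not_dvd_lprod[of "G - {L}" L] L group_subset[OF G] by auto
  qed
next
  assume "(if b then s L else r L) = 0"
  then show "l L dvd \<gamma> G b"
    using \<gamma>_dvd_diff[OF G L, of b] by simp
qed

lemma \<gamma>_nonzero: "G \<in> \<P> \<Longrightarrow> \<gamma> G False \<noteq> 0" "G \<in> \<D> \<Longrightarrow> \<gamma> G True \<noteq> 0"
proof -
  show "\<gamma> G False \<noteq> 0" if "G \<in> \<P>"
    using \<gamma>_dvd_iff[OF that e1[OF that], of False] coords_e1[OF that] by auto
  show "\<gamma> G True \<noteq> 0" if "G \<in> \<D>"
    using \<gamma>_dvd_iff[OF _ e2(1)[OF that], of True] coords_e2[OF that] that \<D>_subset by auto
qed

subsection \<open>Relations between the generators\<close>

text \<open>The two coefficients in a pencil are relatively prime, which is shown with Euler's relation.\<close>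

lemma group_syzygy:
  assumes G: "G \<in> \<P>" and "a * \<gamma> G False + b * \<gamma> G True = 0" and "G \<notin> \<D> \<Longrightarrow> b = 0"
  shows "\<exists>w. a = w * \<gamma> G True \<and> b = - w * \<gamma> G False"
proof (cases "G \<in> \<D>")
  case False
  then have "a = 0" "b = 0"
    using assms(2,3) \<gamma>_singleton'[OF G] by auto
  then show ?thesis by (intro exI[of _ 0]) simp
next
  case True
  define \<alpha> \<beta> g t where "\<alpha> = l (e1 G)" and "\<beta> = l (e2 G)" and "g = lprod G" and "t = (of_nat (card G) :: 'k poly3)"
  have euler: "\<alpha> * \<gamma> G False + \<beta> * \<gamma> G True = t * g"
    unfolding \<alpha>_def \<beta>_def g_def t_def by (rule group_euler[OF G])
  have ab: "b * \<gamma> G True = - (a * \<gamma> G False)"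
    using assms(2) by (simp add: eq_neg_iff_add_eq_0 add.commute)
  \<comment> \<open>Eliminating with Euler's relation, \<open>\<beta> * a - \<alpha> * b\<close>
    becomes a multiple of \<open>g\<close> when multiplied by either derivative.\<close>
  have 1: "(\<beta> * a - \<alpha> * b) * \<gamma> G False = - (t * g) * b"
  proof -
    have "(\<beta> * a - \<alpha> * b) * \<gamma> G False = - \<beta> * (b * \<gamma> G True) - \<alpha> * b * \<gamma> G False"
      unfolding ab by (simp add: algebra_simps)
    also have "\<dots> = - b * (\<alpha> * \<gamma> G False + \<beta> * \<gamma> G True)" by (simp add: algebra_simps)
    finally show ?thesis unfolding euler by (simp add: algebra_simps)
  qed
  have 2: "(\<beta> * a - \<alpha> * b) * \<gamma> G True = (t * g) * a"
  proof -
    have "(\<beta> * a - \<alpha> * b) * \<gamma> G True = \<beta> * a * \<gamma> G True - \<alpha> * (b * \<gamma> G True)"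
      by (simp add: algebra_simps)
    also have "\<dots> = a * (\<alpha> * \<gamma> G False + \<beta> * \<gamma> G True)" unfolding ab by (simp add: algebra_simps)
    finally show ?thesis unfolding euler by (simp add: algebra_simps)
  qed
  have "g dvd \<beta> * a - \<alpha> * b"
    unfolding g_def
  proof (rule lprod_dvd[OF group_subset[OF G]])
    fix L assume L: "L \<in> G"
    then have LAr: "L \<in> Ar" using group_subset[OF G] by blast
    have "l L dvd g"
      unfolding g_def using lprod_remove[OF L group_subset[OF G]] by simp
    then have *: "l L dvd (\<beta> * a - \<alpha> * b) * \<gamma> G False" "l L dvd (\<beta> * a - \<alpha> * b) * \<gamma> G True"
      unfolding 1 2 by simp_all
    \<comment> \<open>The prime \<open>l L\<close> cannot divide both derivatives, so it can be
      cancelled from one of the two products.\<close>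
    have "r L \<noteq> 0 \<or> s L \<noteq> 0"
      using coords[OF G L] c_nonzero[OF LAr] by (metis (mono_tags, lifting) add_0_right mult_zero_left ext)
    then have "\<not> l L dvd \<gamma> G False \<or> \<not> l L dvd \<gamma> G True"
      using \<gamma>_dvd_iff[OF G L] by simp
    then show "l L dvd \<beta> * a - \<alpha> * b"
      using * lin_dvd_mult[OF c_nonzero[OF LAr]] by blast
  qed
  then obtain w where w: "\<beta> * a - \<alpha> * b = g * w" by blast
  have g0: "g \<noteq> 0" unfolding g_def by (rule lprod_nonzero[OF group_subset[OF G]])
  \<comment> \<open>Characteristic zero enters: the number of lines of the group is invertible,
    which removes the factor \<open>t\<close> of Euler's relation.\<close>
  have t: "Const (inverse (of_nat (card G))) * t = 1"
    unfolding t_def using card_group_pos[OF G] Const_inverse_mult[of "of_nat (card G) :: 'k"] by simp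
  define w' where "w' = Const (inverse (of_nat (card G))) * w"
  have "g * (w * \<gamma> G True) = g * (t * a)" "g * (w * \<gamma> G False) = g * (- t * b)"
    using 1 2 unfolding w by (simp_all add: algebra_simps)
  then have wt: "w * \<gamma> G True = t * a" "w * \<gamma> G False = - t * b"
    using mult_left_cancel[OF g0] by blast+
  have "w' * \<gamma> G True = (Const (inverse (of_nat (card G))) * t) * a"
    unfolding w'_def using wt(1) by (simp add: mult.assoc)
  moreover have "- w' * \<gamma> G False = (Const (inverse (of_nat (card G))) * t) * b"
    unfolding w'_def using wt(2) by (simp add: mult.assoc)
  ultimately have "a = w' * \<gamma> G True \<and> b = - w' * \<gamma> G False"
    unfolding t by simp
  then show ?thesis by blast
qed

text \<open>\<open>Inl H\<close> is the difference of the Euler relations of \<open>H\<close> and \<open>G\<^sub>0\<close>, and \<open>Inr H\<close> is the Koszul relation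
  of \<open>H\<close>.\<close>

definition rel :: "'l set \<times> bool \<Rightarrow> 'l set + 'l set \<Rightarrow> 'k poly3" where
  "rel e j = (case j of
      Inl H \<Rightarrow> (if fst e = H then Const (inverse (of_nat (card H))) * l (if snd e then e2 H else e1 H)
        else if fst e = G\<^sub>0 then - Const (inverse (of_nat (card G\<^sub>0))) * l (if snd e then e2 G\<^sub>0 else e1 G\<^sub>0) else 0)
    | Inr H \<Rightarrow> (if fst e = H then (if snd e then - \<gamma> H False else \<gamma> H True) else 0))"

text \<open>The normalized Euler relation of every group expresses the same \<open>f\<close>, so
  only differences of them are relations, taken against the reference \<open>G\<^sub>0\<close>.
  Hence \<open>J\<close> has one element fewer than \<open>E\<close>.\<close>

definition J :: "('l set + 'l set) set" where "J = Inl ` (\<P> - {G\<^sub>0}) \<union> Inr ` \<D>"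

lemma finite_J: "finite J"
  using finite_\<P> by (simp add: J_def)

lemma sum_J: "(\<Sum>j\<in>J. \<phi> j) = (\<Sum>H\<in>\<P> - {G\<^sub>0}. \<phi> (Inl H)) + (\<Sum>H\<in>\<D>. \<phi> (Inr H))"
proof -
  have "(\<Sum>j\<in>J. \<phi> j) = (\<Sum>j\<in>Inl ` (\<P> - {G\<^sub>0}). \<phi> j) + (\<Sum>j\<in>Inr ` \<D>. \<phi> j)"
    unfolding J_def using finite_\<P> by (intro sum.union_disjoint) auto
  then show ?thesis by (simp add: sum.reindex)
qed

abbreviation ct :: "'l set \<Rightarrow> 'k poly3" where "ct G \<equiv> Const (inverse (of_nat (card G)))"

lemma ct: "G \<in> \<P> \<Longrightarrow> ct G * of_nat (card G) = 1"
  using card_group_pos[of G] Const_inverse_mult[of "of_nat (card G) :: 'k"] by simp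

text \<open>The multiple of the normalized Euler relation of \<open>G\<close> that occurs in the
  combination \<open>v\<close>. As only differences are used, these multiples add up to 0, which
  determines the one of \<open>G\<^sub>0\<close>.\<close>

definition \<kappa> :: "('l set + 'l set \<Rightarrow> 'k poly3) \<Rightarrow> 'l set \<Rightarrow> 'k poly3" where
  "\<kappa> v G = (if G = G\<^sub>0 then - (\<Sum>H\<in>\<P> - {G\<^sub>0}. v (Inl H)) else v (Inl G))"

lemma rel_sum:
  assumes "G \<in> \<P>" "b \<Longrightarrow> G \<in> \<D>"
  shows "(\<Sum>j\<in>J. rel (G, b) j * v j) = ct G * l (if b then e2 G else e1 G) * \<kappa> v G
     + (if G \<in> \<D> then (if b then - \<gamma> G False else \<gamma> G True) * v (Inr G) else 0)"
proof -
  have "(\<Sum>H\<in>\<D>. rel (G, b) (Inr H) * v (Inr H)) =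
      (\<Sum>H\<in>\<D>. if G = H then (if b then - \<gamma> G False else \<gamma> G True) * v (Inr G) else 0)"
    by (intro sum.cong) (auto simp: rel_def)
  moreover have "(\<Sum>H\<in>\<P> - {G\<^sub>0}. rel (G, b) (Inl H) * v (Inl H)) = ct G * l (if b then e2 G else e1 G) * \<kappa> v G"
  proof (cases "G = G\<^sub>0")
    case True
    then have "(\<Sum>H\<in>\<P> - {G\<^sub>0}. rel (G, b) (Inl H) * v (Inl H)) =
       (\<Sum>H\<in>\<P> - {G\<^sub>0}. - (ct G * l (if b then e2 G else e1 G)) * v (Inl H))"
      by (intro sum.cong) (auto simp: rel_def)
    then show ?thesis
      using True by (simp add: \<kappa>_def sum_distrib_left[symmetric] sum_negf)
  next
    case False
    then have "(\<Sum>H\<in>\<P> - {G\<^sub>0}. rel (G, b) (Inl H) * v (Inl H)) =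
       (\<Sum>H\<in>\<P> - {G\<^sub>0}. if G = H then ct G * l (if b then e2 G else e1 G) * v (Inl G) else 0)"
      by (intro sum.cong) (auto simp: rel_def)
    then show ?thesis
      using False assms(1) finite_\<P> by (simp add: \<kappa>_def)
  qed
  ultimately show ?thesis
    using finite_\<P> by (simp add: sum_J)
qed

lemma rel_sum_False: "G \<in> \<P> \<Longrightarrow> (\<Sum>j\<in>J. rel (G, False) j * v j) =
    ct G * l (e1 G) * \<kappa> v G + (if G \<in> \<D> then \<gamma> G True * v (Inr G) else 0)"
  using rel_sum[of G False v] by (cases "G \<in> \<D>") simp_all

lemma rel_sum_True: "G \<in> \<D> \<Longrightarrow> (\<Sum>j\<in>J. rel (G, True) j * v j) =
    ct G * l (e2 G) * \<kappa> v G - \<gamma> G False * v (Inr G)"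
  using rel_sum[of G True v] \<D>_subset by auto

lemma sum_\<kappa>: "(\<Sum>G\<in>\<P>. \<kappa> v G) = 0"
proof -
  have "(\<Sum>G\<in>\<P> - {G\<^sub>0}. \<kappa> v G) = (\<Sum>H\<in>\<P> - {G\<^sub>0}. v (Inl H))"
    by (intro sum.cong) (auto simp: \<kappa>_def)
  then show ?thesis
    using sum.remove[OF finite_\<P>(1) G0, of "\<kappa> v"] by (simp add: \<kappa>_def)
qed

lemma rel_inj:
  assumes "\<And>e. e \<in> E \<Longrightarrow> (\<Sum>j\<in>J. rel e j * v j) = 0" and j: "j \<in> J"
  shows "v j = 0"
proof -
  have \<kappa>: "\<kappa> v G = 0" if G: "G \<in> \<P>" for G
  proof -
    have 1: "ct G * l (e1 G) * \<kappa> v G + (if G \<in> \<D> then \<gamma> G True * v (Inr G) else 0) = 0"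
      using assms(1)[of "(G, False)"] rel_sum_False[OF G, of v] G by (simp add: E_def)
    have 2: "ct G * l (e2 G) * \<kappa> v G - \<gamma> G False * v (Inr G) = 0" if "G \<in> \<D>"
      using assms(1)[of "(G, True)"] rel_sum_True[of G v] that by (simp add: E_def)
    \<comment> \<open>Combining the two equations of a group with its two derivatives cancels the
      Koszul part and leaves Euler's relation.\<close>
    have "ct G * \<kappa> v G * (l (e1 G) * \<gamma> G False + l (e2 G) * \<gamma> G True) = 0"
    proof (cases "G \<in> \<D>")
      case True
      have "ct G * \<kappa> v G * (l (e1 G) * \<gamma> G False + l (e2 G) * \<gamma> G True)
         = (ct G * l (e1 G) * \<kappa> v G + \<gamma> G True * v (Inr G)) * \<gamma> G False
           + (ct G * l (e2 G) * \<kappa> v G - \<gamma> G False * v (Inr G)) * \<gamma> G True"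
        by (simp add: algebra_simps)
      then show ?thesis using 1 2 True by simp
    next
      case False
      then show ?thesis
        using 1 \<gamma>_singleton[OF G] by auto
    qed
    then show ?thesis
      unfolding group_euler[OF G] using lprod_nonzero[OF group_subset[OF G]] card_group_pos[OF G] by auto
  qed
  from j consider G where "j = Inl G" "G \<in> \<P>" "G \<noteq> G\<^sub>0" | G where "j = Inr G" "G \<in> \<D>"
    by (auto simp: J_def)
  then show ?thesis
  proof cases
    case 1
    then show ?thesis using \<kappa>[of G] by (simp add: \<kappa>_def)
  next
    case 2
    then have "G \<in> \<P>" using \<D>_subset by blast
    then have "\<gamma> G True * v (Inr G) = 0"
      using assms(1)[of "(G, False)"] rel_sum_False[of G v] 2 \<kappa>[of G] by (simp add: E_def)
    then show ?thesis using \<gamma>_nonzero(2)[OF 2(2)] 2(1) by simp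
  qed
qed

lemma rel_exact:
  "(\<Sum>e\<in>E. u e * Y e) = 0 \<longleftrightarrow> (\<exists>v. \<forall>e\<in>E. u e = (\<Sum>j\<in>J. rel e j * v j))"
proof
  assume "\<exists>v. \<forall>e\<in>E. u e = (\<Sum>j\<in>J. rel e j * v j)"
  then obtain v where v: "\<And>e. e \<in> E \<Longrightarrow> u e = (\<Sum>j\<in>J. rel e j * v j)" by blast
  have "u (G, False) * Y (G, False) + (if G \<in> \<D> then u (G, True) * Y (G, True) else 0) = f * \<kappa> v G"
    if G: "G \<in> \<P>" for G
  proof -
    have 1: "u (G, False) = ct G * l (e1 G) * \<kappa> v G + (if G \<in> \<D> then \<gamma> G True * v (Inr G) else 0)"
      using v[of "(G, False)"] rel_sum_False[OF G, of v] G by (simp add: E_def)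
    have 2: "u (G, True) = ct G * l (e2 G) * \<kappa> v G - \<gamma> G False * v (Inr G)" if "G \<in> \<D>"
      using v[of "(G, True)"] rel_sum_True[of G v] that by (simp add: E_def)
    have "u (G, False) * Y (G, False) + (if G \<in> \<D> then u (G, True) * Y (G, True) else 0)
       = h G * (ct G * \<kappa> v G * (l (e1 G) * \<gamma> G False + l (e2 G) * \<gamma> G True))"
    proof (cases "G \<in> \<D>")
      case True
      then show ?thesis unfolding 1 2[OF True] by (simp add: Y_def algebra_simps)
    next
      case False
      then show ?thesis unfolding 1 using \<gamma>_singleton[OF G] by (simp add: Y_def algebra_simps)
    qed
    also have "\<dots> = (ct G * of_nat (card G)) * (h G * lprod G * \<kappa> v G)"
      unfolding group_euler[OF G] by (simp only: mult_ac)
    finally show ?thesis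
      unfolding ct[OF G] lprod_group[OF G] by (simp add: mult_ac)
  qed
  then show "(\<Sum>e\<in>E. u e * Y e) = 0"
    unfolding sum_E_groups by (simp add: sum_distrib_left[symmetric] sum_\<kappa>)
next
  assume zero: "(\<Sum>e\<in>E. u e * Y e) = 0"
  define u2 where "u2 = (\<lambda>G. if G \<in> \<D> then u (G, True) else 0)"
  define w where "w = (\<lambda>G. u (G, False) * \<gamma> G False + u2 G * \<gamma> G True)"
  have sum_w: "(\<Sum>G\<in>\<P>. h G * w G) = 0"
  proof -
    have "(\<Sum>G\<in>\<P>. h G * w G) = (\<Sum>e\<in>E. u e * Y e)"
      unfolding sum_E_groups by (intro sum.cong) (auto simp: w_def u2_def Y_def algebra_simps)
    with zero show ?thesis by simp
  qed
  \<comment> \<open>For every other group \<open>H\<close> the product \<open>h H\<close> contains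
    all lines of \<open>G\<close>, while \<open>h G\<close> contains none; so each of these primes
    divides \<open>w G\<close>.\<close>
  have "\<exists>k. w G = lprod G * k" if G: "G \<in> \<P>" for G
  proof -
    have "h G * w G = - (\<Sum>H\<in>\<P> - {G}. h H * w H)"
      using sum_w sum.remove[OF finite_\<P>(1) G, of "\<lambda>H. h H * w H"] by (simp add: eq_neg_iff_add_eq_0)
    also have "lprod G dvd \<dots>"
    proof -
      have "lprod G dvd h H" if "H \<in> \<P> - {G}" for H
        using disjoint[OF G, of H] that group_subset[OF G] by (intro lprod_dvd_mono) auto
      then show ?thesis unfolding dvd_minus_iff by (intro dvd_sum dvd_mult2)
    qed
    finally have dvd: "lprod G dvd h G * w G" .
    have "lprod G dvd w G"
    proof (rule lprod_dvd[OF group_subset[OF G]])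
      fix L assume L: "L \<in> G"
      then have LAr: "L \<in> Ar" using group_subset[OF G] by blast
      have "l L dvd h G * w G"
        using dvd lprod_remove[OF L group_subset[OF G]] by (metis dvd_mult_left)
      moreover have "\<not> l L dvd h G"
        using L LAr by (intro not_dvd_lprod) auto
      ultimately show "l L dvd w G"
        using lin_dvd_mult[OF c_nonzero[OF LAr]] by blast
    qed
    then show ?thesis by (auto elim: dvdE)
  qed
  then obtain k where k: "\<And>G. G \<in> \<P> \<Longrightarrow> w G = lprod G * k G" by metis
  have "f * (\<Sum>G\<in>\<P>. k G) = 0"
  proof -
    have "f * (\<Sum>G\<in>\<P>. k G) = (\<Sum>G\<in>\<P>. h G * w G)"
      unfolding sum_distrib_left using lprod_group k by (intro sum.cong refl) (simp add: mult_ac)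
    then show ?thesis using sum_w by simp
  qed
  then have sum_k: "(\<Sum>G\<in>\<P>. k G) = 0"
    using lprod_nonzero[of Ar] by simp
  \<comment> \<open>After subtraction of \<open>k G\<close> times the normalized Euler relation, a
    syzygy within the group is left, hence a multiple of its Koszul relation.\<close>
  have "\<exists>z. u (G, False) - ct G * l (e1 G) * k G = z * \<gamma> G True \<and>
      (u2 G - (if G \<in> \<D> then ct G * l (e2 G) * k G else 0)) = - z * \<gamma> G False" if G: "G \<in> \<P>" for G
  proof (rule group_syzygy[OF G])
    have "(u (G, False) - ct G * l (e1 G) * k G) * \<gamma> G False +
       (u2 G - (if G \<in> \<D> then ct G * l (e2 G) * k G else 0)) * \<gamma> G True
       = w G - ct G * k G * (l (e1 G) * \<gamma> G False + l (e2 G) * \<gamma> G True)"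
      using \<gamma>_singleton[OF G] by (auto simp: w_def algebra_simps)
    also have "\<dots> = w G - (ct G * of_nat (card G)) * (lprod G * k G)"
      unfolding group_euler[OF G] by (simp only: mult_ac)
    also have "\<dots> = 0"
      unfolding ct[OF G] k[OF G] by simp
    finally show "(u (G, False) - ct G * l (e1 G) * k G) * \<gamma> G False +
       (u2 G - (if G \<in> \<D> then ct G * l (e2 G) * k G else 0)) * \<gamma> G True = 0" .
  qed (simp add: u2_def)
  then obtain z where z: "\<And>G. G \<in> \<P> \<Longrightarrow> u (G, False) - ct G * l (e1 G) * k G = z G * \<gamma> G True"
    "\<And>G. G \<in> \<P> \<Longrightarrow> (u2 G - (if G \<in> \<D> then ct G * l (e2 G) * k G else 0)) = - z G * \<gamma> G False"
    by metis
  \<comment> \<open>\<open>Inl G\<^sub>0\<close> is not in \<open>J\<close>; the value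
    \<open>k G\<^sub>0\<close> is recovered from the others because all of them add up to 0.\<close>
  define v where "v = case_sum k z"
  have \<kappa>_v: "\<kappa> v G = k G" if "G \<in> \<P>" for G
    using sum_k sum.remove[OF finite_\<P>(1) G0, of k] by (auto simp: \<kappa>_def v_def eq_neg_iff_add_eq_0 neg_eq_iff_add_eq_0 add.commute)
  have "u e = (\<Sum>j\<in>J. rel e j * v j)" if "e \<in> E" for e
  proof -
    from that consider G where "e = (G, False)" "G \<in> \<P>" | G where "e = (G, True)" "G \<in> \<D>"
      by (auto simp: E_def)
    then show ?thesis
    proof cases
      case 1
      have "u (G, False) = ct G * l (e1 G) * k G + z G * \<gamma> G True"
        using z(1)[OF 1(2)] by (simp add: diff_eq_eq add.commute)
      then show ?thesis
        using 1 rel_sum_False[OF 1(2), of v] \<kappa>_v[OF 1(2)] \<gamma>_singleton[OF 1(2)]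
        by (auto simp: v_def mult.commute)
    next
      case 2
      then have G: "G \<in> \<P>" using \<D>_subset by blast
      have "u (G, True) = ct G * l (e2 G) * k G - z G * \<gamma> G False"
        using z(2)[OF G] 2 by (simp add: u2_def diff_eq_eq add.commute)
      then show ?thesis
        using 2 rel_sum_True[of G v] \<kappa>_v[OF G] by (simp add: v_def mult.commute)
    qed
  qed
  then show "\<exists>v. \<forall>e\<in>E. u e = (\<Sum>j\<in>J. rel e j * v j)" by blast
qed

lemma homogeneous_\<gamma>:
  assumes G: "G \<in> \<P>"
  shows "homogeneous_of_degree (int (card G) - 1) (\<gamma> G b)"
  unfolding \<gamma>_def
proof (intro homogeneous_sum homogeneous_Const_mult)
  fix L assume L: "L \<in> G"
  have "int (card (G - {L})) = int (card G) - 1"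
    using card_group_pos[OF G] L finite_group[OF G] by (simp add: card_Diff_singleton of_nat_diff)
  then show "homogeneous_of_degree (int (card G) - 1) (lprod (G - {L}))"
    using homogeneous_lprod[of "G - {L}"] group_subset[OF G] by (metis Diff_subset order_trans)
qed

lemma homogeneous_Y:
  assumes "e \<in> E"
  shows "homogeneous_of_degree (int (card Ar) - 1) (Y e)"
proof -
  have G: "fst e \<in> \<P>" using assms \<D>_subset by (auto simp: E_def)
  have "card Ar = card (Ar - fst e) + card (fst e)"
    using group_subset[OF G] finite_Ar card_mono[OF finite_Ar, of "fst e"] by (simp add: card_Diff_subset finite_group[OF G])
  then have "int (card (Ar - fst e)) + (int (card (fst e)) - 1) = int (card Ar) - 1" by simp
  then show ?thesis
    unfolding Y_def by (intro homogeneous_mult'[OF homogeneous_lprod homogeneous_\<gamma>[OF G]]) auto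
qed

definition rel_degree :: "'l set + 'l set \<Rightarrow> int" where
  "rel_degree j = (case j of Inl _ \<Rightarrow> 1 | Inr H \<Rightarrow> int (card H) - 1)"

lemma homogeneous_rel:
  assumes "j \<in> J"
  shows "homogeneous_of_degree (rel_degree j) (rel e j)"
proof (cases j)
  case (Inl H)
  have "homogeneous_of_degree 1 (- ct G\<^sub>0 * l L)" for L
    unfolding mult_minus_left homogeneous_uminus by (rule homogeneous_Const_mult[OF homogeneous_lin])
  then show ?thesis
    using Inl by (simp add: rel_def rel_degree_def homogeneous_Const_mult[OF homogeneous_lin])
next
  case (Inr H)
  then have "H \<in> \<P>" using assms \<D>_subset by (auto simp: J_def)
  then show ?thesis
    using Inr homogeneous_\<gamma>[of H] by (simp add: rel_def rel_degree_def)
qed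

end

section \<open>The Jacobian ideal as the ideal of the gradient\<close>

lemma ideal_jacobian: "ideal (jacobian_ideal p) S_ring"
  unfolding jacobian_ideal_def by (rule ideal_genideal_range)

lemma jacobian_ideal_iff: "a \<in> jacobian_ideal p \<longleftrightarrow> (\<exists>\<theta>. a = (\<Sum>i\<in>UNIV. \<theta> i * partial_deriv i p))"
  unfolding jacobian_ideal_def genideal_range by simp

definition gradient :: "'k::field poly3 \<Rightarrow> 'k poly3 vec" where
  "gradient p = vec 3 (\<lambda>i. partial_deriv (of_nat i) p)"

lemma gradient_carrier [simp]: "gradient p \<in> carrier_vec 3"
  by (simp add: gradient_def)

lemma gradient_index: "gradient p $ 0 = partial_deriv 0 p" "gradient p $ 1 = partial_deriv 1 p"
  "gradient p $ Suc 0 = partial_deriv 1 p" "gradient p $ 2 = partial_deriv 2 p"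
  by (simp_all add: gradient_def)

lemma jacobian_eq_vec_ideal: "jacobian_ideal p = vec_ideal (gradient p)"
proof
  show "jacobian_ideal p \<subseteq> vec_ideal (gradient p)"
  proof
    fix a assume "a \<in> jacobian_ideal p"
    then obtain \<theta> where a: "a = (\<Sum>i\<in>UNIV. \<theta> i * partial_deriv i p)"
      unfolding jacobian_ideal_iff by blast
    have "a = gradient p \<bullet> vec 3 (\<lambda>i. \<theta> (of_nat i))"
      by (simp add: a sum_UNIV_3 scalar_prod_3 gradient_index mult.commute)
    then show "a \<in> vec_ideal (gradient p)"
      using vec_idealI[of "vec 3 (\<lambda>i. \<theta> (of_nat i))" "gradient p"] by (simp add: gradient_def)
  qed
  show "vec_ideal (gradient p) \<subseteq> jacobian_ideal p"
  proof
    fix a assume "a \<in> vec_ideal (gradient p)"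
    then obtain \<theta> where \<theta>: "\<theta> \<in> carrier_vec 3" "a = gradient p \<bullet> \<theta>"
      by (auto elim!: vec_idealE simp: gradient_def)
    have "a = (\<Sum>i\<in>UNIV. (if i = 0 then \<theta> $ 0 else if i = 1 then \<theta> $ 1 else \<theta> $ 2) * partial_deriv i p)"
      using \<theta> by (simp add: sum_UNIV_3 scalar_prod_3 gradient_index mult.commute)
    then show "a \<in> jacobian_ideal p"
      unfolding jacobian_ideal_iff
      by (intro exI[of _ "\<lambda>i. if i = 0 then \<theta> $ 0 else if i = 1 then \<theta> $ 1 else \<theta> $ 2"])
  qed
qed

lemma lin_unit: "lin (\<lambda>j. if j = i then 1 else 0) = variable i"
  by (simp add: lin_def if_distrib[of Const] if_distrib[of "\<lambda>x. x * _"] sum.delta cong: if_cong)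

section \<open>Splitting off constant matrices\<close>

lemma sum_split_3: "(\<Sum>e\<in>{0..<p + 3}. \<phi> e) = \<phi> 0 + \<phi> 1 + \<phi> 2 + (\<Sum>e\<in>{0..<p}. \<phi> (e + 3 :: nat))"
proof -
  have "{0..<p + 3} = {0, 1, 2} \<union> (\<lambda>e. e + 3) ` {0..<p}"
    by (auto simp: image_add_atLeastLessThan')
  moreover have "(\<Sum>e\<in>{0, 1, 2} \<union> (\<lambda>e. e + 3) ` {0..<p}. \<phi> e) = (\<Sum>e\<in>{0, 1, 2}. \<phi> e) + (\<Sum>e\<in>(\<lambda>e. e + 3) ` {0..<p}. \<phi> e)"
    by (rule sum.union_disjoint) auto
  moreover have "(\<Sum>e\<in>(\<lambda>e. e + 3) ` {0..<p}. \<phi> e) = (\<Sum>e\<in>{0..<p}. \<phi> (e + 3))"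
    by (subst sum.reindex) (auto simp: inj_on_def)
  moreover have "(\<Sum>e\<in>{0, 1, 2}. \<phi> e) = \<phi> 0 + \<phi> 1 + \<phi> 2"
    by (simp add: add.assoc)
  ultimately show ?thesis by (simp only:)
qed

lemma dual_basis3:
  fixes a :: "nat \<Rightarrow> 3 \<Rightarrow> 'k::field"
  assumes "det3 (a 0) (a 1) (a 2) \<noteq> 0"
  obtains v where "\<And>j k. j < 3 \<Longrightarrow> k < 3 \<Longrightarrow> dot3 (a j) (v k) = (if j = k then 1 else 0)"
    "\<And>b i. b i = dot3 b (v 0) * a 0 i + dot3 b (v 1) * a 1 i + dot3 b (v 2) * a 2 i"
proof -
  have perm: "det3 (a 1) (a 0) (a 2) \<noteq> 0" "det3 (a 2) (a 0) (a 1) \<noteq> 0"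
    using assms by (simp_all add: det3_def algebra_simps)
  obtain v0 v1 v2 where v:
    "dot3 (a 0) v0 = 1" "dot3 (a 1) v0 = 0" "dot3 (a 2) v0 = 0"
    "dot3 (a 1) v1 = 1" "dot3 (a 0) v1 = 0" "dot3 (a 2) v1 = 0"
    "dot3 (a 2) v2 = 1" "dot3 (a 0) v2 = 0" "dot3 (a 1) v2 = 0"
    using dual_vector3[OF assms] dual_vector3[OF perm(1)] dual_vector3[OF perm(2)] by metis
  define v where "v = (\<lambda>k :: nat. if k = 0 then v0 else if k = 1 then v1 else v2)"
  have dual: "dot3 (a j) (v k) = (if j = k then 1 else 0)" if "j < 3" "k < 3" for j k
    using that v by (auto simp: less_3_iff v_def)
  have "b i = dot3 b (v 0) * a 0 i + dot3 b (v 1) * a 1 i + dot3 b (v 2) * a 2 i" for b i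
  proof -
    obtain x y z where b: "b = (\<lambda>i. x * a 0 i + y * a 1 i + z * a 2 i)"
      using cramer3[OF assms] by blast
    have "dot3 b w = x * dot3 (a 0) w + y * dot3 (a 1) w + z * dot3 (a 2) w" for w
      unfolding b by (simp add: dot3_eq algebra_simps)
    then have "dot3 b (v 0) = x" "dot3 b (v 1) = y" "dot3 b (v 2) = z"
      by (simp_all add: v_def v v[unfolded One_nat_def])
    then show ?thesis by (simp add: b)
  qed
  with dual show ?thesis by (rule that)
qed

text \<open>The first three rows of \<open>\<Lambda>\<close> form an invertible matrix.
  \<open>L\<close> inverts them, \<open>T\<close> includes the remaining coordinates, and
  \<open>P\<close> subtracts from each of these its expression \<open>\<mu>\<close> through the
  first three.\<close>

lemma constant_splitting:
  fixes a :: "nat \<Rightarrow> 3 \<Rightarrow> 'k::field" and p :: nat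
  assumes det: "det3 (a 0) (a 1) (a 2) \<noteq> 0"
  defines "\<Lambda> \<equiv> mat (p + 3) 3 (\<lambda>(e, i). Const (a e (of_nat i)))"
  obtains L T P where "L \<in> carrier_mat 3 (p + 3)" "T \<in> carrier_mat (p + 3) p" "P \<in> carrier_mat p (p + 3)"
    "L * \<Lambda> = 1\<^sub>m 3" "P * T = 1\<^sub>m p" "P * \<Lambda> = 0\<^sub>m p 3" "\<Lambda> * L + T * P = 1\<^sub>m (p + 3)"
    "\<forall>e<p + 3. \<forall>i<p. homogeneous_of_degree 0 (T $$ (e, i))"
    "\<forall>e<p. \<forall>i<p + 3. homogeneous_of_degree 0 (P $$ (e, i))"
proof -
  obtain v where v: "\<And>j k. j < 3 \<Longrightarrow> k < 3 \<Longrightarrow> dot3 (a j) (v k) = (if j = k then 1 else 0)"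
    "\<And>b i. b i = dot3 b (v 0) * a 0 i + dot3 b (v 1) * a 1 i + dot3 b (v 2) * a 2 i"
    using dual_basis3[of a, OF det] by metis
  define \<mu> where "\<mu> = (\<lambda>e k. dot3 (a e) (v k))"
  define L where "L = mat 3 (p + 3) (\<lambda>(i, e). if e < 3 then Const (v e (of_nat i)) else 0)"
  define T where "T = mat (p + 3) p (\<lambda>(e, r). if e = r + 3 then 1 else 0 :: 'k poly3)"
  define P where "P = mat p (p + 3) (\<lambda>(r, e). if e < 3 then - Const (\<mu> (r + 3) e) else if e = r + 3 then 1 else 0)"
  have \<Lambda>: "\<Lambda> \<in> carrier_mat (p + 3) 3" and L: "L \<in> carrier_mat 3 (p + 3)"
    and T: "T \<in> carrier_mat (p + 3) p" and P: "P \<in> carrier_mat p (p + 3)"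
    by (simp_all add: \<Lambda>_def L_def T_def P_def)
  have prod: "(M * K) $$ (i, j) = (\<Sum>e\<in>{0..<n}. M $$ (i, e) * K $$ (e, j))"
    if "M \<in> carrier_mat n1 n" "K \<in> carrier_mat n n2" "i < n1" "j < n2" for M K :: "'k poly3 mat" and n1 n n2 i j
    using that by (simp add: scalar_prod_def)
  have delta: "(\<Sum>e\<in>{0..<p}. (if e = r then 1 else 0) * \<phi> e) = (if r < p then \<phi> r else 0 :: 'k poly3)" for r \<phi>
    by (simp add: if_distrib[of "\<lambda>x. x * _"] sum.delta cong: if_cong)
  have "L * \<Lambda> = 1\<^sub>m 3"
  proof (rule eq_matI)
    fix i j assume "i < dim_row (1\<^sub>m 3 :: 'k poly3 mat)" "j < dim_col (1\<^sub>m 3 :: 'k poly3 mat)"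
    then have ij: "i < 3" "j < 3" by auto
    define b where "b = (\<lambda>k :: 3. if k = of_nat i then 1 else 0 :: 'k)"
    have "dot3 b w = w (of_nat i)" for w
      by (simp add: dot3_def b_def if_distrib[of "\<lambda>x. x * _"] sum.delta cong: if_cong)
    with v(2)[of b "of_nat j"]
    have 1: "v 0 (of_nat i) * a 0 (of_nat j) + v 1 (of_nat i) * a 1 (of_nat j) + v 2 (of_nat i) * a 2 (of_nat j)
       = (if i = j then 1 else 0)"
      using ij by (auto simp: b_def less_3_iff)
    have "(L * \<Lambda>) $$ (i, j) = Const (v 0 (of_nat i) * a 0 (of_nat j) + v 1 (of_nat i) * a 1 (of_nat j) + v 2 (of_nat i) * a 2 (of_nat j))"
      unfolding prod[OF L \<Lambda> ij] sum_split_3 Const_add Const_mult using ij by (simp add: L_def \<Lambda>_def)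
    then show "(L * \<Lambda>) $$ (i, j) = 1\<^sub>m 3 $$ (i, j)"
      unfolding 1 using ij by simp
  qed (use L \<Lambda> in auto)
  moreover have "P * T = 1\<^sub>m p"
  proof (rule eq_matI)
    fix i j assume "i < dim_row (1\<^sub>m p :: 'k poly3 mat)" "j < dim_col (1\<^sub>m p :: 'k poly3 mat)"
    then have ij: "i < p" "j < p" by auto
    show "(P * T) $$ (i, j) = 1\<^sub>m p $$ (i, j)"
      unfolding prod[OF P T ij] sum_split_3 using ij delta[of i "\<lambda>e. if e = j then 1 else 0"]
      by (simp add: P_def T_def)
  qed (use P T in auto)
  moreover have coord: "a e i = \<mu> e 0 * a 0 i + \<mu> e 1 * a 1 i + \<mu> e 2 * a 2 i" for e i
    unfolding \<mu>_def by (rule v(2))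
  have "P * \<Lambda> = 0\<^sub>m p 3"
  proof (rule eq_matI)
    fix i j assume "i < dim_row (0\<^sub>m p 3 :: 'k poly3 mat)" "j < dim_col (0\<^sub>m p 3 :: 'k poly3 mat)"
    then have ij: "i < p" "j < 3" by auto
    have "(P * \<Lambda>) $$ (i, j) = - Const (\<mu> (i + 3) 0 * a 0 (of_nat j) + \<mu> (i + 3) 1 * a 1 (of_nat j) + \<mu> (i + 3) 2 * a 2 (of_nat j))
       + Const (a (i + 3) (of_nat j))"
      unfolding prod[OF P \<Lambda> ij] sum_split_3 Const_add Const_mult
      using ij delta[of i "\<lambda>e. Const (a (e + 3) (of_nat j))"] by (simp add: P_def \<Lambda>_def)
    then show "(P * \<Lambda>) $$ (i, j) = 0\<^sub>m p 3 $$ (i, j)"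
      unfolding coord[symmetric] using ij by simp
  qed (use P \<Lambda> in auto)
  moreover have "\<Lambda> * L + T * P = 1\<^sub>m (p + 3)"
  proof (rule eq_matI)
    fix i j assume "i < dim_row (1\<^sub>m (p + 3) :: 'k poly3 mat)" "j < dim_col (1\<^sub>m (p + 3) :: 'k poly3 mat)"
    then have ij: "i < p + 3" "j < p + 3" by auto
    have sum3: "(\<Sum>e\<in>{0..<3}. \<phi> e) = \<phi> 0 + \<phi> 1 + \<phi> (2::nat)" for \<phi> :: "nat \<Rightarrow> 'k poly3"
      using sum_split_3[of \<phi> 0] by simp
    have 1: "(\<Lambda> * L) $$ (i, j) = (if j < 3 then Const (\<mu> i j) else 0)"
    proof (cases "j < 3")
      case True
      have "(\<Lambda> * L) $$ (i, j) = Const (a i 0 * v j 0 + a i 1 * v j 1 + a i 2 * v j 2)"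
        unfolding prod[OF \<Lambda> L ij] sum3 Const_add Const_mult using ij True by (simp add: L_def \<Lambda>_def)
      then show ?thesis using True by (simp add: \<mu>_def dot3_eq)
    next
      case False
      then show ?thesis unfolding prod[OF \<Lambda> L ij] sum3 using ij by (simp add: L_def)
    qed
    have 2: "(T * P) $$ (i, j) = (if i < 3 then 0 else P $$ (i - 3, j))"
    proof -
      have "(T * P) $$ (i, j) = (\<Sum>e\<in>{0..<p}. (if i = e + 3 then 1 else 0) * P $$ (e, j))"
        unfolding prod[OF T P ij] using ij by (intro sum.cong) (auto simp: T_def)
      also have "\<dots> = (if i < 3 then 0 else P $$ (i - 3, j))"
      proof (cases "i < 3")
        case False
        then have "(\<Sum>e\<in>{0..<p}. (if i = e + 3 then 1 else 0) * P $$ (e, j)) =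
           (\<Sum>e\<in>{0..<p}. (if e = i - 3 then 1 else 0) * P $$ (e, j))"
          by (intro sum.cong) auto
        then show ?thesis unfolding delta using ij False by auto
      qed (auto intro!: sum.neutral)
      finally show ?thesis .
    qed
    have "(\<Lambda> * L + T * P) $$ (i, j) = (\<Lambda> * L) $$ (i, j) + (T * P) $$ (i, j)"
      using ij \<Lambda> L T P by (intro index_add_mat) auto
    also have "\<dots> = (if i = j then 1 else 0)"
    proof (cases "i < 3")
      case True
      then show ?thesis
        unfolding 1 2 using v(1)[of i j] by (auto simp: \<mu>_def)
    next
      case False
      then show ?thesis
        unfolding 1 2 using ij by (auto simp: P_def)
    qed
    finally show "(\<Lambda> * L + T * P) $$ (i, j) = 1\<^sub>m (p + 3) $$ (i, j)"
      using ij by simp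
  qed (use \<Lambda> L T P in auto)
  moreover have "homogeneous_of_degree 0 (T $$ (e, i))" if "e < p + 3" "i < p" for e i
    using that by (simp add: T_def homogeneous_1)
  moreover have "homogeneous_of_degree 0 (P $$ (e, i))" if "e < p" "i < p + 3" for e i
    using that by (simp add: P_def homogeneous_1 homogeneous_Const)
  ultimately show ?thesis
    using that[OF L T P] by blast
qed

context grouped_arrangement
begin

subsection \<open>Torsion modulo the Jacobian ideal\<close>

lemma card_Ar_pos: "0 < card Ar"
  using G0 e1 group_subset finite_Ar card_gt_0_iff by blast

text \<open>The sum is the derivative of \<open>f\<close> in the direction \<open>v\<close>.\<close>

lemma directional_in_jacobian: "(\<Sum>L\<in>Ar. Const (dot3 (c L) v) * lprod (Ar - {L})) \<in> jacobian_ideal f"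
proof -
  have "(\<Sum>L\<in>Ar. Const (dot3 (c L) v) * lprod (Ar - {L})) = (\<Sum>i\<in>UNIV. Const (v i) * partial_deriv i f)"
    unfolding partial_deriv_f sum_distrib_left
    by (subst sum.swap) (simp add: dot3_def Const_sum Const_mult sum_distrib_left sum_distrib_right mult_ac)
  then show ?thesis
    unfolding jacobian_ideal_iff by (intro exI[of _ "\<lambda>i. Const (v i)"])
qed

lemma euler_f: "(\<Sum>i\<in>UNIV. variable i * partial_deriv i f) = of_nat (card Ar) * f"
  by (rule euler_identity[OF homogeneous_lprod]) simp

lemma inverse_card_Ar: "Const (inverse (of_nat (card Ar))) * of_nat (card Ar) = (1 :: 'k poly3)"
  using card_Ar_pos Const_inverse_mult[of "of_nat (card Ar) :: 'k"] by simp

text \<open>Euler's relation puts \<open>f\<close> itself into the Jacobian ideal, as its degree is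
  invertible in characteristic zero.\<close>

lemma dvd_in_jacobian:
  assumes "f dvd a"
  shows "a \<in> jacobian_ideal f"
proof -
  obtain b where b: "a = f * b" using assms by blast
  have "of_nat (card Ar) * f \<in> jacobian_ideal f"
    unfolding jacobian_ideal_iff using euler_f by metis
  then have "b * Const (inverse (of_nat (card Ar))) * (of_nat (card Ar) * f) \<in> jacobian_ideal f"
    by (rule S_ring_ideal_mult[OF ideal_jacobian])
  moreover have "b * Const (inverse (of_nat (card Ar))) * (of_nat (card Ar) * f) =
      (Const (inverse (of_nat (card Ar))) * of_nat (card Ar)) * a"
    unfolding b by (simp only: mult_ac)
  ultimately show ?thesis
    unfolding inverse_card_Ar by simp
qed

lemma f_dvd_mult:
  assumes "L \<in> V" "V \<subseteq> Ar"
  shows "f dvd lprod V * lprod (Ar - {L})"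
  using lprod_remove[OF assms] lprod_remove[of L Ar] assms by (auto simp: mult_ac)

text \<open>Differentiate in a direction with value 1 on \<open>L\<close> and 0 on
  \<open>L'\<close>. After multiplication by the product of the other lines, all summands but that
  of \<open>L\<close> are multiples of \<open>f\<close>.\<close>

lemma cofactor_in_jacobian:
  assumes L: "L \<in> Ar" "L' \<in> Ar" "L \<noteq> L'"
  shows "lprod (Ar - {L, L'}) * lprod (Ar - {L}) \<in> jacobian_ideal f"
proof -
  define R where "R = lprod (Ar - {L, L'})"
  obtain v where v: "dot3 (c L) v = 1" "dot3 (c L') v = 0"
    using dual_vector2[OF not_proportional[OF L] c_nonzero[OF L(1)]] by blast
  have "R * (\<Sum>M\<in>Ar. Const (dot3 (c M) v) * lprod (Ar - {M})) \<in> jacobian_ideal f"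
    by (rule S_ring_ideal_mult[OF ideal_jacobian directional_in_jacobian])
  moreover have "(\<Sum>M\<in>Ar. Const (dot3 (c M) v) * lprod (Ar - {M})) =
      lprod (Ar - {L}) + (\<Sum>M\<in>Ar - {L, L'}. Const (dot3 (c M) v) * lprod (Ar - {M}))"
  proof -
    have "Ar = insert L (insert L' (Ar - {L, L'}))" using L by auto
    then have "(\<Sum>M\<in>Ar. Const (dot3 (c M) v) * lprod (Ar - {M})) =
       (\<Sum>M\<in>insert L (insert L' (Ar - {L, L'})). Const (dot3 (c M) v) * lprod (Ar - {M}))" by simp
    also have "\<dots> = lprod (Ar - {L}) + (\<Sum>M\<in>Ar - {L, L'}. Const (dot3 (c M) v) * lprod (Ar - {M}))"
      using finite_Ar L by (simp add: v)
    finally show ?thesis .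
  qed
  ultimately have "R * lprod (Ar - {L}) + R * (\<Sum>M\<in>Ar - {L, L'}. Const (dot3 (c M) v) * lprod (Ar - {M})) \<in> jacobian_ideal f"
    by (simp add: distrib_left)
  moreover have "R * (\<Sum>M\<in>Ar - {L, L'}. Const (dot3 (c M) v) * lprod (Ar - {M})) \<in> jacobian_ideal f"
    unfolding sum_distrib_left
  proof (intro S_ring_ideal_sum[OF ideal_jacobian] dvd_in_jacobian)
    fix M assume "M \<in> Ar - {L, L'}"
    then have "f dvd R * lprod (Ar - {M})"
      unfolding R_def by (intro f_dvd_mult) auto
    then show "f dvd R * (Const (dot3 (c M) v) * lprod (Ar - {M}))"
      by (subst mult.left_commute) (rule dvd_mult)
  qed
  ultimately show ?thesis
    using S_ring_ideal_diff[OF ideal_jacobian] unfolding R_def by fastforce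
qed

lemma Y_sum: 
  assumes G: "G \<in> \<P>"
  shows "Y (G, b) = (\<Sum>L\<in>G. Const (if b then s L else r L) * lprod (Ar - {L}))"
  unfolding Y_def \<gamma>_def fst_conv snd_conv sum_distrib_left
  by (intro sum.cong refl) (simp add: lprod_group_remove[OF G] mult.left_commute)

lemma cofactor_mult_Y:
  assumes G: "G \<in> \<P>" and L: "L \<in> G" "L' \<in> Ar - G"
  shows "lprod (Ar - {L, L'}) * Y (G, b) \<in> jacobian_ideal f"
  unfolding Y_sum[OF G] sum_distrib_left
proof (rule S_ring_ideal_sum[OF ideal_jacobian])
  fix M assume M: "M \<in> G"
  have "lprod (Ar - {L, L'}) * lprod (Ar - {M}) \<in> jacobian_ideal f"
  proof (cases "M = L")
    case True
    then show ?thesis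
      using cofactor_in_jacobian[of L L'] L group_subset[OF G] by auto
  next
    case False
    then show ?thesis
      using M L group_subset[OF G] by (intro dvd_in_jacobian f_dvd_mult) auto
  qed
  then show "lprod (Ar - {L, L'}) * (Const (if b then s M else r M) * lprod (Ar - {M})) \<in> jacobian_ideal f"
    using S_ring_ideal_mult[OF ideal_jacobian] by (metis mult.left_commute)
qed

text \<open>In a suitable direction the derivative of \<open>f\<close> is \<open>Y (G, b)\<close>
  plus summands of lines outside \<open>G\<close>, which \<open>h G\<close> turns into multiples of
  \<open>f\<close>.\<close>

lemma h_mult_Y:
  assumes e: "(G, b) \<in> E"
  shows "h G * Y (G, b) \<in> jacobian_ideal f"
proof -
  have G: "G \<in> \<P>" using e \<D>_subset by (auto simp: E_def)
  have "\<exists>v. \<forall>L\<in>G. dot3 (c L) v = (if b then s L else r L)"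
  proof (cases "G \<in> \<D>")
    case True
    then have Ar: "e1 G \<in> Ar" "e2 G \<in> Ar" "e1 G \<noteq> e2 G"
      using e1[OF G] e2 group_subset[OF G] by auto
    obtain v1 v2 where v: "dot3 (c (e1 G)) v1 = 1" "dot3 (c (e2 G)) v1 = 0" "dot3 (c (e2 G)) v2 = 1" "dot3 (c (e1 G)) v2 = 0"
      using dual_vector2[OF not_proportional[OF Ar] c_nonzero[OF Ar(1)]]
        dual_vector2[OF not_proportional[OF Ar(2,1)] c_nonzero[OF Ar(2)]] Ar(3) by metis
    have "dot3 (c L) w = r L * dot3 (c (e1 G)) w + s L * dot3 (c (e2 G)) w" if "L \<in> G" for L w
      by (subst coords[OF G that]) (simp add: dot3_eq algebra_simps)
    then have "\<forall>L\<in>G. dot3 (c L) (if b then v2 else v1) = (if b then s L else r L)"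
      by (simp add: v)
    then show ?thesis by blast
  next
    case False
    then have "\<not> b" using e by (auto simp: E_def)
    moreover obtain v where "dot3 (c (e1 G)) v = 1"
      using dual_vector1[OF c_nonzero] e1[OF G] group_subset[OF G] by blast
    moreover have "L = e1 G" if "L \<in> G" for L
      using singleton[OF G False] that by blast
    ultimately show ?thesis
      using coords_e1(1)[OF G] by auto
  qed
  then obtain v where v: "\<And>L. L \<in> G \<Longrightarrow> dot3 (c L) v = (if b then s L else r L)" by blast
  have "h G * (\<Sum>L\<in>Ar. Const (dot3 (c L) v) * lprod (Ar - {L})) \<in> jacobian_ideal f"
    by (rule S_ring_ideal_mult[OF ideal_jacobian directional_in_jacobian])
  moreover have "(\<Sum>L\<in>Ar. Const (dot3 (c L) v) * lprod (Ar - {L})) =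
     (\<Sum>L\<in>Ar - G. Const (dot3 (c L) v) * lprod (Ar - {L})) + Y (G, b)"
    unfolding Y_sum[OF G] sum.subset_diff[OF group_subset[OF G] finite_Ar]
    by (intro arg_cong2[of _ _ _ _ "(+)"] sum.cong refl) (simp only: v)
  moreover have "h G * (\<Sum>L\<in>Ar - G. Const (dot3 (c L) v) * lprod (Ar - {L})) \<in> jacobian_ideal f"
    unfolding sum_distrib_left
  proof (intro S_ring_ideal_sum[OF ideal_jacobian] dvd_in_jacobian)
    fix L assume "L \<in> Ar - G"
    then have "f dvd h G * lprod (Ar - {L})"
      by (intro f_dvd_mult) auto
    then show "f dvd h G * (Const (dot3 (c L) v) * lprod (Ar - {L}))"
      by (subst mult.left_commute) (rule dvd_mult)
  qed
  ultimately show ?thesis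
    using S_ring_ideal_diff[OF ideal_jacobian] by (fastforce simp: distrib_left)
qed

text \<open>The annihilator of \<open>Y (G, b)\<close> modulo the Jacobian ideal contains \<open>lprod G\<close>, \<open>h G\<close> and the products of
  all but two lines, one inside and one outside of \<open>G\<close>. The only common zero of all these is the origin.\<close>

lemma variable_power_mult_Y:
  assumes e: "(G, b) \<in> E"
  shows "\<exists>n. variable i ^ n * Y (G, b) \<in> jacobian_ideal f"
proof -
  have G: "G \<in> \<P>" using e \<D>_subset by (auto simp: E_def)
  define \<AA> where "\<AA> = {p. p * Y (G, b) \<in> jacobian_ideal f}"
  have \<AA>: "ideal \<AA> S_ring"
    by (rule S_ring_idealI)
      (auto simp: \<AA>_def distrib_right mult.assoc S_ring_ideal_0[OF ideal_jacobian]
        intro: S_ring_ideal_add[OF ideal_jacobian] S_ring_ideal_mult[OF ideal_jacobian])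
  have g: "lprod G \<in> \<AA>"
  proof -
    have "f dvd lprod G * (h G * \<gamma> G b)"
      unfolding lprod_group[OF G] by (simp add: mult.assoc)
    then show ?thesis unfolding \<AA>_def Y_def using dvd_in_jacobian by simp
  qed
  have h: "h G \<in> \<AA>"
    unfolding \<AA>_def using h_mult_Y[OF e] by simp
  \<comment> \<open>Since \<open>h G\<close> lies in the ideal, it suffices to adjoin one line
    outside \<open>G\<close> at a time. The product \<open>lprod G\<close> then allows the same for
    a line of \<open>G\<close>, and the product of the remaining lines for a third line.\<close>
  have "\<exists>n. variable i ^ n \<in> plus_multiples \<AA> (l L')" if L': "L' \<in> Ar - G" for L'
  proof -
    let ?I = "plus_multiples \<AA> (l L')"
    have I: "ideal ?I S_ring" by (rule ideal_plus_multiples[OF \<AA>])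
    have "\<exists>n. variable i ^ n \<in> plus_multiples ?I (l L)" if L: "L \<in> G" for L
    proof -
      let ?K = "plus_multiples ?I (l L)"
      have K: "ideal ?K S_ring" by (rule ideal_plus_multiples[OF I])
      have "lprod (Ar - {L, L'}) \<in> \<AA>"
        unfolding \<AA>_def using cofactor_mult_Y[OF G L L'] by simp
      then have R: "lprod (Ar - {L, L'}) \<in> ?K"
        by (intro plus_multiples_superset)
      have "\<exists>n. variable i ^ n \<in> plus_multiples ?K (l M)" if M: "M \<in> Ar - {L, L'}" for M
      proof -
        \<comment> \<open>Three lines without a common point: their forms span all linear forms, so
          the variable itself is reached.\<close>
        obtain x y z where xyz: "(\<lambda>j. if j = i then 1 else 0) = (\<lambda>j. x * c L j + y * c L' j + z * c M j)"
          using cramer3[OF generic[OF G L L' M]] by blast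
        have "variable i = lin (\<lambda>j. if j = i then 1 else (0 :: 'k))"
          by (rule lin_unit[symmetric])
        also have "\<dots> = lin (\<lambda>j. x * c L j + y * c L' j + z * c M j)"
          by (rule arg_cong[OF xyz])
        also have "\<dots> = (l L * Const x + l L' * Const y) + l M * Const z"
          by (simp only: lin_add lin_scale mult.commute)
        also have "\<dots> \<in> plus_multiples ?K (l M)"
        proof -
          have "l L * Const x \<in> ?K" by (rule plus_multiples_generator[OF I])
          moreover have "l L' * Const y \<in> ?K"
            by (intro plus_multiples_superset plus_multiples_generator[OF \<AA>])
          ultimately have "l L * Const x + l L' * Const y \<in> ?K"
            by (rule S_ring_ideal_add[OF K])
          then show ?thesis unfolding plus_multiples_def[of ?K] by blast
        qed
        finally have "variable i ^ 1 \<in> plus_multiples ?K (l M)" by simp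
        then show ?thesis by blast
      qed
      then have "\<exists>n. variable i ^ n \<in> plus_multiples ?K (\<Prod>M\<in>Ar - {L, L'}. l M)"
        using finite_Ar by (intro power_in_plus_multiples_prod[OF K]) auto
      then show ?thesis
        using plus_multiples_eq[OF K R] by (simp add: lprod_def)
    qed
    then have "\<exists>n. variable i ^ n \<in> plus_multiples ?I (\<Prod>L\<in>G. l L)"
      by (intro power_in_plus_multiples_prod[OF I finite_group[OF G]])
    then show ?thesis
      using plus_multiples_eq[OF I plus_multiples_superset[OF g]] by (simp add: lprod_def)
  qed
  then have "\<exists>n. variable i ^ n \<in> plus_multiples \<AA> (\<Prod>L\<in>Ar - G. l L)"
    using finite_Ar by (intro power_in_plus_multiples_prod[OF \<AA>]) auto
  then have "\<exists>n. variable i ^ n \<in> \<AA>"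
    using plus_multiples_eq[OF \<AA> h] by (simp add: lprod_def)
  then show ?thesis unfolding \<AA>_def by simp
qed

lemma torsion_bound: "\<exists>k. \<forall>e\<in>E. \<forall>i. variable i ^ k * Y e \<in> jacobian_ideal f"
proof -
  have "\<forall>e\<in>E. \<forall>i. \<exists>n. variable i ^ n * Y e \<in> jacobian_ideal f"
    using variable_power_mult_Y by fastforce
  then obtain n where n: "\<And>e i. e \<in> E \<Longrightarrow> variable i ^ n e i * Y e \<in> jacobian_ideal f" by metis
  define k where "k = (\<Sum>(e, i)\<in>E \<times> UNIV. n e i)"
  have "n e i \<le> k" if "e \<in> E" for e i
    unfolding k_def using that finite_E member_le_sum[of "(e, i)" "E \<times> UNIV" "\<lambda>(e, i). n e i"] by simp
  then have "variable i ^ k * Y e \<in> jacobian_ideal f" if "e \<in> E" for e i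
    using power_in_ideal_mono[OF ideal_jacobian n] that by blast
  then show ?thesis by blast
qed

subsection \<open>The pairing of syzygies\<close>

text \<open>A syzygy of the gradient is a vector field that annihilates \<open>f\<close>. It is
  tangent to every line, because modulo \<open>l L\<close> only the summand of \<open>L\<close>
  survives in the derivative of \<open>f\<close>.\<close>

lemma syzygy_tangent:
  assumes \<theta>: "\<theta> \<in> carrier_vec 3" "gradient f \<bullet> \<theta> = 0" and L: "L \<in> Ar"
  shows "l L dvd Const (c L 0) * \<theta> $ 0 + Const (c L 1) * \<theta> $ 1 + Const (c L 2) * \<theta> $ 2"
proof -
  define \<tau> where "\<tau> = (\<lambda>L. Const (c L 0) * \<theta> $ 0 + Const (c L 1) * \<theta> $ 1 + Const (c L 2) * \<theta> $ 2)"
  have "gradient f \<bullet> \<theta> = (\<Sum>M\<in>Ar. lprod (Ar - {M}) * \<tau> M)"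
    unfolding scalar_prod_3[OF \<theta>(1)] gradient_index partial_deriv_f sum_distrib_right
      sum.distrib[symmetric] \<tau>_def by (intro sum.cong) (simp_all add: algebra_simps)
  also have "\<dots> = lprod (Ar - {L}) * \<tau> L + (\<Sum>M\<in>Ar - {L}. lprod (Ar - {M}) * \<tau> M)"
    by (rule sum.remove[OF finite_Ar L])
  finally have "lprod (Ar - {L}) * \<tau> L = - (\<Sum>M\<in>Ar - {L}. lprod (Ar - {M}) * \<tau> M)"
    using \<theta>(2) by (simp add: eq_neg_iff_add_eq_0)
  also have "l L dvd \<dots>"
    unfolding dvd_minus_iff
  proof (intro dvd_sum dvd_mult2)
    fix M assume "M \<in> Ar - {L}"
    then have "lprod (Ar - {M}) = l L * lprod (Ar - {M} - {L})"
      using L by (intro lprod_remove) auto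
    then show "l L dvd lprod (Ar - {M})" by simp
  qed
  finally have "l L dvd \<tau> L"
    using lin_dvd_mult[OF c_nonzero[OF L]] not_dvd_lprod[of "Ar - {L}" L] L by blast
  then show ?thesis by (simp add: \<tau>_def)
qed

text \<open>Both syzygies are orthogonal to the gradient, so their cross product is parallel to it;
  the point is that the factor is a polynomial. The determinant \<open>\<Delta>\<close> of the Euler
  field and the two syzygies is divisible by all lines, since the three fields are tangent to them,
  and Euler's relation compares the quotient by \<open>f\<close> with the factor.\<close>

lemma syzygy_pairing:
  assumes \<theta>: "\<theta> \<in> carrier_vec 3" "gradient f \<bullet> \<theta> = 0" and \<eta>: "\<eta> \<in> carrier_vec 3" "gradient f \<bullet> \<eta> = 0"
  shows "\<exists>a. cross_mat \<theta> *\<^sub>v \<eta> = a \<cdot>\<^sub>v gradient f"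
proof -
  define u where "u = cross_mat \<theta> *\<^sub>v \<eta>"
  have u: "u \<in> carrier_vec 3" using \<eta>(1) by (simp add: u_def)
  define x where "x = (\<lambda>i. variable i :: 'k poly3)"
  define \<Delta> where "\<Delta> = x 0 * u $ 0 + x 1 * u $ 1 + x 2 * u $ 2"
  have "f dvd \<Delta>"
  proof (rule lprod_dvd)
    fix L assume L: "L \<in> Ar"
    define C where "C = (\<lambda>i. Const (c L i))"
    define \<theta>L \<eta>L where "\<theta>L = C 0 * \<theta> $ 0 + C 1 * \<theta> $ 1 + C 2 * \<theta> $ 2"
      and "\<eta>L = C 0 * \<eta> $ 0 + C 1 * \<eta> $ 1 + C 2 * \<eta> $ 2"
    have l: "l L = C 0 * x 0 + C 1 * x 1 + C 2 * x 2"
      by (simp add: lin_def sum_UNIV_3 C_def x_def)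
    have dvd: "l L dvd \<theta>L" "l L dvd \<eta>L"
      using syzygy_tangent[OF \<theta> L] syzygy_tangent[OF \<eta> L] by (simp_all add: \<theta>L_def \<eta>L_def C_def)
    have u_index: "u $ 0 = \<theta> $ 1 * \<eta> $ 2 - \<theta> $ 2 * \<eta> $ 1" "u $ 1 = \<theta> $ 2 * \<eta> $ 0 - \<theta> $ 0 * \<eta> $ 2"
      "u $ 2 = \<theta> $ 0 * \<eta> $ 1 - \<theta> $ 1 * \<eta> $ 0"
      unfolding u_def using \<eta>(1) by (simp_all only: cross_mat_index)
    \<comment> \<open>Expansions of the determinant, where \<open>\<theta>L\<close>,
      \<open>\<eta>L\<close> and \<open>l L\<close> are the values of the linear form on the two
      syzygies and on the Euler field. One of the \<open>C i\<close> is a unit.\<close>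
    have "C 0 * \<Delta> = \<theta>L * (\<eta> $ 1 * x 2 - \<eta> $ 2 * x 1) + \<eta>L * (x 1 * \<theta> $ 2 - x 2 * \<theta> $ 1) + l L * u $ 0"
      "C 1 * \<Delta> = \<theta>L * (\<eta> $ 2 * x 0 - \<eta> $ 0 * x 2) + \<eta>L * (x 2 * \<theta> $ 0 - x 0 * \<theta> $ 2) + l L * u $ 1"
      "C 2 * \<Delta> = \<theta>L * (\<eta> $ 0 * x 1 - \<eta> $ 1 * x 0) + \<eta>L * (x 0 * \<theta> $ 1 - x 1 * \<theta> $ 0) + l L * u $ 2"
      unfolding \<Delta>_def \<theta>L_def \<eta>L_def l u_index by (simp_all add: algebra_simps)
    then have "\<forall>i. l L dvd C i * \<Delta>"
      unfolding forall_3 using dvd by simp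
    moreover obtain i where "c L i \<noteq> 0" using c_nonzero[OF L] by auto
    ultimately have "l L dvd Const (inverse (c L i)) * (C i * \<Delta>)" by (simp only: dvd_mult)
    also have "Const (inverse (c L i)) * (C i * \<Delta>) = \<Delta>"
      unfolding C_def mult.assoc[symmetric] Const_inverse_mult[OF \<open>c L i \<noteq> 0\<close>] by simp
    finally show "l L dvd \<Delta>" .
  qed simp
  then obtain b where b: "\<Delta> = f * b" by blast
  define F where "F = gradient f"
  have F: "F \<in> carrier_vec 3" by (simp add: F_def)
  have "cross_mat F *\<^sub>v u = 0\<^sub>v 3"
    unfolding u_def cross_cross[OF F \<theta>(1) \<eta>(1)] using \<theta> \<eta> by (auto simp: F_def intro!: eq_vecI)
  then have par: "F $ 1 * u $ 2 = F $ 2 * u $ 1" "F $ 2 * u $ 0 = F $ 0 * u $ 2" "F $ 0 * u $ 1 = F $ 1 * u $ 0"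
    using cross_mat_index[OF u, of F] by simp_all
  have euler: "x 0 * F $ 0 + x 1 * F $ 1 + x 2 * F $ 2 = of_nat (card Ar) * f"
    using euler_f unfolding F_def gradient_index x_def sum_UNIV_3 .
  define a where "a = Const (inverse (of_nat (card Ar))) * b"
  have key: "u $ i = a * F $ i" if i: "i < 3" for i
  proof -
    have "u $ i * (x 0 * F $ 0 + x 1 * F $ 1 + x 2 * F $ 2) = F $ i * \<Delta>"
    proof -
      have "u $ i * F $ j = F $ i * u $ j" if "j < 3" for j
        using i that par by (auto simp: less_3_iff mult.commute)
      then have "u $ i * F $ 0 = F $ i * u $ 0" "u $ i * F $ 1 = F $ i * u $ 1" "u $ i * F $ 2 = F $ i * u $ 2"
        by simp_all
      then have "x 0 * (u $ i * F $ 0) + x 1 * (u $ i * F $ 1) + x 2 * (u $ i * F $ 2) =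
         x 0 * (F $ i * u $ 0) + x 1 * (F $ i * u $ 1) + x 2 * (F $ i * u $ 2)" by simp
      then show ?thesis unfolding \<Delta>_def by (simp add: algebra_simps)
    qed
    then have "f * (of_nat (card Ar) * u $ i) = f * (F $ i * b)"
      unfolding euler b by (simp add: mult_ac)
    then have "of_nat (card Ar) * u $ i = F $ i * b"
      using lprod_nonzero[of Ar] by simp
    then have "Const (inverse (of_nat (card Ar))) * of_nat (card Ar) * u $ i = a * F $ i"
      unfolding a_def by (simp add: mult_ac)
    then show ?thesis unfolding inverse_card_Ar by simp
  qed
  have "u = a \<cdot>\<^sub>v F"
    using u F key by (intro eq_vecI) auto
  then show ?thesis unfolding u_def F_def by blast
qed

lemma gradient_nonzero: "gradient f \<noteq> 0\<^sub>v 3"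
proof
  assume "gradient f = 0\<^sub>v 3"
  then have "partial_deriv 0 f = 0" "partial_deriv 1 f = 0" "partial_deriv 2 f = 0"
    using gradient_index[of f] by simp_all
  then have "of_nat (card Ar) * f = 0"
    using euler_f by (simp add: sum_UNIV_3)
  then show False
    using lprod_nonzero[of Ar] card_Ar_pos by simp
qed

end

section \<open>From index sets to lists, vectors and matrices\<close>

lemma sum_nth_distinct:
  assumes "distinct xs"
  shows "(\<Sum>i\<in>{0..<length xs}. \<phi> (xs ! i)) = (\<Sum>x\<in>set xs. \<phi> x)"
  using sum.reindex_bij_betw[OF bij_betw_nth[OF assms refl refl], of \<phi>] by (simp add: atLeast0LessThan)

lemma function_of_vec:
  assumes "distinct xs"
  shows "\<exists>u. \<forall>i<length xs. u (xs ! i) = v $ i"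
proof -
  have "inj_on ((!) xs) {0..<length xs}"
    using assms by (simp add: inj_on_nth)
  then show ?thesis
    by (intro exI[of _ "\<lambda>x. v $ inv_into {0..<length xs} ((!) xs) x"]) simp
qed

context grouped_arrangement
begin

lemma rel_degree_nonzero: "j \<in> J \<Longrightarrow> rel_degree j \<noteq> 0"
proof -
  have "int (card H) - 1 \<noteq> 0" if H: "H \<in> \<D>" for H
  proof
    assume "int (card H) - 1 = 0"
    then have "card H = 1" by simp
    then obtain x where "H = {x}" by (rule card_1_singletonE)
    then show False using e1[of H] e2[OF H] H \<D>_subset by auto
  qed
  then show "j \<in> J \<Longrightarrow> rel_degree j \<noteq> 0"
    by (auto simp: rel_degree_def J_def)
qed

lemma free_resolution_generators:
  assumes es: "distinct es" "set es = E" and js: "distinct js" "set js = J"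
  defines "y \<equiv> vec (length es) (\<lambda>i. Y (es ! i))"
    and "A \<equiv> mat (length es) (length js) (\<lambda>(i, j). rel (es ! i) (js ! j))"
  shows "free_resolution_2 (length es) (length js) y A (int (card Ar) - 1) (\<lambda>j. rel_degree (js ! j))"
proof
  show "y \<in> carrier_vec (length es)" "A \<in> carrier_mat (length es) (length js)"
    by (simp_all add: y_def A_def)
  have in_E: "es ! i \<in> E" if "i < length es" for i using es(2) that nth_mem by blast
  have A_vec: "(A *\<^sub>v vec (length js) (\<lambda>j. z (js ! j))) $ i = (\<Sum>j\<in>J. rel (es ! i) j * z j)" if "i < length es" for z i
    using that sum_nth_distinct[OF js(1), of "\<lambda>j. rel (es ! i) j * z j"]
    by (simp add: A_def scalar_prod_def js(2))
  fix v :: "'k poly3 vec" assume v: "v \<in> carrier_vec (length es)"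
  obtain u where u: "\<And>i. i < length es \<Longrightarrow> u (es ! i) = v $ i"
    using function_of_vec[OF es(1), of v] by blast
  have "y \<bullet> v = (\<Sum>e\<in>E. u e * Y e)"
    using v sum_nth_distinct[OF es(1), of "\<lambda>e. u e * Y e"] by (simp add: y_def scalar_prod_def es(2) u mult.commute)
  then have "y \<bullet> v = 0 \<longleftrightarrow> (\<exists>z. \<forall>e\<in>E. u e = (\<Sum>j\<in>J. rel e j * z j))"
    by (simp add: rel_exact)
  also have "\<dots> \<longleftrightarrow> (\<exists>w\<in>carrier_vec (length js). v = A *\<^sub>v w)"
  proof
    assume "\<exists>z. \<forall>e\<in>E. u e = (\<Sum>j\<in>J. rel e j * z j)"
    then obtain z where z: "\<And>e. e \<in> E \<Longrightarrow> u e = (\<Sum>j\<in>J. rel e j * z j)" by blast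
    have "v = A *\<^sub>v vec (length js) (\<lambda>j. z (js ! j))"
    proof (rule eq_vecI)
      fix i assume "i < dim_vec (A *\<^sub>v vec (length js) (\<lambda>j. z (js ! j)))"
      then have i: "i < length es" by (simp add: A_def)
      show "v $ i = (A *\<^sub>v vec (length js) (\<lambda>j. z (js ! j))) $ i"
        unfolding A_vec[OF i] u[OF i, symmetric] by (rule z[OF in_E[OF i]])
    qed (use v in \<open>simp add: A_def\<close>)
    then show "\<exists>w\<in>carrier_vec (length js). v = A *\<^sub>v w"
      using vec_carrier by blast
  next
    assume "\<exists>w\<in>carrier_vec (length js). v = A *\<^sub>v w"
    then obtain w where w: "w \<in> carrier_vec (length js)" "v = A *\<^sub>v w" by blast
    obtain z where z: "\<And>j. j < length js \<Longrightarrow> z (js ! j) = w $ j"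
      using function_of_vec[OF js(1), of w] by blast
    have wz: "w = vec (length js) (\<lambda>j. z (js ! j))"
      using w(1) z by (intro eq_vecI) auto
    have "u e = (\<Sum>j\<in>J. rel e j * z j)" if e: "e \<in> E" for e
    proof -
      obtain i where i: "i < length es" "e = es ! i"
        using e es(2) by (metis in_set_conv_nth)
      show ?thesis
        unfolding i(2) u[OF i(1)] A_vec[OF i(1), symmetric] wz[symmetric] w(2) ..
    qed
    then show "\<exists>z. \<forall>e\<in>E. u e = (\<Sum>j\<in>J. rel e j * z j)" by blast
  qed
  finally show "y \<bullet> v = 0 \<longleftrightarrow> (\<exists>w\<in>carrier_vec (length js). v = A *\<^sub>v w)" .
next
  have in_J: "js ! j \<in> J" if "j < length js" for j using js(2) that nth_mem by blast
  fix w assume w: "w \<in> carrier_vec (length js)" "A *\<^sub>v w = 0\<^sub>v (length es)"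
  obtain z where z: "\<And>j. j < length js \<Longrightarrow> z (js ! j) = w $ j"
    using function_of_vec[OF js(1), of w] by blast
  have "(\<Sum>j\<in>J. rel e j * z j) = 0" if e: "e \<in> E" for e
  proof -
    obtain i where i: "i < length es" "e = es ! i"
      using e es(2) by (metis in_set_conv_nth)
    have "(\<Sum>j\<in>J. rel e j * z j) = (A *\<^sub>v w) $ i"
      using i w(1) sum_nth_distinct[OF js(1), of "\<lambda>j. rel e j * z j"]
      by (simp add: A_def scalar_prod_def js(2) z)
    then show ?thesis unfolding w(2) using i by simp
  qed
  then have "z (js ! j) = 0" if "j < length js" for j
    using rel_inj[of z "js ! j"] in_J[OF that] by blast
  then show "w = 0\<^sub>v (length js)"
    using w(1) z by (intro eq_vecI) auto
next
  fix e j
  show "homogeneous_of_degree (int (card Ar) - 1) (y $ e)" if "e < length es"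
    using homogeneous_Y[of "es ! e"] es(2) that nth_mem by (auto simp: y_def)
  show "homogeneous_of_degree (rel_degree (js ! j)) (A $$ (e, j))" if "e < length es" "j < length js"
    using homogeneous_rel[of "js ! j" "es ! e"] js(2) that nth_mem by (auto simp: A_def)
  show "rel_degree (js ! j) \<noteq> 0" if "j < length js"
    using rel_degree_nonzero js(2) that nth_mem by blast
qed

section \<open>Twists, and the cases of independent and of spanning coefficient vectors\<close>

lemma image_mset_rel_degree:
  "{# \<phi> (rel_degree j). j \<in># mset_set J #} =
     replicate_mset (card \<P> - 1) (\<phi> 1) + {# \<phi> (int (card H) - 1). H \<in># mset_set \<D> #}"
proof -
  have "mset_set J = image_mset Inl (mset_set (\<P> - {G\<^sub>0})) + image_mset Inr (mset_set \<D>)"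
    unfolding J_def using finite_\<P> by (subst mset_set_Union) (auto simp: image_mset_mset_set)
  moreover have "{# \<phi> 1. H \<in># mset_set (\<P> - {G\<^sub>0}) #} = replicate_mset (card \<P> - 1) (\<phi> 1)"
    using G0 by (simp add: image_mset_const_eq)
  ultimately show ?thesis
    by (simp add: rel_degree_def image_mset.compositionality comp_def)
qed

lemma mset_map_js: "distinct js \<Longrightarrow> set js = J \<Longrightarrow>
    mset (map (\<lambda>j. \<phi> (rel_degree (js ! j))) [0..<length js]) =
    replicate_mset (card \<P> - 1) (\<phi> 1) + {# \<phi> (int (card H) - 1). H \<in># mset_set \<D> #}"
proof -
  assume js: "distinct js" "set js = J"
  have "map (\<lambda>j. \<phi> (rel_degree (js ! j))) [0..<length js] = map (\<lambda>j. \<phi> (rel_degree j)) js"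
    by (intro nth_equalityI) auto
  then have "mset (map (\<lambda>j. \<phi> (rel_degree (js ! j))) [0..<length js]) = {# \<phi> (rel_degree j). j \<in># mset_set J #}"
    using mset_set_set[OF js(1)] js(2) by simp
  then show ?thesis unfolding image_mset_rel_degree .
qed

lemma length_es: "distinct es \<Longrightarrow> set es = E \<Longrightarrow> length es = card \<P> + card \<D>"
  using distinct_card card_E by metis

lemma gradient_generators:
  assumes es: "distinct es" "set es = E" and \<theta>: "\<theta> \<in> carrier_vec 3"
  shows "vec (length es) (\<lambda>i. Y (es ! i)) \<bullet>
      (mat (length es) 3 (\<lambda>(e, i). Const (ce (fst (es ! e)) (snd (es ! e)) (of_nat i))) *\<^sub>v \<theta>) = gradient f \<bullet> \<theta>"
proof -
  define \<phi> where "\<phi> = (\<lambda>e. Y e * (Const (ce (fst e) (snd e) 0) * \<theta> $ 0 +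
      Const (ce (fst e) (snd e) 1) * \<theta> $ 1 + Const (ce (fst e) (snd e) 2) * \<theta> $ 2))"
  have "vec (length es) (\<lambda>i. Y (es ! i)) \<bullet>
      (mat (length es) 3 (\<lambda>(e, i). Const (ce (fst (es ! e)) (snd (es ! e)) (of_nat i))) *\<^sub>v \<theta>)
    = (\<Sum>i\<in>{0..<length es}. \<phi> (es ! i))"
    by (simp add: scalar_prod_def[of "vec _ _"] scalar_prod_3[OF \<theta>] \<phi>_def)
  also have "\<dots> = (\<Sum>e\<in>E. \<phi> e)"
    by (simp only: sum_nth_distinct[OF es(1)] es(2))
  also have "\<dots> = gradient f \<bullet> \<theta>"
    unfolding scalar_prod_3[OF \<theta>] gradient_index partial_deriv_f_E
    by (simp add: \<phi>_def sum_distrib_left sum.distrib algebra_simps)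
  finally show ?thesis .
qed

text \<open>A vector dual to the coefficient vectors solves the linear system: differentiating
  \<open>f\<close> along it gives the single generator \<open>Y e\<close>. So the generators span
  the Jacobian ideal itself.\<close>

theorem independent_case:
  assumes dual: "\<And>e. e \<in> E \<Longrightarrow> \<exists>v. \<forall>e'\<in>E. dot3 (ce (fst e') (snd e')) v = (if e' = e then 1 else 0)"
  shows "free_arrangement_poly f"
    and "has_graded_minimal_free_resolution (ideal_module (jacobian_ideal f))
      [replicate_mset (card \<P> + card \<D>) (- int (card Ar) + 1),
       replicate_mset (card \<P> - 1) (- int (card Ar)) + {# - int (card Ar) + 2 - int (card H). H \<in># mset_set \<D> #}]"
proof -
  obtain es where es: "distinct es" "set es = E" using finite_distinct_list[OF finite_E] by blast
  obtain js where js: "distinct js" "set js = J" using finite_distinct_list[OF finite_J] by blast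
  define y where "y = vec (length es) (\<lambda>i. Y (es ! i))"
  interpret R: free_resolution_2 "length es" "length js" y
      "mat (length es) (length js) (\<lambda>(i, j). rel (es ! i) (js ! j))" "int (card Ar) - 1" "\<lambda>j. rel_degree (js ! j)"
    unfolding y_def by (rule free_resolution_generators[OF es js])
  have Y_in: "Y e \<in> jacobian_ideal f" if e: "e \<in> E" for e
  proof -
    obtain v where v: "\<And>e'. e' \<in> E \<Longrightarrow> dot3 (ce (fst e') (snd e')) v = (if e' = e then 1 else 0)"
      using dual[OF e] by blast
    have "(\<Sum>i\<in>UNIV. Const (v i) * partial_deriv i f) = (\<Sum>e'\<in>E. Const (dot3 (ce (fst e') (snd e')) v) * Y e')"
      unfolding partial_deriv_f_E sum_distrib_left
      by (subst sum.swap) (simp add: dot3_def Const_sum Const_mult sum_distrib_left sum_distrib_right mult_ac)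
    also have "\<dots> = (\<Sum>e'\<in>E. if e' = e then Y e' else 0)"
      using v by (intro sum.cong) auto
    also have "\<dots> = Y e" using e finite_E by simp
    finally show ?thesis unfolding jacobian_ideal_iff by (metis (no_types))
  qed
  have jac: "jacobian_ideal f = vec_ideal y"
  proof
    show "vec_ideal y \<subseteq> jacobian_ideal f"
    proof
      fix a assume "a \<in> vec_ideal y"
      then obtain v where "v \<in> carrier_vec (dim_vec y)" "a = y \<bullet> v" by (rule vec_idealE)
      then have "a = (\<Sum>i\<in>{0..<length es}. v $ i * Y (es ! i))"
        by (simp add: y_def scalar_prod_def mult.commute)
      then show "a \<in> jacobian_ideal f"
        using es(2) nth_mem by (auto intro!: S_ring_ideal_sum[OF ideal_jacobian] S_ring_ideal_mult[OF ideal_jacobian] Y_in)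
    qed
    show "jacobian_ideal f \<subseteq> vec_ideal y"
    proof
      fix a assume "a \<in> jacobian_ideal f"
      then obtain \<theta> where \<theta>: "\<theta> \<in> carrier_vec 3" "a = gradient f \<bullet> \<theta>"
        unfolding jacobian_eq_vec_ideal by (auto elim!: vec_idealE simp: gradient_def)
      then show "a \<in> vec_ideal y"
        unfolding \<theta>(2) gradient_generators[OF es \<theta>(1), symmetric] y_def
        by (intro vec_idealI carrier_vecI) simp
    qed
  qed
  show "free_arrangement_poly f"
    unfolding free_arrangement_poly_def jac R.saturated_vec_ideal ..
  have "mset (map (\<lambda>j. - (int (card Ar) - 1) - rel_degree (js ! j)) [0..<length js]) =
     replicate_mset (card \<P> - 1) (- int (card Ar)) + {# - int (card Ar) + 2 - int (card H). H \<in># mset_set \<D> #}"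
    unfolding mset_map_js[OF js, of "\<lambda>x. - (int (card Ar) - 1) - x"] by (simp add: algebra_simps)
  then show "has_graded_minimal_free_resolution (ideal_module (jacobian_ideal f))
      [replicate_mset (card \<P> + card \<D>) (- int (card Ar) + 1),
       replicate_mset (card \<P> - 1) (- int (card Ar)) + {# - int (card Ar) + 2 - int (card H). H \<in># mset_set \<D> #}]"
    using R.resolution_vec_ideal unfolding jac length_es[OF es] by (simp add: algebra_simps)
qed

text \<open>The three independent coefficient vectors are put first in the list, so that the
  gradient splits off. The bounds keep the degrees in \<open>R\<close> and those off the diagonal of
  \<open>\<Phi>\<close> away from 0, and leave at least one generator for the Milnor module.\<close>

theorem spanning_case:
  assumes ea: "ea \<in> E" "eb \<in> E" "ec \<in> E"
    and det: "det3 (ce (fst ea) (snd ea)) (ce (fst eb) (snd eb)) (ce (fst ec) (snd ec)) \<noteq> 0"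
    and card_4: "4 \<le> card Ar" and more: "3 < card \<P> + card \<D>"
    and small: "\<And>H. H \<in> \<D> \<Longrightarrow> card H + 2 \<le> card Ar"
  shows "\<not> free_arrangement_poly f"
    and "has_graded_minimal_free_resolution (milnor_module f)
      [replicate_mset (card \<P> + card \<D> - 3) (- int (card Ar) + 1),
       replicate_mset (card \<P> - 1) (- int (card Ar)) + {# - int (card Ar) + 2 - int (card H). H \<in># mset_set \<D> #},
       replicate_mset (card \<P> - 1) (- 2 * int (card Ar) + 3) + {# - 2 * int (card Ar) + 1 + int (card H). H \<in># mset_set \<D> #},
       replicate_mset (card \<P> + card \<D> - 3) (- 2 * int (card Ar) + 2)]"
    and "has_graded_minimal_free_resolution (ideal_module (jacobian_ideal f))
      [replicate_mset 3 (- int (card Ar) + 1),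
       replicate_mset (card \<P> - 1) (- 2 * int (card Ar) + 3) + {# - 2 * int (card Ar) + 1 + int (card H). H \<in># mset_set \<D> #},
       replicate_mset (card \<P> + card \<D> - 3) (- 2 * int (card Ar) + 2)]"
proof -
  have "ea \<noteq> eb" "ea \<noteq> ec" "eb \<noteq> ec"
    using det by (auto simp: det3_def algebra_simps)
  moreover obtain rest where rest: "distinct rest" "set rest = E - {ea, eb, ec}"
    using finite_distinct_list[of "E - {ea, eb, ec}"] finite_E by blast
  define es where "es = ea # eb # ec # rest"
  ultimately have es: "distinct es" "set es = E"
    using ea rest by (auto simp: es_def)
  obtain js where js: "distinct js" "set js = J" using finite_distinct_list[OF finite_J] by blast
  have len: "length es = length rest + 3" by (simp add: es_def)
  have len': "length rest = card \<P> + card \<D> - 3" using length_es[OF es] len by simp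
  define y where "y = vec (length es) (\<lambda>i. Y (es ! i))"
  define A where "A = mat (length es) (length js) (\<lambda>(i, j). rel (es ! i) (js ! j))"
  define \<Lambda> where "\<Lambda> = mat (length es) 3 (\<lambda>(e, i). Const (ce (fst (es ! e)) (snd (es ! e)) (of_nat i)))"
  have "det3 (ce (fst (es ! 0)) (snd (es ! 0))) (ce (fst (es ! 1)) (snd (es ! 1))) (ce (fst (es ! 2)) (snd (es ! 2))) \<noteq> 0"
  proof -
    have "es ! 0 = ea" "es ! 1 = eb" "es ! 2 = ec" by (simp_all add: es_def numeral_2_eq_2)
    then show ?thesis using det by (simp only:) simp
  qed
  then obtain L T P where LTP: "L \<in> carrier_mat 3 (length es)" "T \<in> carrier_mat (length es) (length rest)"
    "P \<in> carrier_mat (length rest) (length es)"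
    "L * \<Lambda> = 1\<^sub>m 3" "P * T = 1\<^sub>m (length rest)" "P * \<Lambda> = 0\<^sub>m (length rest) 3" "\<Lambda> * L + T * P = 1\<^sub>m (length es)"
    "\<forall>e<length es. \<forall>i<length rest. homogeneous_of_degree 0 (T $$ (e, i))"
    "\<forall>e<length rest. \<forall>i<length es. homogeneous_of_degree 0 (P $$ (e, i))"
    unfolding \<Lambda>_def len
    by (rule constant_splitting[of "\<lambda>e. ce (fst (es ! e)) (snd (es ! e))" "length rest"])
  obtain k where k: "\<And>e i. e \<in> E \<Longrightarrow> variable i ^ k * Y e \<in> jacobian_ideal f"
    using torsion_bound by blast
  interpret R: free_resolution_2 "length es" "length js" y A "int (card Ar) - 1" "\<lambda>j. rel_degree (js ! j)"
    unfolding y_def A_def by (rule free_resolution_generators[OF es js])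
  have in_J: "js ! j \<in> J" if "j < length js" for j using js(2) that nth_mem by blast
  interpret R: jacobian_presentation "length es" "length js" y A "int (card Ar) - 1" "\<lambda>j. rel_degree (js ! j)"
    "length rest" k "gradient f" \<Lambda> L T P
  proof
    show "gradient f \<in> carrier_vec 3" "\<Lambda> \<in> carrier_mat (length es) 3"
      by (simp_all add: \<Lambda>_def)
    show "y \<bullet> (\<Lambda> *\<^sub>v \<theta>) = gradient f \<bullet> \<theta>" if "\<theta> \<in> carrier_vec 3" for \<theta>
      unfolding y_def \<Lambda>_def by (rule gradient_generators[OF es that])
    show "\<exists>\<theta>\<in>carrier_vec 3. variable i ^ k * (y \<bullet> v) = gradient f \<bullet> \<theta>" if v: "v \<in> carrier_vec (length es)" for i v
    proof -
      have "variable i ^ k * (y \<bullet> v) = (\<Sum>j\<in>{0..<length es}. v $ j * (variable i ^ k * Y (es ! j)))"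
        using v by (simp add: y_def scalar_prod_def sum_distrib_left mult_ac)
      also have "\<dots> \<in> jacobian_ideal f"
        by (rule S_ring_ideal_sum[OF ideal_jacobian], rule S_ring_ideal_mult[OF ideal_jacobian], rule k)
          (use es(2) nth_mem in auto)
      finally show ?thesis
        unfolding jacobian_eq_vec_ideal by (auto elim!: vec_idealE simp: gradient_def)
    qed
    show "\<exists>a. cross_mat \<theta> *\<^sub>v \<eta> = a \<cdot>\<^sub>v gradient f"
      if "\<theta> \<in> carrier_vec 3" "\<eta> \<in> carrier_vec 3" "gradient f \<bullet> \<theta> = 0" "gradient f \<bullet> \<eta> = 0" for \<theta> \<eta>
      by (rule syzygy_pairing[OF that(1,3,2,4)])
    show "gradient f \<noteq> 0\<^sub>v 3" by (rule gradient_nonzero)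
    show "homogeneous_of_degree (int (card Ar) - 1) (gradient f $ i)" if "i < 3" for i
      using that homogeneous_partial_deriv[OF homogeneous_lprod[of Ar]] by (simp add: gradient_def)
    show "homogeneous_of_degree 0 (\<Lambda> $$ (e, i))" if "e < length es" "i < 3" for e i
      using that by (simp add: \<Lambda>_def homogeneous_Const)
    show "int (card Ar) - 1 - rel_degree (js ! j) \<noteq> 0" if "j < length js" for j
      using in_J[OF that] card_4 small by (fastforce simp: J_def rel_degree_def)
    \<comment> \<open>For d lines the degree is d - 3, d - 1 - \<open>card H\<close> or d + 1 -
      \<open>card H\<close> - \<open>card H'\<close>; the last one is positive because different
      pencils are disjoint.\<close>
    show "int (card Ar) - 1 - rel_degree (js ! i) - rel_degree (js ! j) \<noteq> 0"
      if ij: "i < length js" "j < length js" "i \<noteq> j" for i j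
    proof -
      have neq: "js ! i \<noteq> js ! j" using ij js(1) by (simp add: nth_eq_iff_index_eq)
      have "card H + card H' \<le> card Ar" if "H \<in> \<D>" "H' \<in> \<D>" "H \<noteq> H'" for H H'
      proof -
        have "H \<in> \<P>" "H' \<in> \<P>" using that \<D>_subset by auto
        then have "card (H \<union> H') = card H + card H'" "H \<union> H' \<subseteq> Ar"
          using disjoint[of H H'] that(3) finite_group group_subset by (auto intro!: card_Un_disjoint)
        then show ?thesis using card_mono[OF finite_Ar, of "H \<union> H'"] by simp
      qed
      then have "int (card H) + int (card H') \<le> int (card Ar)" if "H \<in> \<D>" "H' \<in> \<D>" "H \<noteq> H'" for H H'
        using that by (metis of_nat_add of_nat_le_iff)
      moreover have "int (card H) + 2 \<le> int (card Ar)" if "H \<in> \<D>" for H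
        using small[OF that] by linarith
      ultimately show ?thesis
        using in_J[OF ij(1)] in_J[OF ij(2)] neq card_4
        by (fastforce simp: J_def rel_degree_def)
    qed
  qed (use LTP in auto)
  show "\<not> free_arrangement_poly f"
    unfolding free_arrangement_poly_def jacobian_eq_vec_ideal R.saturation_jacobian
    by (rule R.vec_ideal_neq) (use more len' in simp)
  have m1: "mset (map (\<lambda>j. - (int (card Ar) - 1) - rel_degree (js ! j)) [0..<length js]) =
     replicate_mset (card \<P> - 1) (- int (card Ar)) + {# - int (card Ar) + 2 - int (card H). H \<in># mset_set \<D> #}"
    unfolding mset_map_js[OF js, of "\<lambda>x. - (int (card Ar) - 1) - x"] by (simp add: algebra_simps)
  have m2: "mset (map (\<lambda>j. - 2 * (int (card Ar) - 1) + rel_degree (js ! j)) [0..<length js]) =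
     replicate_mset (card \<P> - 1) (- 2 * int (card Ar) + 3) + {# - 2 * int (card Ar) + 1 + int (card H). H \<in># mset_set \<D> #}"
    unfolding mset_map_js[OF js, of "\<lambda>x. - 2 * (int (card Ar) - 1) + x"] by (simp add: algebra_simps)
  have m3: "- (int (card Ar) - 1) = - int (card Ar) + 1" "- 2 * (int (card Ar) - 1) = - 2 * int (card Ar) + 2"
    by simp_all
  show "has_graded_minimal_free_resolution (milnor_module f)
      [replicate_mset (card \<P> + card \<D> - 3) (- int (card Ar) + 1),
       replicate_mset (card \<P> - 1) (- int (card Ar)) + {# - int (card Ar) + 2 - int (card H). H \<in># mset_set \<D> #},
       replicate_mset (card \<P> - 1) (- 2 * int (card Ar) + 3) + {# - 2 * int (card Ar) + 1 + int (card H). H \<in># mset_set \<D> #},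
       replicate_mset (card \<P> + card \<D> - 3) (- 2 * int (card Ar) + 2)]"
    unfolding milnor_module_def jacobian_eq_vec_ideal R.saturation_jacobian
    using R.resolution_quotient unfolding m1 m2 unfolding m3 len' .
  show "has_graded_minimal_free_resolution (ideal_module (jacobian_ideal f))
      [replicate_mset 3 (- int (card Ar) + 1),
       replicate_mset (card \<P> - 1) (- 2 * int (card Ar) + 3) + {# - 2 * int (card Ar) + 1 + int (card H). H \<in># mset_set \<D> #},
       replicate_mset (card \<P> + card \<D> - 3) (- 2 * int (card Ar) + 2)]"
    unfolding jacobian_eq_vec_ideal
    using R.resolution_jacobian unfolding m2 unfolding m3 len' .
qed

end

section \<open>Orthogonal vectors\<close>

lemma orthogonal_vector:
  obtains v where "v \<noteq> (\<lambda>_. 0 :: 'k::field)" "dot3 a v = 0"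
proof (cases "a 0 = 0 \<and> a 1 = 0")
  case True
  then have "(\<lambda>i :: 3. if i = 0 then 1 else 0 :: 'k) \<noteq> (\<lambda>_. 0)" "dot3 a (\<lambda>i. if i = 0 then 1 else 0) = 0"
    by (auto simp: fun_eq_iff dot3_eq)
  then show ?thesis by (rule that)
next
  case False
  then have "(\<lambda>i :: 3. if i = 0 then a 1 else if i = 1 then - a 0 else 0) \<noteq> (\<lambda>_. 0)"
    "dot3 a (\<lambda>i. if i = 0 then a 1 else if i = 1 then - a 0 else 0) = 0"
    by (auto simp: fun_eq_3_iff dot3_eq)
  then show ?thesis by (rule that)
qed

lemma dot3_cross3_left: "dot3 a (cross3 a b) = 0" "dot3 b (cross3 a b) = 0"
  by (simp_all add: dot3_eq algebra_simps)

lemma orthogonal_vector2: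
  obtains v where "v \<noteq> (\<lambda>_. 0 :: 'k::field)" "dot3 a v = 0" "dot3 b v = 0"
proof (cases "cross3 a b = (\<lambda>_. 0)")
  case False
  then show ?thesis using that dot3_cross3_left by blast
next
  case True
  show ?thesis
  proof (cases "a = (\<lambda>_. 0)")
    case True
    obtain v where "v \<noteq> (\<lambda>_. 0 :: 'k)" "dot3 b v = 0" by (rule orthogonal_vector)
    then show ?thesis using that True by (simp add: dot3_eq)
  next
    case False
    then obtain x where x: "b = (\<lambda>i. x * a i)" using cross3_eq_0[OF True] by blast
    obtain v where v: "v \<noteq> (\<lambda>_. 0 :: 'k)" "dot3 a v = 0" by (rule orthogonal_vector)
    then have "dot3 b v = 0"
      unfolding x using dot3_scale_right[of v x a] by (simp add: dot3_commute)
    then show ?thesis using that v by blast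
  qed
qed

lemma cross3_nonzero:
  "a \<noteq> (\<lambda>_. 0 :: 'k::field) \<Longrightarrow> (\<And>x. b \<noteq> (\<lambda>i. x * a i)) \<Longrightarrow> cross3 a b \<noteq> (\<lambda>_. 0)"
  using cross3_eq_0 by blast

lemma span2:
  assumes "cross3 a b \<noteq> (\<lambda>_. 0 :: 'k::field)" "dot3 u (cross3 a b) = 0"
  shows "\<exists>x y. u = (\<lambda>i. x * a i + y * b i)"
proof -
  obtain w where w: "dot3 (cross3 a b) w = 1"
    using dual_vector1[OF assms(1)] by blast
  then have "det3 a b w \<noteq> 0"
    by (simp add: dot3_eq det3_def algebra_simps)
  then obtain x y z where xyz: "u = (\<lambda>i. x * a i + y * b i + z * w i)"
    using cramer3 by blast
  have "dot3 u (cross3 a b) = x * dot3 a (cross3 a b) + y * dot3 b (cross3 a b) + z * dot3 w (cross3 a b)"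
    unfolding xyz dot3_eq by (simp add: algebra_simps)
  then have "z = 0"
    using assms(2) w by (simp add: dot3_cross3_left dot3_commute)
  then show ?thesis using xyz by auto
qed

lemma orthogonal_to_both:
  assumes "dot3 a v = 0" "dot3 b v = (0 :: 'k::field)" "cross3 a b \<noteq> (\<lambda>_. 0)"
  shows "\<exists>x. v = (\<lambda>i. x * cross3 a b i)"
proof (rule cross3_eq_0[OF _ assms(3)])
  have "cross3 (cross3 a b) v = (\<lambda>i. dot3 a v * b i - dot3 b v * a i)"
    unfolding fun_eq_3_iff by (simp add: dot3_eq algebra_simps)
  then show "cross3 (cross3 a b) v = (\<lambda>_. 0)"
    using assms(1,2) by simp
qed

section \<open>Independent lines among those that span the groups\<close>

context grouped_arrangement
begin

abbreviation line_of :: "'l set \<times> bool \<Rightarrow> 'l" where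
  "line_of e \<equiv> if snd e then e2 (fst e) else e1 (fst e)"

lemma line_of_in: "e \<in> E \<Longrightarrow> line_of e \<in> fst e" "e \<in> E \<Longrightarrow> fst e \<in> \<P>" "e \<in> E \<Longrightarrow> line_of e \<in> Ar"
proof -
  assume "e \<in> E"
  then show "line_of e \<in> fst e" "fst e \<in> \<P>"
    using e1 e2 \<D>_subset by (auto simp: E_def)
  then show "line_of e \<in> Ar" using group_subset by blast
qed

lemma line_of_inj: "e \<in> E \<Longrightarrow> e' \<in> E \<Longrightarrow> line_of e = line_of e' \<Longrightarrow> e = e'"
proof -
  assume e: "e \<in> E" "e' \<in> E" "line_of e = line_of e'"
  have "line_of e \<in> fst e \<inter> fst e'"
    using line_of_in(1)[OF e(1)] line_of_in(1)[OF e(2)] e(3) by (metis IntI)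
  then have "fst e = fst e'"
    using disjoint[OF line_of_in(2)[OF e(1)] line_of_in(2)[OF e(2)]] by (metis empty_iff)
  moreover from this have "snd e = snd e'"
    using e e2(2)[of "fst e"] by (auto simp: E_def split: if_splits)
  ultimately show "e = e'" by (simp add: prod_eq_iff)
qed

lemma independent_at_most_two:
  assumes "card E \<le> 2" "e \<in> E"
  shows "\<exists>v. \<forall>e'\<in>E. dot3 (ce (fst e') (snd e')) v = (if e' = e then 1 else 0)"
proof (cases "E = {e}")
  case True
  have "\<exists>v. dot3 (c (line_of e)) v = 1"
    using dual_vector1 c_nonzero line_of_in(3)[OF assms(2)] by blast
  then show ?thesis using True by auto
next
  case False
  then obtain b where b: "b \<in> E" "b \<noteq> e" using assms(2) by blast
  have "card {e, b} = 2" using b by simp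
  then have E: "E = {e, b}"
    using assms b finite_E by (metis card_seteq empty_subsetI insert_subset)
  have "line_of b \<noteq> line_of e" using line_of_inj b assms(2) by blast
  then have "\<exists>v. dot3 (c (line_of e)) v = 1 \<and> dot3 (c (line_of b)) v = 0"
    using line_of_in(3)[OF assms(2)] line_of_in(3)[OF b(1)]
    by (intro dual_vector2 not_proportional c_nonzero) auto
  then show ?thesis
    using E b by auto
qed

lemma independent_three:
  assumes "card E = 3" and abc: "e\<^sub>0 \<in> E" "e\<^sub>1 \<in> E" "e\<^sub>2 \<in> E"
    "det3 (c (line_of e\<^sub>0)) (c (line_of e\<^sub>1)) (c (line_of e\<^sub>2)) \<noteq> 0" and "e \<in> E"
  shows "\<exists>v. \<forall>e'\<in>E. dot3 (ce (fst e') (snd e')) v = (if e' = e then 1 else 0)"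
proof -
  have distinct: "e\<^sub>0 \<noteq> e\<^sub>1" "e\<^sub>0 \<noteq> e\<^sub>2" "e\<^sub>1 \<noteq> e\<^sub>2"
    using abc(4) by (auto simp: det3_def algebra_simps)
  then have "card {e\<^sub>0, e\<^sub>1, e\<^sub>2} = 3" by simp
  then have E: "E = {e\<^sub>0, e\<^sub>1, e\<^sub>2}"
    using assms(1) abc finite_E by (metis card_subset_eq empty_subsetI insert_subset)
  define es where "es = (\<lambda>k :: nat. if k = 0 then e\<^sub>0 else if k = 1 then e\<^sub>1 else e\<^sub>2)"
  have es_idx: "es 0 = e\<^sub>0" "es 1 = e\<^sub>1" "es 2 = e\<^sub>2" by (simp_all add: es_def)
  have "det3 (c (line_of (es 0))) (c (line_of (es 1))) (c (line_of (es 2))) \<noteq> 0"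
    unfolding es_idx by (rule abc(4))
  then obtain v where v: "\<And>j k. j < 3 \<Longrightarrow> k < 3 \<Longrightarrow> dot3 (c (line_of (es j))) (v k) = (if j = k then 1 else 0)"
    by (rule dual_basis3[of "\<lambda>k. c (line_of (es k))"]) metis
  have v0: "dot3 (c (line_of e\<^sub>0)) (v k) = (if 0 = k then 1 else 0)"
    and v1: "dot3 (c (line_of e\<^sub>1)) (v k) = (if 1 = k then 1 else 0)"
    and v2: "dot3 (c (line_of e\<^sub>2)) (v k) = (if 2 = k then 1 else 0)" if "k < 3" for k
    using v[OF _ that, of 0] v[OF _ that, of 1] v[OF _ that, of 2] unfolding es_idx by simp_all
  from assms(6) E consider "e = e\<^sub>0" | "e = e\<^sub>1" | "e = e\<^sub>2" by blast
  then show ?thesis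
  proof cases
    case 1
    then show ?thesis unfolding E using distinct v0[of 0] v1[of 0] v2[of 0] by (intro exI[of _ "v 0"]) auto
  next
    case 2
    then show ?thesis unfolding E using distinct v0[of 1] v1[of 1] v2[of 1] by (intro exI[of _ "v 1"]) auto
  next
    case 3
    then show ?thesis unfolding E using distinct v0[of 2] v1[of 2] v2[of 2] by (intro exI[of _ "v 2"]) auto
  qed
qed

text \<open>The lines indexed by \<open>E\<close> span all coefficient vectors, so one of them
  avoids any given point. Choosing greedily, each new line avoids a point of the previous ones, at
  last the one given by the cross product.\<close>

lemma spanning_lines:
  assumes "\<And>v. v \<noteq> (\<lambda>_. 0) \<Longrightarrow> \<exists>L\<in>Ar. dot3 (c L) v \<noteq> 0"
  obtains e\<^sub>0 e\<^sub>1 e\<^sub>2 where "e\<^sub>0 \<in> E" "e\<^sub>1 \<in> E" "e\<^sub>2 \<in> E"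
    "det3 (c (line_of e\<^sub>0)) (c (line_of e\<^sub>1)) (c (line_of e\<^sub>2)) \<noteq> 0"
proof -
  have ex: "\<exists>e\<in>E. dot3 (c (line_of e)) v \<noteq> 0" if v: "v \<noteq> (\<lambda>_. 0)" for v
  proof -
    obtain L where L: "L \<in> Ar" "dot3 (c L) v \<noteq> 0" using assms[OF v] by blast
    obtain G where G: "G \<in> \<P>" "L \<in> G" using L(1) Union_\<P> by blast
    have "dot3 (c L) v = r L * dot3 (c (e1 G)) v + s L * dot3 (c (e2 G)) v"
      by (subst coords[OF G]) (simp add: dot3_eq algebra_simps)
    then consider "dot3 (c (e1 G)) v \<noteq> 0" | "s L \<noteq> 0" "dot3 (c (e2 G)) v \<noteq> 0"
      using L(2) by fastforce
    then show ?thesis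
    proof cases
      case 1
      then show ?thesis using G by (intro bexI[of _ "(G, False)"]) (auto simp: E_def)
    next
      case 2
      then have "G \<in> \<D>" using coords_singleton[OF G(1) _ G(2)] by blast
      then show ?thesis using 2 by (intro bexI[of _ "(G, True)"]) (auto simp: E_def)
    qed
  qed
  obtain a where a: "a \<in> E" using G0 by (auto simp: E_def)
  obtain v where v: "v \<noteq> (\<lambda>_. 0)" "dot3 (c (line_of a)) v = 0" by (rule orthogonal_vector)
  obtain b where b: "b \<in> E" "dot3 (c (line_of b)) v \<noteq> 0" using ex[OF v(1)] by blast
  have "c (line_of b) \<noteq> (\<lambda>i. x * c (line_of a) i)" for x
  proof
    assume *: "c (line_of b) = (\<lambda>i. x * c (line_of a) i)"
    have "dot3 (c (line_of b)) v = x * dot3 (c (line_of a)) v"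
      unfolding * by (simp add: dot3_eq algebra_simps)
    then show False using b(2) v(2) by simp
  qed
  then have "cross3 (c (line_of a)) (c (line_of b)) \<noteq> (\<lambda>_. 0)"
    using c_nonzero[OF line_of_in(3)[OF a]] by (rule cross3_nonzero[rotated])
  then obtain e where e: "e \<in> E" "dot3 (c (line_of e)) (cross3 (c (line_of a)) (c (line_of b))) \<noteq> 0"
    using ex by blast
  then show ?thesis
    using that[of e a b] a b unfolding dot3_cross3 by blast
qed

end

section \<open>Points and lines of the projective plane\<close>

definition proj_point :: "(3 \<Rightarrow> 'k::field) \<Rightarrow> (3 \<Rightarrow> 'k) set" where
  "proj_point v = proj_rel `` {v}"

lemma proj_point_in_plane: "v \<noteq> (\<lambda>_. 0) \<Longrightarrow> proj_point v \<in> proj_plane"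
  unfolding proj_point_def proj_plane_def by (rule quotientI) simp

lemma proj_plane_cases:
  assumes "P \<in> proj_plane"
  obtains v where "v \<noteq> (\<lambda>_. 0)" "P = proj_point v"
  using assms unfolding proj_plane_def proj_point_def by (auto elim!: quotientE)

lemma mem_proj_point: "v \<noteq> (\<lambda>_. 0) \<Longrightarrow> x \<in> proj_point v \<longleftrightarrow> (\<exists>a. a \<noteq> 0 \<and> x = (\<lambda>i. a * v i))"
  by (auto simp: proj_point_def proj_rel_def)

lemma proj_point_scale:
  assumes "v \<noteq> (\<lambda>_. 0 :: 'k::field)" "a \<noteq> 0"
  shows "proj_point (\<lambda>i. a * v i) = proj_point v"
proof -
  have av: "(\<lambda>i. a * v i) \<noteq> (\<lambda>_. 0)" using assms by (auto simp: fun_eq_iff)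
  have "x \<in> proj_point (\<lambda>i. a * v i) \<longleftrightarrow> x \<in> proj_point v" for x
  proof
    assume "x \<in> proj_point (\<lambda>i. a * v i)"
    then obtain b where "b \<noteq> 0" "x = (\<lambda>i. b * (a * v i))" unfolding mem_proj_point[OF av] by blast
    then show "x \<in> proj_point v"
      unfolding mem_proj_point[OF assms(1)] using assms(2) by (intro exI[of _ "b * a"]) (simp add: mult.assoc)
  next
    assume "x \<in> proj_point v"
    then obtain b where "b \<noteq> 0" "x = (\<lambda>i. b * v i)" unfolding mem_proj_point[OF assms(1)] by blast
    then show "x \<in> proj_point (\<lambda>i. a * v i)"
      unfolding mem_proj_point[OF av] using assms(2) by (intro exI[of _ "b / a"]) simp
  qed
  then show ?thesis by blast
qed

lemma proj_point_in_zero_locus: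
  assumes "v \<noteq> (\<lambda>_. 0)"
  shows "proj_point v \<in> zero_locus (lin a) \<longleftrightarrow> dot3 a v = 0"
proof -
  have eval: "poly_eval (lin a) x = dot3 a x" for x
    by (simp add: poly_eval_lin dot3_def)
  have "(\<forall>x\<in>proj_point v. dot3 a x = 0) \<longleftrightarrow> dot3 a v = 0"
  proof
    assume "\<forall>x\<in>proj_point v. dot3 a x = 0"
    moreover have "v \<in> proj_point v" unfolding mem_proj_point[OF assms] by (intro exI[of _ 1]) simp
    ultimately show "dot3 a v = 0" by blast
  next
    assume "dot3 a v = 0"
    then show "\<forall>x\<in>proj_point v. dot3 a x = 0"
      using mem_proj_point[OF assms] by (auto simp: dot3_scale_right)
  qed
  then show ?thesis
    using proj_point_in_plane[OF assms] by (simp add: zero_locus_def eval)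
qed

lemma zero_locus_eqI:
  assumes "\<And>v. v \<noteq> (\<lambda>_. 0) \<Longrightarrow> dot3 a v = 0 \<longleftrightarrow> dot3 b v = 0"
  shows "zero_locus (lin a) = zero_locus (lin b)"
proof -
  have "P \<in> zero_locus (lin a) \<longleftrightarrow> P \<in> zero_locus (lin b)" if "P \<in> proj_plane" for P
    using that assms by (metis proj_plane_cases proj_point_in_zero_locus)
  then show ?thesis unfolding zero_locus_def by blast
qed

section \<open>Arrangements whose lines contain at most one multiple point\<close>

locale sparse_arrangement =
  fixes A :: "(3 \<Rightarrow> 'k::field_char_0) set set set" and c :: "(3 \<Rightarrow> 'k) set set \<Rightarrow> 3 \<Rightarrow> 'k"
  assumes finite_A: "finite A"
    and c_nonzero: "\<And>L. L \<in> A \<Longrightarrow> c L \<noteq> (\<lambda>_. 0)"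
    and c_line: "\<And>L. L \<in> A \<Longrightarrow> L = zero_locus (lin (c L))"
    and sparse: "\<And>L P Q. L \<in> A \<Longrightarrow> P \<in> multiple_points A \<Longrightarrow> Q \<in> multiple_points A \<Longrightarrow> P \<in> L \<Longrightarrow> Q \<in> L \<Longrightarrow> P = Q"
begin

abbreviation "S\<^sub>0 \<equiv> multiple_points A"

definition through :: "(3 \<Rightarrow> 'k) set \<Rightarrow> (3 \<Rightarrow> 'k) set set set" where
  "through P = {L \<in> A. P \<in> L}"

definition simple_lines :: "(3 \<Rightarrow> 'k) set set set" where
  "simple_lines = {L \<in> A. \<forall>P\<in>S\<^sub>0. P \<notin> L}"

lemma incidence: "L \<in> A \<Longrightarrow> v \<noteq> (\<lambda>_. 0) \<Longrightarrow> proj_point v \<in> L \<longleftrightarrow> dot3 (c L) v = 0"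
  using c_line proj_point_in_zero_locus by metis

lemma not_proportional:
  assumes "L \<in> A" "L' \<in> A" "L \<noteq> L'"
  shows "c L' \<noteq> (\<lambda>i. x * c L i)"
proof
  assume *: "c L' = (\<lambda>i. x * c L i)"
  then have "x \<noteq> 0" using c_nonzero[OF assms(2)] by auto
  moreover have "dot3 (c L') v = x * dot3 (c L) v" for v
    unfolding * by (simp add: dot3_eq algebra_simps)
  ultimately have "zero_locus (lin (c L)) = zero_locus (lin (c L'))"
    by (intro zero_locus_eqI) simp
  then show False using c_line assms by metis
qed

lemma cross_nonzero: "L \<in> A \<Longrightarrow> L' \<in> A \<Longrightarrow> L \<noteq> L' \<Longrightarrow> cross3 (c L) (c L') \<noteq> (\<lambda>_. 0)"
  by (intro cross3_nonzero c_nonzero not_proportional)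

lemma common_point:
  assumes "L \<in> A" "L' \<in> A"
  obtains P where "P \<in> proj_plane" "P \<in> L" "P \<in> L'"
proof -
  obtain v where "v \<noteq> (\<lambda>_. 0)" "dot3 (c L) v = 0" "dot3 (c L') v = 0" by (rule orthogonal_vector2)
  then show ?thesis
    using that[of "proj_point v"] incidence assms proj_point_in_plane by blast
qed

lemma unique_point:
  assumes L: "L \<in> A" "L' \<in> A" "L \<noteq> L'" and P: "P \<in> proj_plane" "P \<in> L" "P \<in> L'"
    and Q: "Q \<in> proj_plane" "Q \<in> L" "Q \<in> L'"
  shows "P = Q"
proof -
  have *: "R = proj_point (cross3 (c L) (c L'))" if R: "R \<in> proj_plane" "R \<in> L" "R \<in> L'" for R
  proof -
    obtain v where v: "v \<noteq> (\<lambda>_. 0)" "R = proj_point v" by (rule proj_plane_cases[OF R(1)])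
    obtain x where x: "v = (\<lambda>i. x * cross3 (c L) (c L') i)"
      using orthogonal_to_both[of "c L" v "c L'"] incidence L R v cross_nonzero[OF L] by blast
    then have "x \<noteq> 0" using v(1) by auto
    then show ?thesis
      unfolding v(2) x by (rule proj_point_scale[OF cross_nonzero[OF L]])
  qed
  show ?thesis using *[OF P] *[OF Q] by simp
qed

lemma multiplicity_eq: "point_multiplicity A P = card (through P)"
  by (simp add: point_multiplicity_def through_def)

lemma finite_through: "finite (through P)"
  using finite_A by (simp add: through_def)

lemma mem_S0: "P \<in> S\<^sub>0 \<longleftrightarrow> P \<in> proj_plane \<and> 3 \<le> card (through P)"
  by (simp add: multiple_points_def multiplicity_eq)

lemma through_nonempty: "P \<in> S\<^sub>0 \<Longrightarrow> through P \<noteq> {}"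
  unfolding mem_S0 by auto

text \<open>By sparsity a multiple point is determined by any single line through it.\<close>

lemma through_inj: "inj_on through S\<^sub>0"
proof (rule inj_onI)
  fix P Q assume PQ: "P \<in> S\<^sub>0" "Q \<in> S\<^sub>0" "through P = through Q"
  obtain L where L: "L \<in> through P" using through_nonempty[OF PQ(1)] by blast
  then have "L \<in> A" "P \<in> L" "Q \<in> L" using PQ(3) unfolding through_def by blast+
  then show "P = Q" using sparse PQ by blast
qed

lemma finite_S0: "finite S\<^sub>0"
  using finite_A through_inj by (intro finite_imageD[of through]) (auto intro: finite_subset[of _ "Pow A"] simp: through_def)

definition \<D> :: "(3 \<Rightarrow> 'k) set set set set" where "\<D> = through ` S\<^sub>0"

definition \<P> :: "(3 \<Rightarrow> 'k) set set set set" where "\<P> = \<D> \<union> (\<lambda>L. {L}) ` simple_lines"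

lemma \<D>_card: "G \<in> \<D> \<Longrightarrow> 3 \<le> card G"
  by (auto simp: \<D>_def mem_S0)

lemma card_\<D>: "card \<D> = card S\<^sub>0"
  unfolding \<D>_def by (rule card_image[OF through_inj])

lemma card_\<P>: "card \<P> = card S\<^sub>0 + card simple_lines"
proof -
  have "\<D> \<inter> (\<lambda>L. {L}) ` simple_lines = {}"
    using \<D>_card by fastforce
  moreover have "card ((\<lambda>L. {L}) ` simple_lines) = card simple_lines"
    by (rule card_image) (simp add: inj_on_def)
  moreover have "finite \<D>" "finite ((\<lambda>L. {L}) ` simple_lines)"
    using finite_S0 finite_A by (simp_all add: \<D>_def simple_lines_def)
  ultimately show ?thesis
    unfolding \<P>_def by (simp add: card_Un_disjoint card_\<D>)
qed

lemma image_mset_\<D>: "{# g (card H). H \<in># mset_set \<D> #} = {# g (point_multiplicity A P). P \<in># mset_set S\<^sub>0 #}"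
  unfolding \<D>_def image_mset_mset_set[OF through_inj, symmetric]
  by (simp add: multiplicity_eq image_mset.compositionality comp_def)

lemma \<P>_disjoint:
  assumes "G \<in> \<P>" "H \<in> \<P>" "L \<in> G" "L \<in> H"
  shows "G = H"
proof -
  have L: "L \<in> A" using assms by (auto simp: \<P>_def \<D>_def through_def simple_lines_def)
  show ?thesis
    using assms L sparse unfolding \<P>_def \<D>_def through_def simple_lines_def by fastforce
qed

lemma grouping:
  assumes "A \<noteq> {}"
  obtains e1 e2 r s G\<^sub>0 where "grouped_arrangement A c \<P> \<D> e1 e2 r s G\<^sub>0"
proof -
  have "\<exists>a b. a \<in> G \<and> (G \<in> \<D> \<longrightarrow> b \<in> G \<and> a \<noteq> b)" if "G \<in> \<P>" for G
  proof (cases "G \<in> \<D>")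
    case True
    then have "\<not> card G \<le> 1" using \<D>_card[of G] by simp
    moreover have "finite G" using True finite_through by (auto simp: \<D>_def)
    ultimately show ?thesis by (metis card_le_Suc0_iff_eq One_nat_def)
  next
    case False
    then show ?thesis using that by (auto simp: \<P>_def)
  qed
  then obtain e1 e2 where e: "\<And>G. G \<in> \<P> \<Longrightarrow> e1 G \<in> G" "\<And>G. G \<in> \<P> \<Longrightarrow> G \<in> \<D> \<Longrightarrow> e2 G \<in> G \<and> e1 G \<noteq> e2 G"
    by metis
  have \<P>_A: "\<Union>\<P> = A"
    by (auto simp: \<P>_def \<D>_def through_def simple_lines_def)
  \<comment> \<open>The quantifier over groups lets the coordinates be chosen as functions of the
    line alone; every line lies in exactly one group.\<close>
  define coordinates where "coordinates = (\<lambda>L x y. \<forall>G\<in>\<P>. L \<in> G \<longrightarrow>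
      c L = (\<lambda>i. x * c (e1 G) i + y * c (e2 G) i) \<and> (G \<notin> \<D> \<longrightarrow> y = 0)
      \<and> (L = e1 G \<longrightarrow> x = 1 \<and> y = 0) \<and> (G \<in> \<D> \<and> L = e2 G \<longrightarrow> x = 0 \<and> y = 1))"
  have "\<exists>x y. coordinates L x y" if L: "L \<in> A" for L
  proof -
    obtain G where G: "G \<in> \<P>" "L \<in> G" using L \<P>_A by blast
    have unique: "H = G" if "H \<in> \<P>" "L \<in> H" for H using \<P>_disjoint that G by blast
    have "\<exists>x y. c L = (\<lambda>i. x * c (e1 G) i + y * c (e2 G) i) \<and> (G \<notin> \<D> \<longrightarrow> y = 0)
      \<and> (L = e1 G \<longrightarrow> x = 1 \<and> y = 0) \<and> (G \<in> \<D> \<and> L = e2 G \<longrightarrow> x = 0 \<and> y = 1)"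
    proof (cases "L = e1 G")
      case True
      then show ?thesis using e(2)[OF G(1)] by (intro exI[of _ 1] exI[of _ 0]) auto
    next
      case not_e1: False
      have GD: "G \<in> \<D>"
        using G not_e1 e(1)[OF G(1)] by (auto simp: \<P>_def)
      then have e2: "e2 G \<in> G" "e1 G \<noteq> e2 G" using e(2)[OF G(1)] by auto
      show ?thesis
      proof (cases "L = e2 G")
        case True
        then show ?thesis using not_e1 GD by (intro exI[of _ 0] exI[of _ 1]) auto
      next
        case False
        obtain P where P: "P \<in> S\<^sub>0" "G = through P" using GD by (auto simp: \<D>_def)
        then obtain v where v: "v \<noteq> (\<lambda>_. 0)" "P = proj_point v"
          using proj_plane_cases unfolding mem_S0 by metis
        have zero: "dot3 (c M) v = 0" "M \<in> A" if "M \<in> G" for M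
          using that incidence[of M v] v unfolding P(2) through_def by auto
        \<comment> \<open>The cross product of two lines of the pencil is its point up to a scalar,
          so a line through the point has its coefficient vector in their span.\<close>
        define n where "n = cross3 (c (e1 G)) (c (e2 G))"
        have n: "n \<noteq> (\<lambda>_. 0)"
          unfolding n_def using cross_nonzero zero e(1)[OF G(1)] e2 by blast
        obtain x where x: "v = (\<lambda>i. x * n i)"
          using orthogonal_to_both[OF zero(1)[OF e(1)[OF G(1)]] zero(1)[OF e2(1)]] n unfolding n_def by blast
        then have "x * dot3 (c L) n = 0" using zero(1)[OF G(2)] by (simp add: dot3_scale_right)
        moreover have "x \<noteq> 0" using x v(1) by auto
        ultimately have "dot3 (c L) n = 0" by simp
        then show ?thesis
          using span2[of "c (e1 G)" "c (e2 G)" "c L"] n GD not_e1 False unfolding n_def by blast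
      qed
    qed
    then show ?thesis unfolding coordinates_def using unique by blast
  qed
  then obtain r s where coordinates: "\<And>L. L \<in> A \<Longrightarrow> coordinates L (r L) (s L)"
    by metis
  have rs: "c L = (\<lambda>i. r L * c (e1 G) i + s L * c (e2 G) i) \<and> (G \<notin> \<D> \<longrightarrow> s L = 0)
      \<and> (L = e1 G \<longrightarrow> r L = 1 \<and> s L = 0) \<and> (G \<in> \<D> \<and> L = e2 G \<longrightarrow> r L = 0 \<and> s L = 1)"
    if "L \<in> A" "G \<in> \<P>" "L \<in> G" for L G
    using coordinates[OF that(1)] that(2,3) unfolding coordinates_def by blast
  have sub: "L \<in> A" if "G \<in> \<P>" "L \<in> G" for L G using \<P>_A that by blast
  have \<D>\<P>: "\<D> \<subseteq> \<P>" by (auto simp: \<P>_def)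
  obtain L0 where "L0 \<in> A" using assms by blast
  then obtain G\<^sub>0 where G0: "G\<^sub>0 \<in> \<P>" using \<P>_A by blast
  have "grouped_arrangement A c \<P> \<D> e1 e2 r s G\<^sub>0"
  proof
    show "finite A" by (rule finite_A)
    show "\<Union>\<P> = A" by (rule \<P>_A)
    show "\<D> \<subseteq> \<P>" by (rule \<D>\<P>)
    show "G\<^sub>0 \<in> \<P>" by (rule G0)
    show "c L \<noteq> (\<lambda>_. 0)" if "L \<in> A" for L by (rule c_nonzero[OF that])
    show "c L' \<noteq> (\<lambda>i. x * c L i)" if "L \<in> A" "L' \<in> A" "L \<noteq> L'" for L L' x by (rule not_proportional[OF that])
    show "G \<inter> H = {}" if "G \<in> \<P>" "H \<in> \<P>" "G \<noteq> H" for G H using \<P>_disjoint that by blast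
    show "e1 G \<in> G" if "G \<in> \<P>" for G by (rule e(1)[OF that])
    show "e2 G \<in> G" "e1 G \<noteq> e2 G" if "G \<in> \<D>" for G using e(2)[of G] that \<D>\<P> by auto
    show "G = {e1 G}" if "G \<in> \<P>" "G \<notin> \<D>" for G using that e(1)[OF that(1)] by (auto simp: \<P>_def)
    show "c L = (\<lambda>i. r L * c (e1 G) i + s L * c (e2 G) i)" if "G \<in> \<P>" "L \<in> G" for G L
      using rs[OF sub[OF that] that] by blast
    show "s L = 0" if "G \<in> \<P>" "G \<notin> \<D>" "L \<in> G" for G L
      using rs[OF sub[OF that(1,3)] that(1,3)] that by blast
    show "r (e1 G) = 1" "s (e1 G) = 0" if "G \<in> \<P>" for G
      using rs[OF sub[OF that e(1)[OF that]] that e(1)[OF that]] by auto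
    show "r (e2 G) = 0" "s (e2 G) = 1" if G: "G \<in> \<D>" for G
      using rs[of "e2 G" G] e(2)[of G] G \<D>\<P> sub[of G "e2 G"] by auto
    show "det3 (c L) (c L') (c L'') \<noteq> 0"
      if G: "G \<in> \<P>" "L \<in> G" and L': "L' \<in> A - G" and L'': "L'' \<in> A - {L, L'}" for G L L' L''
    proof
      assume det: "det3 (c L) (c L') (c L'') = 0"
      have L: "L \<in> A" "L' \<in> A" "L \<noteq> L'" using sub G L' by auto
      \<comment> \<open>The three lines would meet in the point given by \<open>n\<close>, which is
        then multiple. Its pencil contains \<open>L\<close>, so it is the group \<open>G\<close>,
        yet it also contains \<open>L'\<close>.\<close>
      define n where "n = cross3 (c L) (c L')"
      have n: "n \<noteq> (\<lambda>_. 0)" unfolding n_def by (rule cross_nonzero[OF L])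
      have "dot3 (c L) n = 0" "dot3 (c L') n = 0"
        unfolding n_def by (rule dot3_cross3_left)+
      moreover have "dot3 (c L'') n = 0"
        using det unfolding n_def by (simp add: dot3_eq det3_def algebra_simps)
      ultimately have sub3: "{L, L', L''} \<subseteq> through (proj_point n)"
        using incidence n L L'' unfolding through_def by auto
      have "L \<noteq> L''" "L' \<noteq> L''" using L'' by blast+
      then have "card {L, L', L''} = 3" using L(3) by simp
      then have "proj_point n \<in> S\<^sub>0"
        unfolding mem_S0 using proj_point_in_plane[OF n] card_mono[OF finite_through sub3] by simp
      then have "through (proj_point n) \<in> \<P>" by (auto simp: \<P>_def \<D>_def)
      then have "through (proj_point n) = G"
        using \<P>_disjoint[OF _ G(1) _ G(2)] sub3 by blast
      then show False using sub3 L' by blast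
    qed
  qed
  then show ?thesis by (rule that)
qed

lemma S0_empty:
  assumes "S\<^sub>0 = {}"
  shows "\<D> = {}" "card \<P> = card A" "simple_lines = A"
  using card_\<P> assms by (simp_all add: \<D>_def simple_lines_def)

lemma S0_empty_if_few: "card A \<le> 2 \<Longrightarrow> S\<^sub>0 = {}"
proof -
  assume "card A \<le> 2"
  moreover have "card (through P) \<le> card A" for P
    by (rule card_mono[OF finite_A]) (auto simp: through_def)
  ultimately have "\<not> 3 \<le> card (through P)" for P
    by (meson le_trans numeral_le_iff semiring_norm not_le less_le_trans lessI numeral_3_eq_3 numeral_2_eq_2)
  then show "S\<^sub>0 = {}" using mem_S0 by blast
qed

text \<open>One statement for two cases: \<open>V\<close> is empty for concurrent lines and consists
  of the exceptional line otherwise. Any multiple point lies on at least three lines, hence on one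
  that also contains \<open>P\<close>.\<close>

lemma S0_single:
  assumes "P \<in> S\<^sub>0" and "\<And>L. L \<in> A - V \<Longrightarrow> P \<in> L" and "V \<subseteq> A" "card V \<le> 1"
    and "\<And>L. L \<in> V \<Longrightarrow> P \<notin> L"
  shows "S\<^sub>0 = {P}" "simple_lines = V" "\<D> = {A - V}" "card \<P> = 1 + card V"
proof -
  have fin: "finite V" using finite_subset[OF assms(3) finite_A] .
  have eq: "Q = P" if Q: "Q \<in> S\<^sub>0" for Q
  proof -
    have "3 \<le> card (through Q)" using Q mem_S0 by blast
    then have "card V < card (through Q)" using assms(4) by simp
    then obtain L where L: "L \<in> through Q" "L \<notin> V"
      using card_mono[OF fin, of "through Q"] by (metis leD subsetI)
    then have "L \<in> A" "Q \<in> L" "P \<in> L" using assms(2) by (auto simp: through_def)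
    then show ?thesis using sparse assms(1) Q by blast
  qed
  then show S: "S\<^sub>0 = {P}" using assms(1) by blast
  show V: "simple_lines = V"
    using assms unfolding simple_lines_def S by blast
  have "through P = A - V"
    using assms by (auto simp: through_def)
  then show "\<D> = {A - V}" unfolding \<D>_def S by simp
  show "card \<P> = 1 + card V"
    using card_\<P> unfolding S V by simp
qed

lemma concurrent_if_few:
  assumes "card A \<le> 2"
  shows "concurrent A"
proof -
  consider "A = {}" | L where "A = {L}" | L L' where "A = {L, L'}"
  proof -
    from assms have "card A = 0 \<or> card A = 1 \<or> card A = 2" by auto
    then show ?thesis
      using that finite_A by (metis card_0_eq card_1_singletonE card_2_iff)
  qed
  then show ?thesis
  proof cases
    case 1
    have "proj_point (\<lambda>_. 1 :: 'k) \<in> proj_plane"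
      by (rule proj_point_in_plane) (simp add: fun_eq_iff)
    then show ?thesis using 1 unfolding concurrent_def by auto
  next
    case 2
    obtain P where "P \<in> proj_plane" "P \<in> L" using common_point[of L L] 2 by blast
    then show ?thesis using 2 unfolding concurrent_def by auto
  next
    case 3
    obtain P where "P \<in> proj_plane" "P \<in> L" "P \<in> L'" using common_point[of L L'] 3 by blast
    then show ?thesis using 3 unfolding concurrent_def by auto
  qed
qed

lemma card_Diff_1: "L \<in> A \<Longrightarrow> card (A - {L}) = card A - 1"
  using finite_A by simp

text \<open>Such lines form a triangle, and each vertex is on all lines but one. So they fall under
  the second case although there is no multiple point.\<close>

lemma three_not_concurrent:
  assumes "card A = 3" "\<not> concurrent A"
  shows "S\<^sub>0 = {}" "all_but_one_through_point A"
proof -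
  have "A = through P" if "3 \<le> card (through P)" for P
    using card_seteq[OF finite_A, of "through P"] that assms(1) by (auto simp: through_def)
  then show "S\<^sub>0 = {}"
    using assms(2) unfolding concurrent_def mem_S0[abs_def] multiple_points_def multiplicity_eq through_def by blast
  obtain L0 L1 L2 where L: "A = {L0, L1, L2}"
    using assms(1) by (metis card_3_iff)
  obtain P where P: "P \<in> proj_plane" "P \<in> L1" "P \<in> L2" using common_point[of L1 L2] L by blast
  then have "P \<notin> L0" using assms(2) L unfolding concurrent_def by auto
  then show "all_but_one_through_point A"
    unfolding all_but_one_through_point_def using P L by (intro bexI[of _ P] bexI[of _ L0]) auto
qed

text \<open>Two of the lines other than \<open>L\<^sub>0\<close> meet only in \<open>P\<close>, so
  no other point can be common to all.\<close>

lemma all_but_one_not_concurrent: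
  assumes "3 \<le> card A" "P \<in> proj_plane" "L\<^sub>0 \<in> A" "P \<notin> L\<^sub>0" "\<And>L. L \<in> A - {L\<^sub>0} \<Longrightarrow> P \<in> L"
  shows "\<not> concurrent A"
proof
  assume "concurrent A"
  then obtain Q where Q: "Q \<in> proj_plane" "\<And>L. L \<in> A \<Longrightarrow> Q \<in> L" unfolding concurrent_def by blast
  have "\<not> card (A - {L\<^sub>0}) \<le> Suc 0" using assms(1) card_Diff_1[OF assms(3)] by simp
  then obtain L L' where L: "L \<in> A - {L\<^sub>0}" "L' \<in> A - {L\<^sub>0}" "L \<noteq> L'"
    using card_le_Suc0_iff_eq[of "A - {L\<^sub>0}"] finite_A by blast
  have "P = Q"
    using unique_point[of L L' P Q] L assms Q by blast
  then show False using Q(2)[OF assms(3)] assms(4) by simp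
qed

lemma spanning_if_not_concurrent:
  assumes "\<not> concurrent A" "v \<noteq> (\<lambda>_. 0)"
  shows "\<exists>L\<in>A. dot3 (c L) v \<noteq> 0"
  using assms incidence proj_point_in_plane[OF assms(2)] unfolding concurrent_def by blast

end

text \<open>The grouping needs at least one line, so the empty arrangement is separate. Its Jacobian
  ideal is 0, which is saturated because the ring is a domain.\<close>

lemma empty_arrangement:
  "free_arrangement_poly (1 :: 'k::field poly3)"
proof -
  have jac: "jacobian_ideal (1 :: 'k poly3) = {0}"
    by (auto simp: jacobian_ideal_iff)
  have "u = 0" if "u \<in> saturation {0 :: 'k poly3}" for u
  proof -
    have "ideal {0 :: 'k poly3} S_ring"
      by (rule S_ring_idealI) auto
    from that obtain n where "variable 0 ^ n * u = 0"
      unfolding saturation_iff[OF \<open>ideal {0} S_ring\<close>] by blast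
    then show ?thesis by simp
  qed
  moreover have "0 \<in> saturation {0 :: 'k poly3}"
    by (simp add: saturation_def)
  ultimately show ?thesis
    unfolding free_arrangement_poly_def jac by blast
qed

text \<open>The bounds on \<open>d\<close> exclude degenerate ideals: with at most one line the
  Jacobian ideal is 0 or the whole ring, and two lines also satisfy
  \<open>all_but_one_through_point\<close> although two generators suffice for them.\<close>

theorem theorem9p6:
  fixes A :: "(3 \<Rightarrow> 'k::field_char_0) set set set"
    and f :: "'k poly3"
    and d s n :: nat
    and S\<^sub>0 :: "(3 \<Rightarrow> 'k) set set"
    and t :: "(3 \<Rightarrow> 'k) set \<Rightarrow> nat"
  assumes "line_arrangement A"
    and "card A = d"
    and "arrangement_poly A f"
    and "S\<^sub>0 = multiple_points A"
    and "n = card S\<^sub>0"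
    and "t = point_multiplicity A"
    and "\<forall>L\<in>A. \<forall>P\<in>S\<^sub>0. \<forall>Q\<in>S\<^sub>0. P \<in> L \<and> Q \<in> L \<longrightarrow> P = Q"
    and "s = card {L \<in> A. \<forall>P\<in>S\<^sub>0. P \<notin> L}"
  shows
    "(concurrent A \<longrightarrow>
        free_arrangement_poly f \<and>
        (d \<ge> 2 \<longrightarrow> has_graded_minimal_free_resolution (ideal_module (jacobian_ideal f))
           [replicate_mset 2 (- int d + 1),
            {# - 2 * int d + 2 #}])) \<and>
     (all_but_one_through_point A \<longrightarrow>
        free_arrangement_poly f \<and>
        (d \<ge> 3 \<longrightarrow> has_graded_minimal_free_resolution (ideal_module (jacobian_ideal f))
           [replicate_mset 3 (- int d + 1),
            {# - 2 * int d + 3, - int d #}])) \<and>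
     (\<not> concurrent A \<and> \<not> all_but_one_through_point A \<longrightarrow>
        \<not> free_arrangement_poly f \<and>
        has_graded_minimal_free_resolution (milnor_module f)
           [replicate_mset (2 * n + s - 3) (- int d + 1),
            replicate_mset (n + s - 1) (- int d) +
              {# - int d - int (t P) + 2. P \<in># mset_set S\<^sub>0 #},
            replicate_mset (n + s - 1) (- 2 * int d + 3) +
              {# - 2 * int d + int (t P) + 1. P \<in># mset_set S\<^sub>0 #},
            replicate_mset (2 * n + s - 3) (- 2 * int d + 2)] \<and>
        has_graded_minimal_free_resolution (ideal_module (jacobian_ideal f))
           [replicate_mset 3 (- int d + 1),
            replicate_mset (n + s - 1) (- 2 * int d + 3) +
              {# - 2 * int d + int (t P) + 1. P \<in># mset_set S\<^sub>0 #},
            replicate_mset (2 * n + s - 3) (- 2 * int d + 2)])"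
proof -
  obtain lf where lf: "\<And>L. L \<in> A \<Longrightarrow> linear_form_of_line (lf L) L" and f: "f = (\<Prod>L\<in>A. lf L)"
    using assms(3) unfolding arrangement_poly_def by blast
  define c where "c = (\<lambda>L i. Poly_Mapping.lookup (lf L) (Poly_Mapping.single i 1))"
  have lin: "lf L = lin (c L)" if "L \<in> A" for L
    using lf[OF that] lin_lookup unfolding linear_form_of_line_def c_def by blast
  interpret S: sparse_arrangement A c
  proof
    show "finite A" using assms(1) by (simp add: line_arrangement_def)
    show "c L \<noteq> (\<lambda>_. 0)" "L = zero_locus (lin (c L))" if "L \<in> A" for L
      using lf[OF that] lin[OF that] lin_eq_0_iff[of "c L"] unfolding linear_form_of_line_def by auto
    show "P = Q" if "L \<in> A" "P \<in> multiple_points A" "Q \<in> multiple_points A" "P \<in> L" "Q \<in> L" for L P Q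
      using assms(4,7) that by blast
  qed
  have n: "card S.\<D> = n" and s: "card S.\<P> = n + s"
    using S.card_\<D> S.card_\<P> assms(4,5,8) by (simp_all add: S.simple_lines_def)
  show ?thesis
  proof (cases "A = {}")
    case True
    have "concurrent A" using True by (intro S.concurrent_if_few) simp
    moreover have "f = 1" "d = 0" "\<not> all_but_one_through_point A"
      using True f assms(2) by (simp_all add: all_but_one_through_point_def)
    ultimately show ?thesis using empty_arrangement by simp
  next
    case False
    obtain e1 e2 r s' G0 where "grouped_arrangement A c S.\<P> S.\<D> e1 e2 r s' G0"
      by (rule S.grouping[OF False])
    then interpret G: grouped_arrangement A c S.\<P> S.\<D> e1 e2 r s' G0 .
    have f: "f = G.lprod A"
      unfolding f G.lprod_def using lin by (intro prod.cong) auto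
    have E: "card G.E = 2 * n + s"
      using G.card_E n s by simp
    have few: "free_arrangement_poly f" if "card G.E \<le> 2"
      unfolding f by (rule G.independent_case(1)[OF G.independent_at_most_two[OF that]])
    have res_few: "has_graded_minimal_free_resolution (ideal_module (jacobian_ideal f))
      [replicate_mset (2 * n + s) (- int d + 1),
       replicate_mset (card S.\<P> - 1) (- int d) + {# - int d + 2 - int (card H). H \<in># mset_set S.\<D> #}]"
      if "card G.E \<le> 2"
      using G.independent_case(2)[OF G.independent_at_most_two[OF that]] E G.card_E
      unfolding f assms(2) by simp
    have image: "{# g (card H). H \<in># mset_set S.\<D> #} = {# g (t P). P \<in># mset_set S\<^sub>0 #}" for g :: "nat \<Rightarrow> int"
      using S.image_mset_\<D> assms(4,6) by simp
    have a: "free_arrangement_poly f \<and>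
        (d \<ge> 2 \<longrightarrow> has_graded_minimal_free_resolution (ideal_module (jacobian_ideal f))
           [replicate_mset 2 (- int d + 1), {# - 2 * int d + 2 #}])" if conc: "concurrent A"
    \<comment> \<open>Three or more concurrent lines form one pencil with its Koszul relation. Two
      lines are two singletons, and the difference of their Euler relations has the same twist
      because \<open>- d = - 2 * d + 2\<close>.\<close>
    proof (cases "d \<ge> 3")
      case True
      obtain P where P: "P \<in> proj_plane" "\<And>L. L \<in> A \<Longrightarrow> P \<in> L" using conc unfolding concurrent_def by blast
      then have "S.through P = A" by (auto simp: S.through_def)
      then have "P \<in> multiple_points A" using True P(1) assms(2) by (simp add: S.mem_S0)
      note single = S.S0_single[OF this, of "{}"]
      have \<D>: "S.\<D> = {A}" and "card S.\<P> = 1" using single P(2) by simp_all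
      then have "n = 1" "s = 0" using n s by simp_all
      then show ?thesis
        using few res_few E \<D> \<open>card S.\<P> = 1\<close> assms(2) by (simp add: numeral_2_eq_2)
    next
      case False
      then have "multiple_points A = {}" using assms(2) by (intro S.S0_empty_if_few) simp
      note S.S0_empty[OF this]
      then have \<D>: "S.\<D> = {}" and "n = 0" "s = d" using n s assms(2) by simp_all
      have "has_graded_minimal_free_resolution (ideal_module (jacobian_ideal f))
           [replicate_mset 2 (- int d + 1), {# - 2 * int d + 2 #}]" if "d \<ge> 2"
      proof -
        have "d = 2" using that False by simp
        then show ?thesis
          using res_few E \<D> \<open>n = 0\<close> \<open>s = d\<close> s by (simp add: numeral_2_eq_2)
      qed
      then show ?thesis using few E \<open>n = 0\<close> \<open>s = d\<close> False by simp
    qed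
    have b: "free_arrangement_poly f \<and>
        (d \<ge> 3 \<longrightarrow> has_graded_minimal_free_resolution (ideal_module (jacobian_ideal f))
           [replicate_mset 3 (- int d + 1), {# - 2 * int d + 3, - int d #}])" if all: "all_but_one_through_point A"
    proof (cases "d \<ge> 3")
      case False
      then have "concurrent A" using assms(2) by (intro S.concurrent_if_few) simp
      then show ?thesis using a False by blast
    next
      case True
      obtain P L0 where P: "P \<in> proj_plane" "L0 \<in> A" "P \<notin> L0" "\<And>L. L \<in> A - {L0} \<Longrightarrow> P \<in> L"
        using all unfolding all_but_one_through_point_def by blast
      have not_conc: "\<not> concurrent A"
        using S.all_but_one_not_concurrent[OF _ P] True assms(2) by simp
      \<comment> \<open>A triangle has three singletons and two Euler differences of twist -3.
        Otherwise there are one pencil and one singleton, hence one Euler difference and one Koszul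
        relation.\<close>
      have counts: "2 * n + s = 3 \<and> replicate_mset (card S.\<P> - 1) (- int d) +
          {# - int d + 2 - int (card H). H \<in># mset_set S.\<D> #} = {# - 2 * int d + 3, - int d #}"
      proof (cases "d = 3")
        case True
        then have "multiple_points A = {}" using S.three_not_concurrent(1) not_conc assms(2) by simp
        note S.S0_empty[OF this]
        then show ?thesis using n s assms(2) True by (simp add: numeral_2_eq_2)
      next
        case False
        have "S.through P = A - {L0}" using P by (auto simp: S.through_def)
        then have "P \<in> multiple_points A"
          using False True P(1) assms(2) S.card_Diff_1[OF P(2)] by (simp add: S.mem_S0)
        note single = S.S0_single[OF this, of "{L0}"]
        have \<D>: "S.\<D> = {A - {L0}}" "card S.\<P> = 2" using single P by simp_all
        moreover have "int (card (A - {L0})) = int d - 1"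
          using S.card_Diff_1[OF P(2)] True assms(2) by simp
        moreover have "n = 1" "s = 1" using n s \<D> by simp_all
        ultimately show ?thesis by simp
      qed
      obtain x0 x1 x2 where x: "x0 \<in> G.E" "x1 \<in> G.E" "x2 \<in> G.E"
        "det3 (c (G.line_of x0)) (c (G.line_of x1)) (c (G.line_of x2)) \<noteq> 0"
        by (rule G.spanning_lines[OF S.spanning_if_not_concurrent[OF not_conc]])
      have E3: "card G.E = 3" using E counts by simp
      note ind = G.independent_case[OF G.independent_three[OF E3 x]]
      show ?thesis
        using ind(1) ind(2) counts E3 G.card_E unfolding f[symmetric] assms(2) by simp
    qed
    have c: "\<not> free_arrangement_poly f \<and>
        has_graded_minimal_free_resolution (milnor_module f)
           [replicate_mset (2 * n + s - 3) (- int d + 1),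
            replicate_mset (n + s - 1) (- int d) + {# - int d - int (t P) + 2. P \<in># mset_set S\<^sub>0 #},
            replicate_mset (n + s - 1) (- 2 * int d + 3) + {# - 2 * int d + int (t P) + 1. P \<in># mset_set S\<^sub>0 #},
            replicate_mset (2 * n + s - 3) (- 2 * int d + 2)] \<and>
        has_graded_minimal_free_resolution (ideal_module (jacobian_ideal f))
           [replicate_mset 3 (- int d + 1),
            replicate_mset (n + s - 1) (- 2 * int d + 3) + {# - 2 * int d + int (t P) + 1. P \<in># mset_set S\<^sub>0 #},
            replicate_mset (2 * n + s - 3) (- 2 * int d + 2)]"
      if not_conc: "\<not> concurrent A" and not_all: "\<not> all_but_one_through_point A"
    proof -
      have "d \<noteq> 3" using S.three_not_concurrent(2)[OF _ not_conc] not_all assms(2) by blast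
      moreover have "\<not> d \<le> 2" using S.concurrent_if_few not_conc assms(2) by blast
      ultimately have d4: "4 \<le> card A" using assms(2) by simp
      \<comment> \<open>A pencil that misses at most one line would put the arrangement into one of
        the first two cases.\<close>
      have small: "card H + 2 \<le> card A" if H\<D>: "H \<in> S.\<D>" for H
      proof (rule ccontr)
        assume "\<not> card H + 2 \<le> card A"
        obtain P where P: "P \<in> proj_plane" "H = S.through P"
          using H\<D> unfolding S.\<D>_def S.mem_S0[abs_def] multiple_points_def by blast
        have H: "H \<subseteq> A" using P(2) by (auto simp: S.through_def)
        have "card (A - H) \<le> 1"
          using \<open>\<not> card H + 2 \<le> card A\<close> card_Diff_subset[OF finite_subset[OF H S.finite_A] H] by simp
        then consider "A - H = {}" | L where "A - H = {L}"
          using S.finite_A by (metis One_nat_def card_0_eq card_1_singletonE finite_Diff le_Suc_eq le_zero_eq)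
        then show False
        proof cases
          case 1
          then have "concurrent A"
            using P unfolding concurrent_def S.through_def by blast
          then show ?thesis using not_conc by blast
        next
          case 2
          then have "L \<in> A" "P \<notin> L" "\<forall>L'\<in>A - {L}. P \<in> L'"
            using P(2) unfolding S.through_def by blast+
          then have "all_but_one_through_point A"
            unfolding all_but_one_through_point_def using P(1) by blast
          then show ?thesis using not_all by blast
        qed
      qed
      \<comment> \<open>Without multiple points \<open>s = d\<close> is at least 4; with one of
        them, at least two lines avoid it; two of them already count 4.\<close>
      have more: "3 < 2 * n + s"
      proof -
        consider "n = 0" | "n = 1" | "n \<ge> 2" by linarith
        then show ?thesis
        proof cases
          case 1
          then have "multiple_points A = {}" using n S.card_\<D> S.finite_S0 by simp
          then show ?thesis using S.S0_empty[of] d4 s 1 by simp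
        next
          case 2
          then obtain H where H: "S.\<D> = {H}" using n by (metis card_1_singletonE)
          then have "card H + 2 \<le> card A" using small by blast
          moreover have "A = H \<union> S.simple_lines"
            using G.Union_\<P> unfolding S.\<P>_def H by auto
          then have "card A \<le> card H + card S.simple_lines" by (metis card_Un_le)
          moreover have "card S.simple_lines = s" using s n S.card_\<P> S.card_\<D> by simp
          ultimately show ?thesis using 2 by simp
        next
          case 3
          then show ?thesis by simp
        qed
      qed
      obtain x0 x1 x2 where x: "x0 \<in> G.E" "x1 \<in> G.E" "x2 \<in> G.E"
        "det3 (c (G.line_of x0)) (c (G.line_of x1)) (c (G.line_of x2)) \<noteq> 0"
        by (rule G.spanning_lines[OF S.spanning_if_not_concurrent[OF not_conc]])
      have nums: "card S.\<P> + card S.\<D> - 3 = 2 * n + s - 3" "card S.\<P> - 1 = n + s - 1"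
        "3 < card S.\<P> + card S.\<D>"
        using n s more by simp_all
      have im1: "{# - int d + 2 - int (card H). H \<in># mset_set S.\<D> #} = {# - int d - int (t P) + 2. P \<in># mset_set S\<^sub>0 #}"
        unfolding image[of "\<lambda>k. - int d + 2 - int k"] by (simp add: algebra_simps)
      have im2: "{# - 2 * int d + 1 + int (card H). H \<in># mset_set S.\<D> #} = {# - 2 * int d + int (t P) + 1. P \<in># mset_set S\<^sub>0 #}"
        unfolding image[of "\<lambda>k. - 2 * int d + 1 + int k"] by (simp add: algebra_simps)
      show ?thesis
        using G.spanning_case[OF x d4 nums(3) small]
        unfolding f[symmetric] nums(1,2) assms(2) im1 im2 by blast
    qed
    show ?thesis using a b c by blast
  qed
qed

end
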